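(* Let $D$ be a skeletal directed acyclic graph. Consider any congruence $\equiv$ of $\mathcal{AR}_D$, and let $\rho_1,\dots,\rho_p$ denote the ropes generating the lower ideal $\mathbb{I}_\equiv$ of the subrope order. Then the quotient fan $\mathcal{F}_\equiv$ is (1) the common refinement of the Cambrian fans $\mathcal{F}_{\rho_1},\dots,\mathcal{F}_{\rho_p}$; (2) the normal fan of the Minkowski sum of the Cambrian associahedra $\mathbb{A}_{\rho_1},\dots,\mathbb{A}_{\rho_p}$.
   Context: All directed graphs are finite and simple. A reorientation of a directed acyclic graph $D=(V,A)$ is a directed graph with the same underlying undirected graph, encoded by the set of arcs of $D$ that it reverses. $\mathcal{AR}_D$ is the poset of acyclic reorientations of $D$ ordered by inclusion of sets of reversed arcs. The transitive reduction of a directed acyclic graph is obtained by deleting all arcs whose endpoints are connected by a directed path of length at least $2$. A directed graph is a forest if its underlying undirected graph has no cycle. $D$ is vertebrate if the transitive reduction of every induced subgraph of $D$ is a forest; filled if for any directed path $\pi$ in $D$ whose endpoints are joined by an arc of $D$, all arcs joining any two vertices of $\pi$ belong to $D$; skeletal if vertebrate and filled. When $D$ is skeletal, $\mathcal{AR}_D$ is a lattice. A congruence of a lattice is an equivalence relation compatible with meets and joins; it contracts a join irreducible $J$ (covering a unique element $J_\star$) if $J_\star\equiv J$. Ropes. The transitive support of an arc $(u,v)$ of $D$ is the set of vertices appearing along directed paths in $D$ from $u$ to $v$. A rope of $D$ is a quadruple $(u,v,\nabla,\Delta)$ where $(u,v)\in A$ and $\nabla\sqcup\Delta$ is a partition of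 the transitive support of $(u,v)$ minus $\{u,v\}$. A rope $(u,v,\nabla,\Delta)$ is a subrope of $(u',v',\nabla',\Delta')$ if $\{u,v\}\subseteq\{u',v'\}\cup\nabla'\cup\Delta'$, $\nabla\subseteq\nabla'$ and $\Delta\subseteq\Delta'$; this defines the subrope order. For a rope $\rho=(u,v,\nabla,\Delta)$, let $I_\vee(\rho)$ be the acyclic reorientation of $D$ where an arc $(w,w')$ of $D$ is reversed if and only if $w\in\Delta\cup\{u\}$ and $w'\in\nabla\cup\{v\}$; $\rho\mapsto I_\vee(\rho)$ is a bijection from ropes of $D$ to join irreducibles of $\mathcal{AR}_D$. For a congruence $\equiv$, $\mathbb{I}_\equiv$ is the set of ropes $\rho$ such that $I_\vee(\rho)$ is not contracted by $\equiv$; $\equiv\ \mapsto\mathbb{I}_\equiv$ is a bijection from congruences of $\mathcal{AR}_D$ to lower ideals of the subrope order. The ropes generating $\mathbb{I}_\equiv$ are its maximal elements. For a rope $\rho$, $\equiv_\rho$ is the congruence whose ideal is the set of all subropes of $\rho$. Fans. For an acyclic reorientation $E$ of $D$, let $\mathbb{C}_E=\{x\in\mathbb{R}^V : x_u\le x_v\text{ for all arcs }(u,v)\text{ of }E\}$. The quotient fan $\mathcal{F}_\equiv$ is the complete fan in $\mathbb{R}^V$ whose chambers are the unions $\bigcup_{E\in X}\mathbb{C}_E$ over the $\equiv$-classes $X$ (these are known to be the chambers of a fan). The Cambrian fan $\mathcal{F}_\rho$ is the quotient fan of $\equiv_\rho$. The normal fan of a polytope $P\subset\mathbb{R}^V$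 is formed by the normal cones of its faces, where the normal cone of a face $F$ is the (closed) cone of vectors $v$ for which $x\mapsto\langle v,x\rangle$ is maximized over $P$ at all points of $F$. An empty Minkowski sum is $\{0\}$, and an empty common refinement is the fan $\{\mathbb{R}^V\}$. Cambrian associahedron $\mathbb{A}_\rho$. Let $\rho=(u,v,\nabla,\Delta)$, and let $u=v_1,v_2,\dots,v_n=v$ be the vertices in order along the directed path from $u$ to $v$ in the transitive reduction of $D$, so that $S=\{v_1,\dots,v_n\}=\{u,v\}\cup\nabla\cup\Delta$. For $U\subseteq V$ write $\mathbf{1}_U=\sum_{w\in U}e_w$. Then $\mathbb{A}_\rho$ is the Hohlweg--Lange associahedron of signature $(\nabla,\Delta)$ embedded in $\mathbb{R}^V$: the set of $x\in\mathbb{R}^V$ with $x_w=0$ for $w\notin S$, $\langle\mathbf{1}_S,x\rangle=\binom{n+1}{2}$, and $\langle\mathbf{1}_U,x\rangle\ge\binom{|U|+1}{2}$ for all $\varnothing\ne U\subsetneq S$ such that for all $1\le i<j<k\le n$: if $v_i,v_k\in U$ and $v_j\in\nabla$ then $v_j\in U$; and if $v_i,v_k\notin U$ and $v_j\in\Delta$ then $v_j\notin U$. *)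

theory Defs
  imports "HOL-Analysis.Analysis" "HOL-Library.Set_Algebras" "HOL-Algebra.Lattice"
begin

text \<open>A directed graph is given by its set \<open>A\<close> of arcs \<open>(u, v)\<close>; its vertices are all elements of
  the finite type \<open>'v\<close>. Acyclic digraphs have neither loops nor opposite pairs of arcs, so they are
  simple.\<close>

section \<open>Skeletal directed acyclic graphs\<close>

definition directed_path :: "('v \<times> 'v) set \<Rightarrow> 'v list \<Rightarrow> bool" where
  "directed_path A p \<longleftrightarrow> p \<noteq> [] \<and> distinct p \<and> successively (\<lambda>x y. (x, y) \<in> A) p"

definition path_from_to :: "('v \<times> 'v) set \<Rightarrow> 'v \<Rightarrow> 'v list \<Rightarrow> 'v \<Rightarrow> bool" where
  "path_from_to A u p v \<longleftrightarrow> directed_path A p \<and> hd p = u \<and> last p = v"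

text \<open>Paths are lists of vertices: a path with at least 3 vertices has length at least 2.\<close>

definition transitive_reduction :: "('v \<times> 'v) set \<Rightarrow> ('v \<times> 'v) set" where
  "transitive_reduction A = {(u, v) \<in> A. \<not> (\<exists>p. path_from_to A u p v \<and> 3 \<le> length p)}"

definition induced_subgraph :: "('v \<times> 'v) set \<Rightarrow> 'v set \<Rightarrow> ('v \<times> 'v) set" where
  "induced_subgraph A U = A \<inter> U \<times> U"

definition forest :: "('v \<times> 'v) set \<Rightarrow> bool" where
  "forest A \<longleftrightarrow>
     \<not> (\<exists>p. directed_path (A \<union> A\<inverse>) p \<and> 3 \<le> length p \<and> (last p, hd p) \<in> A \<union> A\<inverse>)"

definition vertebrate :: "('v \<times> 'v) set \<Rightarrow> bool" where
  "vertebrate A \<longleftrightarrow> (\<forall>U. forest (transitive_reduction (induced_subgraph A U)))"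

text \<open>In the acyclic case, an arc joining two vertices of a directed path points from the earlier to
  the later one.\<close>

definition filled :: "('v \<times> 'v) set \<Rightarrow> bool" where
  "filled A \<longleftrightarrow>
     (\<forall>p. directed_path A p \<longrightarrow> (hd p, last p) \<in> A \<longrightarrow> sorted_wrt (\<lambda>x y. (x, y) \<in> A) p)"

definition skeletal :: "('v \<times> 'v) set \<Rightarrow> bool" where
  "skeletal A \<longleftrightarrow> vertebrate A \<and> filled A"

section \<open>Acyclic reorientations and lattice congruences\<close>

definition reorient :: "('v \<times> 'v) set \<Rightarrow> ('v \<times> 'v) set \<Rightarrow> ('v \<times> 'v) set" where
  "reorient A R = (A - R) \<union> R\<inverse>"

definition acyclic_reorientations :: "('v \<times> 'v) set \<Rightarrow> ('v \<times> 'v) set set" where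
  "acyclic_reorientations A = {R. R \<subseteq> A \<and> acyclic (reorient A R)}"

definition AR :: "('v \<times> 'v) set \<Rightarrow> ('v \<times> 'v) set gorder" where
  "AR A = \<lparr>carrier = acyclic_reorientations A, eq = (=), le = (\<subseteq>)\<rparr>"

text \<open>Congruences are only considered for orders that are lattices, where the operations below are
  the genuine meet and join. They are not the intersection and union of sets, even for \<^term>\<open>AR A\<close>.\<close>

definition lattice_congruence :: "('a, 'b) gorder_scheme \<Rightarrow> ('a \<times> 'a) set \<Rightarrow> bool" where
  "lattice_congruence L r \<longleftrightarrow> equiv (carrier L) r \<and>
     (\<forall>(x, x') \<in> r. \<forall>(y, y') \<in> r.
        (x \<sqinter>\<^bsub>L\<^esub> y, x' \<sqinter>\<^bsub>L\<^esub> y') \<in> r \<and> (x \<squnion>\<^bsub>L\<^esub> y, x' \<squnion>\<^bsub>L\<^esub> y') \<in> r)"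

definition covered_by :: "('a, 'b) gorder_scheme \<Rightarrow> 'a \<Rightarrow> 'a \<Rightarrow> bool" where
  "covered_by L x y \<longleftrightarrow> x \<in> carrier L \<and> y \<in> carrier L \<and> x \<sqsubset>\<^bsub>L\<^esub> y \<and>
     \<not> (\<exists>z \<in> carrier L. x \<sqsubset>\<^bsub>L\<^esub> z \<and> z \<sqsubset>\<^bsub>L\<^esub> y)"

definition join_irreducible :: "('a, 'b) gorder_scheme \<Rightarrow> 'a \<Rightarrow> bool" where
  "join_irreducible L J \<longleftrightarrow> J \<in> carrier L \<and> (\<exists>!K. covered_by L K J)"

definition contracts :: "('a, 'b) gorder_scheme \<Rightarrow> ('a \<times> 'a) set \<Rightarrow> 'a \<Rightarrow> bool" where
  "contracts L r J \<longleftrightarrow> join_irreducible L J \<and> ((THE K. covered_by L K J), J) \<in> r"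

section \<open>Ropes\<close>

text \<open>The rope \<open>(u, v, \<nabla>, \<Delta>)\<close> is written \<open>(u, v, dn, up)\<close>.\<close>

type_synonym 'v rope = "'v \<times> 'v \<times> 'v set \<times> 'v set"

definition transitive_support :: "('v \<times> 'v) set \<Rightarrow> 'v \<Rightarrow> 'v \<Rightarrow> 'v set" where
  "transitive_support A u v = {w. \<exists>p. path_from_to A u p v \<and> w \<in> set p}"

definition ropes :: "('v \<times> 'v) set \<Rightarrow> 'v rope set" where
  "ropes A = {(u, v, dn, up). (u, v) \<in> A \<and> dn \<inter> up = {} \<and>
                dn \<union> up = transitive_support A u v - {u, v}}"

fun subrope :: "'v rope \<Rightarrow> 'v rope \<Rightarrow> bool" where
  "subrope (u, v, dn, up) (u', v', dn', up') \<longleftrightarrow>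
     {u, v} \<subseteq> {u', v'} \<union> dn' \<union> up' \<and> dn \<subseteq> dn' \<and> up \<subseteq> up'"

fun rope_join_irreducible :: "('v \<times> 'v) set \<Rightarrow> 'v rope \<Rightarrow> ('v \<times> 'v) set" where
  "rope_join_irreducible A (u, v, dn, up) =
     {(w, w') \<in> A. w \<in> up \<union> {u} \<and> w' \<in> dn \<union> {v}}"

definition rope_ideal ::
    "('v \<times> 'v) set \<Rightarrow> (('v \<times> 'v) set \<times> ('v \<times> 'v) set) set \<Rightarrow> 'v rope set" where
  "rope_ideal A r = {\<rho> \<in> ropes A. \<not> contracts (AR A) r (rope_join_irreducible A \<rho>)}"

definition generating_ropes ::
    "('v \<times> 'v) set \<Rightarrow> (('v \<times> 'v) set \<times> ('v \<times> 'v) set) set \<Rightarrow> 'v rope set" where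
  "generating_ropes A r =
     {\<rho> \<in> rope_ideal A r. \<forall>\<sigma> \<in> rope_ideal A r. subrope \<rho> \<sigma> \<longrightarrow> \<sigma> = \<rho>}"

text \<open>For skeletal \<open>A\<close>, a congruence is determined by its rope ideal, and every lower ideal of the
  subrope order arises, so the following description is meaningful.\<close>

definition rope_congruence ::
    "('v \<times> 'v) set \<Rightarrow> 'v rope \<Rightarrow> (('v \<times> 'v) set \<times> ('v \<times> 'v) set) set" where
  "rope_congruence A \<rho> =
     (THE r. lattice_congruence (AR A) r \<and> rope_ideal A r = {\<sigma> \<in> ropes A. subrope \<sigma> \<rho>})"

section \<open>Fans\<close>

text \<open>A fan is represented by the set of all its cones.\<close>

definition reorientation_cone ::
    "('v \<times> 'v) set \<Rightarrow> ('v \<times> 'v) set \<Rightarrow> (real ^ 'v::finite) set" where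
  "reorientation_cone A R = {x. \<forall>(u, v) \<in> reorient A R. x $ u \<le> x $ v}"

definition quotient_chambers ::
    "('v \<times> 'v) set \<Rightarrow> (('v \<times> 'v) set \<times> ('v \<times> 'v) set) set \<Rightarrow> (real ^ 'v::finite) set set" where
  "quotient_chambers A r =
     (\<lambda>X. \<Union>R \<in> X. reorientation_cone A R) ` (acyclic_reorientations A // r)"

text \<open>A complete fan consists of its chambers and all their nonempty faces.\<close>

definition quotient_fan ::
    "('v \<times> 'v) set \<Rightarrow> (('v \<times> 'v) set \<times> ('v \<times> 'v) set) set \<Rightarrow> (real ^ 'v::finite) set set" where
  "quotient_fan A r = {F. F \<noteq> {} \<and> (\<exists>C \<in> quotient_chambers A r. F face_of C)}"

definition cambrian_fan :: "('v \<times> 'v) set \<Rightarrow> 'v rope \<Rightarrow> (real ^ 'v::finite) set set" where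
  "cambrian_fan A \<rho> = quotient_fan A (rope_congruence A \<rho>)"

text \<open>For \<open>I = {}\<close> this is \<open>{UNIV}\<close>.\<close>

definition common_refinement :: "'i set \<Rightarrow> ('i \<Rightarrow> 'a set set) \<Rightarrow> 'a set set" where
  "common_refinement I \<F> = {\<Inter>i \<in> I. C i | C. \<forall>i \<in> I. C i \<in> \<F> i}"

definition normal_cone :: "'a::real_inner set \<Rightarrow> 'a set \<Rightarrow> 'a set" where
  "normal_cone P F = {v. \<forall>x \<in> F. \<forall>y \<in> P. v \<bullet> y \<le> v \<bullet> x}"

definition normal_fan :: "'a::real_inner set \<Rightarrow> 'a set set" where
  "normal_fan P = {normal_cone P F | F. F face_of P \<and> F \<noteq> {}}"

section \<open>Cambrian associahedra\<close>

definition ones :: "'v set \<Rightarrow> real ^ 'v::finite" where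
  "ones U = (\<Sum>w \<in> U. axis w 1)"

text \<open>The Hohlweg--Lange associahedron of signature \<open>(\<nabla>, \<Delta>)\<close> on the ordered list \<open>vs\<close> of vertices,
  embedded in the space indexed by all vertices.\<close>

definition associahedron_facet_set :: "'v list \<Rightarrow> 'v set \<Rightarrow> 'v set \<Rightarrow> 'v set \<Rightarrow> bool" where
  "associahedron_facet_set vs dn up U \<longleftrightarrow> U \<noteq> {} \<and> U \<subset> set vs \<and>
     (\<forall>i j k. i < j \<and> j < k \<and> k < length vs \<longrightarrow>
        (vs ! i \<in> U \<and> vs ! k \<in> U \<and> vs ! j \<in> dn \<longrightarrow> vs ! j \<in> U) \<and>
        (vs ! i \<notin> U \<and> vs ! k \<notin> U \<and> vs ! j \<in> up \<longrightarrow> vs ! j \<notin> U))"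

definition associahedron :: "'v list \<Rightarrow> 'v set \<Rightarrow> 'v set \<Rightarrow> (real ^ 'v::finite) set" where
  "associahedron vs dn up =
     {x. (\<forall>w. w \<notin> set vs \<longrightarrow> x $ w = 0) \<and>
         ones (set vs) \<bullet> x = real ((length vs + 1) choose 2) \<and>
         (\<forall>U. associahedron_facet_set vs dn up U \<longrightarrow> ones U \<bullet> x \<ge> real ((card U + 1) choose 2))}"

text \<open>The path is unique because the transitive reduction of a vertebrate digraph is a forest.\<close>

fun cambrian_associahedron :: "('v \<times> 'v) set \<Rightarrow> 'v rope \<Rightarrow> (real ^ 'v::finite) set" where
  "cambrian_associahedron A (u, v, dn, up) =
     associahedron (THE vs. path_from_to (transitive_reduction A) u vs v) dn up"

end

theory Submission
  imports Defs
begin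

text \<open>Each associahedron is the base polytope of a supermodular set function, read off from paths in
  a polygon. Hence every acyclic reorientation \<open>E\<close> selects a vertex, which maximizes all linear
  functions in the cone of \<open>E\<close>. Reversing an arc \<open>(u, v)\<close> that is flippable in \<open>E\<close> moves this vertex
  by a nonnegative multiple of \<open>e\<^sub>u - e\<^sub>v\<close>, and the multiple is a mixed second difference of the set
  function: it vanishes unless the rope of the flip (the arc, with the remaining vertices of its
  transitive support sorted into those below and those above it in \<open>E\<close>) is a subrope of the rope of
  the associahedron.

  On the lattice side, a flip is contracted by a congruence if and only if its rope is not in the
  rope ideal, and a congruence is determined by the flips it contracts. A linear function in the
  interior of the cone of \<open>E'\<close> increases along every flip towards \<open>E'\<close> that moves the vertex; so two
  reorientations are congruent if and only if they select the same vertex of the Minkowski sum of the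
  associahedra of the generating ropes, and the chambers of the quotient fan are the normal cones of
  these vertices. The first claim follows from the second one, applied to the given congruence and to
  the congruences generated by single ropes.\<close>

section \<open>Skeletal graphs and acyclic reorientations\<close>

text \<open>The obstacle is that the associahedron is described by inequalities for certain subsets
  only, whereas the greedy choice of a vertex needs a sharp lower bound for every subset
  \<open>W\<close>. The bound comes from writing the indicator function of \<open>W\<close>, up to a
  multiple of the all-ones function, as the sum of the indicator functions of the sets below the
  diagonals of a polygon path: the facet inequalities add up along the path, and a count modulo
  \<open>n\<close> shows that facet sets get back their own inequality. Second differences of this
  bound are computable because the right-hand sides are quadratic in the size of a set, and the size
  of the set below a diagonal is a function of its right end minus a function of its left end. So a
  second difference is either zero, when a path vertex lies between the two labels and separates
  them, or a product of two factors whose signs are known. On the lattice side, the structure rests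
  on triangles: a reorientation is acyclic as soon as no triangle is cyclic, so the lattice consists
  of biclosed sets of arcs, as for inversion sets of permutations.\<close>

lemma acyclic_imp_asym: "acyclic A \<Longrightarrow> (a, b) \<in> A \<Longrightarrow> (b, a) \<notin> A"
  by (meson acyclic_def trancl.simps)

lemma acyclic_imp_neq: "acyclic A \<Longrightarrow> (a, b) \<in> A \<Longrightarrow> a \<noteq> b"
  using acyclic_imp_asym by metis

lemma acyclic_no_triangle: "acyclic A \<Longrightarrow> (a, b) \<in> A \<Longrightarrow> (b, c) \<in> A \<Longrightarrow> (c, a) \<notin> A"
  by (meson acyclic_def trancl.simps)

lemma successively_imp_sorted_trancl:
  assumes "successively (\<lambda>x y. (x, y) \<in> A) p"
  shows "sorted_wrt (\<lambda>x y. (x, y) \<in> A\<^sup>+) p"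
proof -
  have "successively (\<lambda>x y. (x, y) \<in> A\<^sup>+) p"
    using assms by (rule successively_mono) auto
  then show ?thesis
    by (subst (asm) successively_conv_sorted_wrt) (auto intro!: transpI)
qed

lemma acyclic_walk_distinct:
  assumes "acyclic A" "successively (\<lambda>x y. (x, y) \<in> A) p"
  shows "distinct p"
proof -
  have "sorted_wrt (\<lambda>x y. (x, y) \<in> A\<^sup>+) p" by (rule successively_imp_sorted_trancl[OF assms(2)])
  then show ?thesis using assms(1) by (induction p) (auto simp: acyclic_def)
qed

lemma trancl_imp_walk:
  assumes "(a, b) \<in> A\<^sup>+"
  obtains p where "2 \<le> length p" "successively (\<lambda>x y. (x, y) \<in> A) p" "hd p = a" "last p = b"
proof -
  have "\<exists>p. 2 \<le> length p \<and> successively (\<lambda>x y. (x, y) \<in> A) p \<and> hd p = a \<and> last p = b"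
    using assms
  proof (induction rule: trancl_induct)
    case (base y)
    then show ?case by (intro exI[of _ "[a, y]"]) auto
  next
    case (step y z)
    then obtain p where "2 \<le> length p" "successively (\<lambda>x y. (x, y) \<in> A) p" "hd p = a" "last p = y"
      by auto
    moreover from this have "p \<noteq> []" by auto
    ultimately show ?case using step(2)
      by (intro exI[of _ "p @ [z]"]) (simp add: successively_append_iff)
  qed
  then show ?thesis using that by blast
qed

locale skeletal_dag =
  fixes A :: "('v::finite \<times> 'v) set"
  assumes acyclic: "acyclic A" and skeletal: "skeletal A"
begin

lemmas asym = acyclic_imp_asym[OF acyclic]
  and arc_neq = acyclic_imp_neq[OF acyclic]
  and no_triangle = acyclic_no_triangle[OF acyclic]

lemma filled_sorted:
  assumes "directed_path A p" "(hd p, last p) \<in> A"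
  shows "sorted_wrt (\<lambda>x y. (x, y) \<in> A) p"
  using skeletal assms by (auto simp: skeletal_def filled_def)

text \<open>Filledness for walks. The two walks concatenate to a walk from \<open>a\<close> to
  \<open>c\<close>, which is a path by acyclicity, and \<open>b\<close> lies strictly inside
  it.\<close>

lemma filled_between:
  assumes "(a, b) \<in> A\<^sup>+" "(b, c) \<in> A\<^sup>+" "(a, c) \<in> A"
  shows "(a, b) \<in> A" "(b, c) \<in> A"
proof -
  obtain p where p: "2 \<le> length p" "successively (\<lambda>x y. (x, y) \<in> A) p" "hd p = a" "last p = b"
    by (rule trancl_imp_walk[OF assms(1)])
  obtain q where q: "2 \<le> length q" "successively (\<lambda>x y. (x, y) \<in> A) q" "hd q = b" "last q = c"
    by (rule trancl_imp_walk[OF assms(2)])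
  obtain q' where q': "q = b # q'" "q' \<noteq> []" using q by (cases q; cases "tl q") auto
  have s: "successively (\<lambda>x y. (x, y) \<in> A) (p @ q')"
    using p q q' by (auto simp: successively_append_iff successively_Cons)
  have "p \<noteq> []" using p by auto
  then have "directed_path A (p @ q')" "hd (p @ q') = a" "last (p @ q') = c"
    using s q' q p acyclic_walk_distinct[OF acyclic s] by (auto simp: directed_path_def)
  then have sorted: "sorted_wrt (\<lambda>x y. (x, y) \<in> A) (p @ q')" using filled_sorted assms(3) by metis
  obtain p' where p': "p = a # p'" "p' \<noteq> []" using p by (cases p; cases "tl p") auto
  have "b \<in> set p'" using p p' by (metis last_ConsR last_in_set)
  moreover have "c \<in> set q'" using q q' by (metis last_ConsR last_in_set)
  ultimately show "(a, b) \<in> A" "(b, c) \<in> A" using sorted unfolding p'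
    by (auto simp: sorted_wrt_append)
qed

text \<open>A path from \<open>u\<close> to \<open>v\<close> is sorted by filledness, so each inner
  vertex is joined directly to both ends, and a path of length two already witnesses it.\<close>

lemma transitive_support_arc:
  assumes "(u, v) \<in> A"
  shows "transitive_support A u v = insert u (insert v {w. (u, w) \<in> A \<and> (w, v) \<in> A})"
proof (intro equalityI subsetI)
  fix w assume "w \<in> transitive_support A u v"
  then obtain p where p: "path_from_to A u p v" "w \<in> set p" by (auto simp: transitive_support_def)
  then have sorted: "sorted_wrt (\<lambda>x y. (x, y) \<in> A) p" and e: "p \<noteq> []" "hd p = u" "last p = v"
    using filled_sorted assms by (auto simp: path_from_to_def directed_path_def)
  obtain xs ys where xy: "p = xs @ w # ys" using p by (meson split_list)
  have "w = u \<or> u \<in> set xs" "w = v \<or> v \<in> set ys" using e xy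
    by (cases xs; cases ys rule: rev_cases; auto)+
  then show "w \<in> insert u (insert v {w. (u, w) \<in> A \<and> (w, v) \<in> A})"
    using sorted xy by (auto simp: sorted_wrt_append)
next
  fix w assume "w \<in> insert u (insert v {w. (u, w) \<in> A \<and> (w, v) \<in> A})"
  then consider "w \<in> {u, v}" | "(u, w) \<in> A" "(w, v) \<in> A" by auto
  then show "w \<in> transitive_support A u v"
  proof cases
    case 1
    then show ?thesis unfolding transitive_support_def path_from_to_def directed_path_def
      using assms arc_neq by (intro CollectI exI[of _ "[u, v]"]) auto
  next
    case 2
    then show ?thesis unfolding transitive_support_def path_from_to_def directed_path_def
      using assms arc_neq by (intro CollectI exI[of _ "[u, w, v]"]) auto
  qed
qed

text \<open>By filledness, the second vertex of any longer path from \<open>x\<close> to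
  \<open>y\<close> is joined to \<open>y\<close>. Hence an arc that is bypassed at all is bypassed
  by a path of length two.\<close>

lemma mem_transitive_reduction_induced:
  "(x, y) \<in> transitive_reduction (induced_subgraph A U) \<longleftrightarrow>
     (x, y) \<in> A \<and> x \<in> U \<and> y \<in> U \<and> \<not> (\<exists>z \<in> U. (x, z) \<in> A \<and> (z, y) \<in> A)" (is "?L \<longleftrightarrow> ?R")
proof
  assume L: ?L
  then have xy: "(x, y) \<in> A" "x \<in> U" "y \<in> U"
    by (auto simp: transitive_reduction_def induced_subgraph_def)
  have "\<not> ((x, z) \<in> A \<and> (z, y) \<in> A)" if "z \<in> U" for z
  proof
    assume "(x, z) \<in> A \<and> (z, y) \<in> A"
    then have "path_from_to (induced_subgraph A U) x [x, z, y] y"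
      using xy that arc_neq by (auto simp: path_from_to_def directed_path_def induced_subgraph_def)
    then show False using L by (force simp: transitive_reduction_def)
  qed
  then show ?R using xy by blast
next
  assume R: ?R
  have "\<not> (path_from_to (induced_subgraph A U) x p y \<and> 3 \<le> length p)" for p
  proof
    assume p: "path_from_to (induced_subgraph A U) x p y \<and> 3 \<le> length p"
    then obtain z q where q: "p = x # z # q" "q \<noteq> []"
      unfolding path_from_to_def by (cases p; cases "tl p"; cases "tl (tl p)") auto
    have "successively (\<lambda>x y. (x, y) \<in> A) p"
      using p unfolding path_from_to_def directed_path_def
      by (elim conjE) (erule successively_mono, auto simp: induced_subgraph_def)
    then have "directed_path A p" using p by (auto simp: path_from_to_def directed_path_def)
    then have s: "sorted_wrt (\<lambda>x y. (x, y) \<in> A) p"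
      using filled_sorted R p by (auto simp: path_from_to_def)
    have "z \<in> U" using p q by (auto simp: path_from_to_def directed_path_def induced_subgraph_def)
    moreover have "y \<in> set q" using p q by (auto simp: path_from_to_def)
    ultimately show False using R s q by auto
  qed
  then show ?L using R by (auto simp: transitive_reduction_def induced_subgraph_def)
qed

lemma vertebrate_forest: "forest (transitive_reduction (induced_subgraph A U))"
  using skeletal by (auto simp: skeletal_def vertebrate_def)

text \<open>Otherwise none of the four arcs is bypassed within \<open>{a, b, c, w}\<close>, so all
  of them survive in the transitive reduction of the induced subgraph, where they form an undirected
  4-cycle.\<close>

lemma diamond:
  assumes "(a, b) \<in> A" "(b, c) \<in> A" "(a, w) \<in> A" "(w, c) \<in> A" "b \<noteq> w"
  shows "(b, w) \<in> A \<or> (w, b) \<in> A"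
proof (rule ccontr)
  assume n: "\<not> ?thesis"
  let ?T = "transitive_reduction (induced_subgraph A {a, b, c, w})"
  note asyms = assms(1-4)[THEN asym] and neqs = assms(1-4)[THEN arc_neq]
  have T: "(a, b) \<in> ?T" "(b, c) \<in> ?T" "(a, w) \<in> ?T" "(w, c) \<in> ?T"
    unfolding mem_transitive_reduction_induced using assms n asyms neqs arc_neq by blast+
  have "a \<noteq> c" using assms asym by blast
  then have "directed_path (?T \<union> ?T\<inverse>) [a, b, c, w]"
    using T assms neqs by (auto simp: directed_path_def)
  moreover have "(last [a, b, c, w], hd [a, b, c, w]) \<in> ?T \<union> ?T\<inverse>" using T by auto
  moreover have "3 \<le> length [a, b, c, w]" by simp
  ultimately show False using vertebrate_forest[of "{a, b, c, w}"] unfolding forest_def by blast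
qed

text \<open>Two inner vertices are opposite corners of a diamond between \<open>u\<close> and
  \<open>v\<close>. With acyclicity, \<open>A\<close> is thus a linear order on each transitive
  support.\<close>

lemma support_clique:
  assumes "(u, v) \<in> A" "x \<in> transitive_support A u v" "y \<in> transitive_support A u v" "x \<noteq> y"
  shows "(x, y) \<in> A \<or> (y, x) \<in> A"
  using assms diamond[of u x v y] unfolding transitive_support_arc[OF assms(1)] by auto

lemma support_convex:
  assumes "(u, v) \<in> A" "x \<in> transitive_support A u v" "y \<in> transitive_support A u v"
    "(x, w) \<in> A" "(w, y) \<in> A"
  shows "w \<in> transitive_support A u v"
proof -
  have "(u, w) \<in> A\<^sup>+" "(w, v) \<in> A\<^sup>+"
    using assms unfolding transitive_support_arc[OF assms(1)]
    by (auto intro: trancl.intros)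
  then show ?thesis using filled_between[OF _ _ assms(1)]
    unfolding transitive_support_arc[OF assms(1)] by blast
qed

section \<open>Acyclic reorientations as biclosed sets of arcs\<close>

lemma mem_reorient:
  assumes "R \<subseteq> A"
  shows "(a, b) \<in> reorient A R \<longleftrightarrow> (a, b) \<in> A \<and> (a, b) \<notin> R \<or> (b, a) \<in> R"
  by (auto simp: reorient_def)

lemma reorient_cases:
  assumes "R \<subseteq> A" "(a, b) \<in> A \<or> (b, a) \<in> A"
  shows "(a, b) \<in> reorient A R \<longleftrightarrow> (b, a) \<notin> reorient A R"
  using assms asym unfolding mem_reorient[OF assms(1)] by blast

lemma reorient_adjacent: "R \<subseteq> A \<Longrightarrow> (a, b) \<in> reorient A R \<Longrightarrow> (a, b) \<in> A \<or> (b, a) \<in> A"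
  by (auto simp: reorient_def)

text \<open>A shortest directed cycle of a reorientation has no chords. If it has at least four vertices, then
  the transitive reduction of the subgraph induced by these vertices is the whole undirected cycle.\<close>

lemma acyclic_reorient_iff:
  assumes R: "R \<subseteq> A"
  defines "B \<equiv> reorient A R"
  shows "acyclic B \<longleftrightarrow> (\<forall>a b c. (a, b) \<in> B \<longrightarrow> (b, c) \<in> B \<longrightarrow> (c, a) \<notin> B)"
proof
  assume "acyclic B"
  then show "\<forall>a b c. (a, b) \<in> B \<longrightarrow> (b, c) \<in> B \<longrightarrow> (c, a) \<notin> B" by (blast dest: acyclic_no_triangle)
next
  assume no3: "\<forall>a b c. (a, b) \<in> B \<longrightarrow> (b, c) \<in> B \<longrightarrow> (c, a) \<notin> B"
  have adj: "(a, b) \<in> B \<Longrightarrow> (a, b) \<in> A \<or> (b, a) \<in> A" and tot: "(a, b) \<in> A \<Longrightarrow> (a, b) \<in> B \<or> (b, a) \<in> B"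
    and asymB: "(a, b) \<in> B \<Longrightarrow> (b, a) \<notin> B" for a b
    unfolding B_def using reorient_adjacent[OF R] reorient_cases[OF R] by blast+
  show "acyclic B"
  proof (rule ccontr)
    assume "\<not> acyclic B"
    then have ex: "\<exists>n x. 0 < n \<and> (x, x) \<in> B ^^ n" by (auto simp: acyclic_def trancl_power)
    define n where "n = (LEAST n. 0 < n \<and> (\<exists>x. (x, x) \<in> B ^^ n))"
    have "0 < n \<and> (\<exists>x. (x, x) \<in> B ^^ n)" unfolding n_def by (rule LeastI_ex) (use ex in auto)
    then obtain x where n: "0 < n" and x: "(x, x) \<in> B ^^ n" by auto
    have least: "(y, y) \<notin> B ^^ m" if "0 < m" "m < n" for m y
      using not_less_Least[of m "\<lambda>n. 0 < n \<and> (\<exists>x. (x, x) \<in> B ^^ n)"] that unfolding n_def by auto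
    obtain f where f: "f 0 = x" "f n = x" "\<And>i. i < n \<Longrightarrow> (f i, f (Suc i)) \<in> B"
      using x unfolding relpow_fun_conv by auto
    have walk: "(f i, f j) \<in> B ^^ (j - i)" if "i \<le> j" "j \<le> n" for i j
      unfolding relpow_fun_conv using f that by (intro exI[of _ "\<lambda>k. f (i + k)"]) auto
    have inj: "f i \<noteq> f j" if "i < j" "j < n" for i j
      using walk[of i j] least[of "j - i" "f i"] that
      by (metis diff_less_mono2 diff_zero le0 less_imp_diff_less less_imp_le_nat zero_less_diff)
    have chord: "j = Suc i" if "i < j" "j < n" "(f i, f j) \<in> B" for i j
    proof (rule ccontr)
      assume "j \<noteq> Suc i"
      have "(x, f j) \<in> B ^^ (Suc i)" using walk[of 0 i] that f by auto
      then have "(x, x) \<in> B ^^ (Suc i + (n - j))" unfolding relpow_add using walk[of j n] that f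
        by auto
      moreover have "Suc i + (n - j) < n" using that \<open>j \<noteq> Suc i\<close> by linarith
      ultimately show False using least by blast
    qed
    \<comment> \<open>A backward arc closes a cycle of length \<open>Suc (j - i)\<close>, which
      contradicts minimality unless it is the closing arc of the whole cycle.\<close>
    have chord': "i = 0 \<and> j = n - 1" if "i < j" "j < n" "(f j, f i) \<in> B" for i j
    proof -
      have "(f i, f i) \<in> B ^^ (Suc (j - i))" using walk[of i j] that by auto
      then have "\<not> Suc (j - i) < n" using least by blast
      then show ?thesis using that by linarith
    qed
    have near: "j = Suc i \<or> i = Suc j \<or> i = 0 \<and> j = n - 1 \<or> j = 0 \<and> i = n - 1"
      if "i < n" "j < n" "(f i, f j) \<in> A \<or> (f j, f i) \<in> A" for i j
    proof -
      have "(f i, f j) \<in> B \<or> (f j, f i) \<in> B" using that tot by blast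
      moreover have "i \<noteq> j" using that arc_neq by auto
      ultimately show ?thesis using chord[of i j] chord'[of i j] chord[of j i] chord'[of j i] that
        by (cases i j rule: linorder_cases) auto
    qed
    have "n \<noteq> 1"
    proof
      assume "n = 1"
      then have "(x, x) \<in> B" using f(1,2) f(3)[of 0] by simp
      then show False using asymB by blast
    qed
    moreover have "n \<noteq> 2"
    proof
      assume "n = 2"
      then have "(f 0, f 1) \<in> B" "(f 1, f 0) \<in> B"
        using f(1,2) f(3)[of 0] f(3)[of 1] by (simp_all add: numeral_2_eq_2)
      then show False using asymB by blast
    qed
    moreover have "n \<noteq> 3"
    proof
      assume "n = 3"
      then have "(f 0, f 1) \<in> B" "(f 1, f 2) \<in> B" "(f 2, f 0) \<in> B"
        using f(1,2) f(3)[of 0] f(3)[of 1] f(3)[of 2]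
        by (simp_all add: numeral_3_eq_3 numeral_2_eq_2)
      then show False using no3 by blast
    qed
    ultimately have n4: "4 \<le> n" using n by linarith
    define U where "U = f ` {..<n}"
    let ?T = "transitive_reduction (induced_subgraph A U)"
    \<comment> \<open>Around a cycle with at least four vertices, no vertex is a neighbour of two
      neighbouring ones, so no arc among these vertices is bypassed.\<close>
    have reduced: "(f i, f j) \<in> ?T" if ij: "i < n" "j < n" "(f i, f j) \<in> A" for i j
    proof -
      have False if z: "z \<in> U" "(f i, z) \<in> A" "(z, f j) \<in> A" for z
      proof -
        obtain k where k: "k < n" "z = f k" using z by (auto simp: U_def)
        have "i \<noteq> j" "i \<noteq> k" "j \<noteq> k" using ij z k arc_neq by auto
        moreover have "j = Suc i \<or> i = Suc j \<or> i = 0 \<and> j = n - 1 \<or> j = 0 \<and> i = n - 1"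
          "k = Suc i \<or> i = Suc k \<or> i = 0 \<and> k = n - 1 \<or> k = 0 \<and> i = n - 1"
          "j = Suc k \<or> k = Suc j \<or> k = 0 \<and> j = n - 1 \<or> j = 0 \<and> k = n - 1"
          using near[of i j] near[of i k] near[of k j] ij z k by blast+
        ultimately show False using n4 by linarith
      qed
      then show ?thesis unfolding mem_transitive_reduction_induced U_def using ij by blast
    qed
    have cyc: "(f i, f j) \<in> ?T \<union> ?T\<inverse>" if "i < n" "j < n" "(f i, f j) \<in> B" for i j
      using adj[OF that(3)] reduced that by blast
    let ?p = "map f [0..<n]"
    have "distinct ?p" unfolding distinct_map
    proof (intro conjI inj_onI)
      fix i j assume "i \<in> set [0..<n]" "j \<in> set [0..<n]" "f i = f j"
      then show "i = j" using inj[of i j] inj[of j i] by (cases i j rule: linorder_cases) simp_all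
    qed simp
    moreover have "successively (\<lambda>x y. (x, y) \<in> ?T \<union> ?T\<inverse>) ?p"
      unfolding successively_conv_nth using cyc f(3) by simp
    ultimately have "directed_path (?T \<union> ?T\<inverse>) ?p" using n by (simp add: directed_path_def)
    moreover have "(last ?p, hd ?p) \<in> ?T \<union> ?T\<inverse>"
      using n cyc[of "n - 1" 0] f(3)[of "n - 1"] f(1,2) by (simp add: last_map hd_map)
    moreover have "3 \<le> length ?p" using n4 by simp
    ultimately show False using vertebrate_forest[of U] unfolding forest_def by blast
  qed
qed

text \<open>By \<open>acyclic_reorient_iff\<close> only triangles matter. A triangle of
  \<open>A\<close> has arcs \<open>(a, b)\<close>, \<open>(b, c)\<close>, \<open>(a, c)\<close>, and
  its two cyclic reorientations reverse exactly \<open>(a, c)\<close>, or exactly the other two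
  arcs.\<close>

lemma mem_AR_iff:
  "R \<in> acyclic_reorientations A \<longleftrightarrow> R \<subseteq> A \<and>
     (\<forall>a b c. (a, b) \<in> A \<longrightarrow> (b, c) \<in> A \<longrightarrow> (a, c) \<in> A \<longrightarrow>
        ((a, b) \<in> R \<and> (b, c) \<in> R \<longrightarrow> (a, c) \<in> R) \<and> ((a, c) \<in> R \<longrightarrow> (a, b) \<in> R \<or> (b, c) \<in> R))"
proof (cases "R \<subseteq> A")
  case True
  let ?B = "reorient A R"
  show ?thesis
  proof (intro iffI conjI allI impI)
    assume R: "R \<in> acyclic_reorientations A"
    then have no3: "\<And>a b c. (a, b) \<in> ?B \<Longrightarrow> (b, c) \<in> ?B \<Longrightarrow> (c, a) \<notin> ?B"
      by (auto simp: acyclic_reorientations_def dest: acyclic_no_triangle)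
    show "R \<subseteq> A" by (rule True)
    fix a b c assume abc: "(a, b) \<in> A" "(b, c) \<in> A" "(a, c) \<in> A"
    show "(a, c) \<in> R" if "(a, b) \<in> R \<and> (b, c) \<in> R"
      using no3[of b a c] that abc unfolding mem_reorient[OF True] by blast
    show "(a, b) \<in> R \<or> (b, c) \<in> R" if "(a, c) \<in> R"
      using no3[of a b c] that abc unfolding mem_reorient[OF True] by blast
  next
    assume bic: "R \<subseteq> A \<and>
      (\<forall>a b c. (a, b) \<in> A \<longrightarrow> (b, c) \<in> A \<longrightarrow> (a, c) \<in> A \<longrightarrow>
        ((a, b) \<in> R \<and> (b, c) \<in> R \<longrightarrow> (a, c) \<in> R) \<and> ((a, c) \<in> R \<longrightarrow> (a, b) \<in> R \<or> (b, c) \<in> R))"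
    have "(c, a) \<notin> ?B" if "(a, b) \<in> ?B" "(b, c) \<in> ?B" for a b c
    proof
      assume "(c, a) \<in> ?B"
      with that show False unfolding mem_reorient[OF True]
        using no_triangle[of a b c] no_triangle[of a c b] asym True bic by (elim disjE; blast)
    qed
    then show "R \<in> acyclic_reorientations A"
      unfolding acyclic_reorientations_def using True acyclic_reorient_iff[OF True] by blast
  qed
qed (auto simp: acyclic_reorientations_def)

lemma AR_subset: "R \<in> acyclic_reorientations A \<Longrightarrow> R \<subseteq> A"
  by (auto simp: acyclic_reorientations_def)

lemma AR_closed:
  assumes "R \<in> acyclic_reorientations A" "(a, b) \<in> R" "(b, c) \<in> R" "(a, c) \<in> A"
  shows "(a, c) \<in> R"
  using assms(2-4) AR_subset[OF assms(1)] assms(1)[unfolded mem_AR_iff] by blast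

lemma AR_coclosed:
  assumes "R \<in> acyclic_reorientations A" "(a, c) \<in> R" "(a, b) \<in> A" "(b, c) \<in> A"
  shows "(a, b) \<in> R \<or> (b, c) \<in> R"
  using assms(2-4) AR_subset[OF assms(1)] assms(1)[unfolded mem_AR_iff] by blast

lemma AR_complement: "R \<in> acyclic_reorientations A \<Longrightarrow> A - R \<in> acyclic_reorientations A"
  unfolding mem_AR_iff by blast

section \<open>Joins as transitive closures restricted to the arcs\<close>

definition closure_join :: "('v \<times> 'v) set \<Rightarrow> ('v \<times> 'v) set \<Rightarrow> ('v \<times> 'v) set" where
  "closure_join R R' = A \<inter> (R \<union> R')\<^sup>+"

text \<open>For coclosedness, suppose that neither part of the detour through \<open>b\<close> lies
  in the closure, and follow a walk from \<open>a\<close> to \<open>c\<close>. Each of its vertices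
  must precede \<open>b\<close> in \<open>A\<close>: the next vertex \<open>z\<close> is comparable
  with \<open>b\<close> by \<open>diamond\<close>, and if it came after \<open>b\<close>,
  coclosedness of one of the two sets at the current step would extend the walk from
  \<open>a\<close> to \<open>b\<close> or yield one from \<open>b\<close> to \<open>c\<close>. At
  \<open>c\<close> this contradicts \<open>(b, c) \<in> A\<close>.\<close>

lemma closure_join_AR:
  assumes R: "R \<in> acyclic_reorientations A" "R' \<in> acyclic_reorientations A"
  shows "closure_join R R' \<in> acyclic_reorientations A"
  unfolding mem_AR_iff
proof (intro conjI allI impI)
  let ?Z = "R \<union> R'"
  have Z: "?Z \<subseteq> A" using R[THEN AR_subset] by blast
  show "closure_join R R' \<subseteq> A" by (auto simp: closure_join_def)
  fix a b c assume abc: "(a, b) \<in> A" "(b, c) \<in> A" "(a, c) \<in> A"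
  show "(a, c) \<in> closure_join R R'" if "(a, b) \<in> closure_join R R' \<and> (b, c) \<in> closure_join R R'"
    using that abc by (auto simp: closure_join_def)
  show "(a, b) \<in> closure_join R R' \<or> (b, c) \<in> closure_join R R'" if "(a, c) \<in> closure_join R R'"
  proof (rule ccontr)
    assume n: "\<not> ?thesis"
    then have n1: "(a, b) \<notin> ?Z\<^sup>+" and n2: "(b, c) \<notin> ?Z\<^sup>+" using abc by (auto simp: closure_join_def)
    have below: "(y, c) \<in> ?Z\<^sup>* \<longrightarrow> (y, b) \<in> A" if "(a, y) \<in> ?Z\<^sup>*" for y
      using that
    proof (induction rule: rtrancl_induct)
      case base
      then show ?case using abc by blast
    next
      case (step y z)
      show ?case
      proof
        assume zc: "(z, c) \<in> ?Z\<^sup>*"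
        then have yb: "(y, b) \<in> A" using step by (meson converse_rtrancl_into_rtrancl)
        have az: "(a, z) \<in> ?Z\<^sup>+" using step(1,2) by (rule rtrancl_into_trancl1)
        then have "z \<noteq> b" using n1 by auto
        have "z = c \<or> (z, c) \<in> ?Z\<^sup>+" using zc by (metis rtrancl_eq_or_trancl)
        then have "z = c \<or> (a, z) \<in> A \<and> (z, c) \<in> A"
          using filled_between[OF _ _ abc(3), of z] az trancl_mono_subset[OF Z] by blast
        then have "(b, z) \<in> A \<or> (z, b) \<in> A" using diamond[of a b c z] abc \<open>z \<noteq> b\<close> by blast
        moreover have False if "(b, z) \<in> A"
        proof -
          have "(y, b) \<in> ?Z \<or> (b, z) \<in> ?Z" using step(2) AR_coclosed R yb that by blast
          then show False
          proof
            assume "(y, b) \<in> ?Z"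
            with step(1) have "(a, b) \<in> ?Z\<^sup>+" by (rule rtrancl_into_trancl1)
            then show False using n1 by simp
          next
            assume "(b, z) \<in> ?Z"
            from this zc have "(b, c) \<in> ?Z\<^sup>+" by (rule rtrancl_into_trancl2)
            then show False using n2 by simp
          qed
        qed
        ultimately show "(z, b) \<in> A" by blast
      qed
    qed
    moreover have "(a, c) \<in> ?Z\<^sup>*" using that by (auto simp: closure_join_def)
    ultimately show False using asym abc by blast
  qed
qed

lemma closure_join_upper:
  "R \<in> acyclic_reorientations A \<Longrightarrow> R' \<in> acyclic_reorientations A \<Longrightarrow> R \<union> R' \<subseteq> closure_join R R'"
  using AR_subset by (auto simp: closure_join_def)

text \<open>Closedness of \<open>K\<close> speaks only of triangles of \<open>A\<close>. Along a
  walk whose ends are joined by an arc, \<open>filled_between\<close> provides the missing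
  sides.\<close>

lemma closure_join_least:
  assumes K: "K \<in> acyclic_reorientations A" and "R \<subseteq> K" "R' \<subseteq> K"
  shows "closure_join R R' \<subseteq> K"
proof -
  have ZA: "R \<union> R' \<subseteq> A" using AR_subset K assms by blast
  have "(a, b) \<in> A \<longrightarrow> (a, b) \<in> K" if "(a, b) \<in> (R \<union> R')\<^sup>+" for a b
    using that
  proof (induction rule: trancl_induct)
    case (base y)
    then show ?case using assms by blast
  next
    case (step y z)
    show ?case
    proof
      assume "(a, z) \<in> A"
      moreover have "(a, y) \<in> A\<^sup>+" "(y, z) \<in> A\<^sup>+"
        using step ZA trancl_mono_subset[OF ZA] by blast+
      ultimately have "(a, y) \<in> A" using filled_between by blast
      then show "(a, z) \<in> K" using step \<open>(a, z) \<in> A\<close> AR_closed[OF K] assms by blast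
    qed
  qed
  then show ?thesis by (auto simp: closure_join_def)
qed

end

section \<open>Flips and congruences\<close>

text \<open>This is the effect on ropes of complementing reorientations, the duality that exchanges
  meets and joins; see \<open>flip_complement\<close>.\<close>

fun swap_rope :: "'v rope \<Rightarrow> 'v rope" where
  "swap_rope (u, v, dn, up) = (u, v, up, dn)"

lemma swap_rope_swap [simp]: "swap_rope (swap_rope \<rho>) = \<rho>"
  by (cases \<rho>) simp

lemma subrope_refl: "subrope \<rho> \<rho>"
  by (cases \<rho>) auto

lemma subrope_trans: "subrope \<rho> \<sigma> \<Longrightarrow> subrope \<sigma> \<tau> \<Longrightarrow> subrope \<rho> \<tau>"
  by (cases \<rho>; cases \<sigma>; cases \<tau>) auto

lemma subrope_swap: "subrope (swap_rope \<rho>) (swap_rope \<sigma>) \<longleftrightarrow> subrope \<rho> \<sigma>"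
  by (cases \<rho>; cases \<sigma>) auto

lemma lattice_congruenceD:
  assumes "lattice_congruence L r"
  shows "equiv (carrier L) r"
    "(x, x') \<in> r \<Longrightarrow> (y, y') \<in> r \<Longrightarrow> (x \<sqinter>\<^bsub>L\<^esub> y, x' \<sqinter>\<^bsub>L\<^esub> y') \<in> r"
    "(x, x') \<in> r \<Longrightarrow> (y, y') \<in> r \<Longrightarrow> (x \<squnion>\<^bsub>L\<^esub> y, x' \<squnion>\<^bsub>L\<^esub> y') \<in> r"
  using assms unfolding lattice_congruence_def by fast+

context skeletal_dag
begin

abbreviation "\<R> \<equiv> acyclic_reorientations A"

abbreviation between :: "'v \<Rightarrow> 'v \<Rightarrow> 'v set" where
  "between u v \<equiv> {w. (u, w) \<in> A \<and> (w, v) \<in> A}"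

lemma carrier_AR [simp]: "carrier (AR A) = \<R>"
  by (simp add: AR_def)

lemma join_AR:
  assumes "R \<in> \<R>" "R' \<in> \<R>" "N \<in> \<R>" "R \<subseteq> N" "R' \<subseteq> N"
    and "\<And>K. K \<in> \<R> \<Longrightarrow> R \<subseteq> K \<Longrightarrow> R' \<subseteq> K \<Longrightarrow> N \<subseteq> K"
  shows "R \<squnion>\<^bsub>AR A\<^esub> R' = N"
  unfolding join_def sup_def
proof (rule some_equality)
  show "least (AR A) N (Upper (AR A) {R, R'})"
    using assms by (auto simp: least_def Upper_def AR_def)
  then show "x = N" if "least (AR A) x (Upper (AR A) {R, R'})" for x
    using that by (auto simp: least_def AR_def)
qed

lemma meet_AR:
  assumes "R \<in> \<R>" "R' \<in> \<R>" "N \<in> \<R>" "N \<subseteq> R" "N \<subseteq> R'"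
    and "\<And>K. K \<in> \<R> \<Longrightarrow> K \<subseteq> R \<Longrightarrow> K \<subseteq> R' \<Longrightarrow> K \<subseteq> N"
  shows "R \<sqinter>\<^bsub>AR A\<^esub> R' = N"
  unfolding meet_def inf_def
proof (rule some_equality)
  show "greatest (AR A) N (Lower (AR A) {R, R'})"
    using assms by (auto simp: greatest_def Lower_def AR_def)
  then show "x = N" if "greatest (AR A) x (Lower (AR A) {R, R'})" for x
    using that by (auto simp: greatest_def AR_def)
qed

lemma join_closure: "R \<in> \<R> \<Longrightarrow> R' \<in> \<R> \<Longrightarrow> R \<squnion>\<^bsub>AR A\<^esub> R' = closure_join R R'"
  using closure_join_AR closure_join_upper closure_join_least by (intro join_AR) auto

definition closure_meet :: "('v \<times> 'v) set \<Rightarrow> ('v \<times> 'v) set \<Rightarrow> ('v \<times> 'v) set" where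
  "closure_meet R R' = A - closure_join (A - R) (A - R')"

lemma closure_meet:
  assumes "R \<in> \<R>" "R' \<in> \<R>"
  shows "closure_meet R R' \<in> \<R>" "closure_meet R R' \<subseteq> R" "closure_meet R R' \<subseteq> R'"
    "K \<in> \<R> \<Longrightarrow> K \<subseteq> R \<Longrightarrow> K \<subseteq> R' \<Longrightarrow> K \<subseteq> closure_meet R R'"
proof -
  note c = assms[THEN AR_complement]
  show "closure_meet R R' \<in> \<R>" unfolding closure_meet_def by (intro AR_complement closure_join_AR c)
  show "closure_meet R R' \<subseteq> R" "closure_meet R R' \<subseteq> R'"
    unfolding closure_meet_def using closure_join_upper[OF c] by auto
  show "K \<subseteq> closure_meet R R'" if "K \<in> \<R>" "K \<subseteq> R" "K \<subseteq> R'"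
    unfolding closure_meet_def
    using closure_join_least[OF AR_complement[OF that(1)], of "A - R" "A - R'"] that AR_subset
    by blast
qed

lemma meet_closure: "R \<in> \<R> \<Longrightarrow> R' \<in> \<R> \<Longrightarrow> R \<sqinter>\<^bsub>AR A\<^esub> R' = closure_meet R R'"
  using closure_meet by (intro meet_AR) auto

lemma congruence_props:
  assumes "lattice_congruence (AR A) r"
  shows "r \<subseteq> \<R> \<times> \<R>" "E \<in> \<R> \<Longrightarrow> (E, E) \<in> r" "(E, F) \<in> r \<Longrightarrow> (F, E) \<in> r"
    "(E, F) \<in> r \<Longrightarrow> (F, G) \<in> r \<Longrightarrow> (E, G) \<in> r"
proof -
  have "equiv \<R> r" using lattice_congruenceD(1)[OF assms] by simp
  then have "refl_on \<R> r" "r \<subseteq> \<R> \<times> \<R>" "sym r" "trans r" by (auto simp: equiv_def)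
  then show "r \<subseteq> \<R> \<times> \<R>" "E \<in> \<R> \<Longrightarrow> (E, E) \<in> r" "(E, F) \<in> r \<Longrightarrow> (F, E) \<in> r"
    "(E, F) \<in> r \<Longrightarrow> (F, G) \<in> r \<Longrightarrow> (E, G) \<in> r"
    by (auto dest: refl_onD symD transD)
qed

lemma congruence_interval:
  assumes r: "lattice_congruence (AR A) r" and "(M, E) \<in> r" "K \<in> \<R>" "M \<subseteq> K" "K \<subseteq> E"
  shows "(M, K) \<in> r"
proof -
  have ME: "M \<in> \<R>" "E \<in> \<R>" using congruence_props(1)[OF r] assms by auto
  have "(M \<squnion>\<^bsub>AR A\<^esub> K, E \<squnion>\<^bsub>AR A\<^esub> K) \<in> r"
    using lattice_congruenceD(3)[OF r] assms congruence_props(2)[OF r] by blast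
  moreover have "M \<squnion>\<^bsub>AR A\<^esub> K = K" using ME assms by (intro join_AR) auto
  moreover have "E \<squnion>\<^bsub>AR A\<^esub> K = E" using ME assms by (intro join_AR) auto
  ultimately show ?thesis using congruence_props(3,4)[OF r] assms(2) by metis
qed

lemma congruence_meet:
  assumes r: "lattice_congruence (AR A) r" and "(E, E') \<in> r"
  shows "(closure_meet E E', E) \<in> r" "(closure_meet E E', E') \<in> r"
proof -
  have EE': "E \<in> \<R>" "E' \<in> \<R>" using congruence_props(1)[OF r] assms by auto
  note refl = congruence_props(2)[OF r, OF EE'(1)] congruence_props(2)[OF r, OF EE'(2)]
  have "(E \<sqinter>\<^bsub>AR A\<^esub> E, E' \<sqinter>\<^bsub>AR A\<^esub> E) \<in> r" by (rule lattice_congruenceD(2)[OF r assms(2) refl(1)])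
  moreover have "E \<sqinter>\<^bsub>AR A\<^esub> E = E" using EE' by (intro meet_AR) auto
  moreover have "E' \<sqinter>\<^bsub>AR A\<^esub> E = closure_meet E E'" using EE' closure_meet[OF EE']
    by (intro meet_AR) auto
  ultimately show 1: "(closure_meet E E', E) \<in> r" using congruence_props(3)[OF r] by metis
  show "(closure_meet E E', E') \<in> r" by (rule congruence_props(4)[OF r 1 assms(2)])
qed

section \<open>Flips, their ropes and join irreducibles\<close>

definition flip :: "('v \<times> 'v) set \<Rightarrow> 'v \<Rightarrow> 'v \<Rightarrow> bool" where
  "flip E u v \<longleftrightarrow> E \<in> \<R> \<and> (u, v) \<in> A \<and> (u, v) \<notin> E \<and> insert (u, v) E \<in> \<R>"

text \<open>Only the position relative to \<open>u\<close> is tested: when \<open>(u, v)\<close> is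
  flippable, \<open>flip_dichotomy\<close> shows that \<open>w\<close> lies on the same side of
  \<open>v\<close>.\<close>

definition flip_rope :: "('v \<times> 'v) set \<Rightarrow> 'v \<Rightarrow> 'v \<Rightarrow> 'v rope" where
  "flip_rope E u v = (u, v, {w \<in> between u v. (u, w) \<in> E}, {w \<in> between u v. (u, w) \<notin> E})"

lemma mem_ropes:
  "(u, v, dn, up) \<in> ropes A \<longleftrightarrow> (u, v) \<in> A \<and> dn \<inter> up = {} \<and> dn \<union> up = between u v"
proof (cases "(u, v) \<in> A")
  case True
  have "transitive_support A u v - {u, v} = between u v"
    unfolding transitive_support_arc[OF True] using arc_neq by auto
  then show ?thesis by (simp add: ropes_def)
qed (simp add: ropes_def)

lemma flip_rope_in_ropes: "(u, v) \<in> A \<Longrightarrow> flip_rope E u v \<in> ropes A"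
  by (auto simp: flip_rope_def mem_ropes)

lemma swap_rope_in_ropes: "swap_rope \<rho> \<in> ropes A \<longleftrightarrow> \<rho> \<in> ropes A"
  by (cases \<rho>) (auto simp: mem_ropes)

lemma subrope_antisym:
  assumes "\<rho> \<in> ropes A" "\<sigma> \<in> ropes A" "subrope \<rho> \<sigma>" "subrope \<sigma> \<rho>"
  shows "\<rho> = \<sigma>"
proof -
  obtain u v dn up u' v' dn' up' where e: "\<rho> = (u, v, dn, up)" "\<sigma> = (u', v', dn', up')"
    by (cases \<rho>; cases \<sigma>) auto
  have dn: "dn = dn'" "up = up'" using assms(3,4) by (auto simp: e)
  have arcs: "(u, v) \<in> A" "(u', v') \<in> A" and b: "dn \<union> up = between u v" "dn' \<union> up' = between u' v'"
    using assms by (auto simp: e mem_ropes)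
  have "u \<notin> between u v" "v \<notin> between u v" "u' \<notin> between u' v'" "v' \<notin> between u' v'" using arc_neq
    by auto
  then have "{u, v} = {u', v'}" using assms(3,4) b dn by (auto simp: e)
  then have "u = u' \<and> v = v'" using arcs asym by (auto simp: doubleton_eq_iff)
  then show ?thesis using dn e by simp
qed

text \<open>Inversion sets of height functions on a support, where ties keep the direction of
  \<open>A\<close>. Strict decrease is both closed and coclosed, which makes such sets acyclic
  reorientations without a case analysis.\<close>

definition levels :: "'v \<Rightarrow> 'v \<Rightarrow> ('v \<Rightarrow> nat) \<Rightarrow> ('v \<times> 'v) set" where
  "levels u v f = {(x, y) \<in> A. x \<in> transitive_support A u v \<and> y \<in> transitive_support A u v \<and> f y < f x}"

lemma levels_AR:
  assumes "(u, v) \<in> A"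
  shows "levels u v f \<in> \<R>"
  unfolding mem_AR_iff
proof (intro conjI allI impI)
  fix a b c assume abc: "(a, b) \<in> A" "(b, c) \<in> A" "(a, c) \<in> A"
  show "(a, c) \<in> levels u v f" if "(a, b) \<in> levels u v f \<and> (b, c) \<in> levels u v f"
    using that abc by (auto simp: levels_def)
  show "(a, b) \<in> levels u v f \<or> (b, c) \<in> levels u v f" if "(a, c) \<in> levels u v f"
    using that abc support_convex[OF assms, of a c b] by (auto simp: levels_def)
qed (auto simp: levels_def)

text \<open>Two heights describe the join irreducible. For its lower cover, \<open>dn\<close> goes
  to the bottom, \<open>up\<close> to the top, and \<open>u\<close>, \<open>v\<close> tie in the
  middle, so that only \<open>(u, v)\<close> is restored.\<close>

lemma rope_join_irreducible_levels:
  assumes "(u, v, dn, up) \<in> ropes A"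
  defines "J \<equiv> rope_join_irreducible A (u, v, dn, up)"
  shows "J = levels u v (\<lambda>w. if w \<in> insert u up then 1 else 0)"
    "J - {(u, v)} = levels u v (\<lambda>w. if w \<in> dn then 0 else if w \<in> up then 2 else 1)"
proof -
  have r: "(u, v) \<in> A" "dn \<inter> up = {}" "dn \<union> up = between u v" using assms by (auto simp: mem_ropes)
  then have S: "transitive_support A u v = {u, v} \<union> dn \<union> up" by (auto simp: transitive_support_arc)
  have n: "u \<notin> dn \<union> up" "v \<notin> dn \<union> up" "u \<noteq> v" using r arc_neq by auto
  have a: "(x, u) \<notin> A" if "x \<in> dn \<union> up \<or> x = v" for x using that r asym by auto
  have b: "(v, x) \<notin> A" if "x \<in> dn \<union> up \<or> x = u" for x using that r asym by auto
  show "J = levels u v (\<lambda>w. if w \<in> insert u up then 1 else 0)"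
    unfolding J_def levels_def S using r n by (auto split: if_splits)
  show "J - {(u, v)} = levels u v (\<lambda>w. if w \<in> dn then 0 else if w \<in> up then 2 else 1)"
    unfolding J_def levels_def S using r n a b by (auto split: if_splits)
qed

lemma rope_join_irreducible_flip:
  assumes "(u, v, dn, up) \<in> ropes A"
  defines "J \<equiv> rope_join_irreducible A (u, v, dn, up)"
  shows "J \<in> \<R>" "J - {(u, v)} \<in> \<R>" "(u, v) \<in> J" "flip (J - {(u, v)}) u v"
    "flip_rope (J - {(u, v)}) u v = (u, v, dn, up)"
proof -
  have r: "(u, v) \<in> A" "dn \<inter> up = {}" "dn \<union> up = between u v" using assms by (auto simp: mem_ropes)
  show J: "J \<in> \<R>" "J - {(u, v)} \<in> \<R>"
    using rope_join_irreducible_levels[OF assms(1)] levels_AR[OF r(1)] by (auto simp: J_def)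
  show uv: "(u, v) \<in> J" using r by (auto simp: J_def)
  then show "flip (J - {(u, v)}) u v" using J r by (simp add: flip_def insert_absorb)
  have "(u, w) \<in> J - {(u, v)} \<longleftrightarrow> w \<in> dn" if "w \<in> between u v" for w
    using that r arc_neq by (auto simp: J_def)
  then show "flip_rope (J - {(u, v)}) u v = (u, v, dn, up)" using r unfolding flip_rope_def by auto
qed

lemma below_rope_join_irreducible:
  assumes "(u, v, dn, up) \<in> ropes A"
  defines "J \<equiv> rope_join_irreducible A (u, v, dn, up)"
  assumes K: "K \<in> \<R>" "K \<subseteq> J" "(u, v) \<in> K"
  shows "K = J"
proof -
  have r: "(u, v) \<in> A" "dn \<inter> up = {}" "dn \<union> up = between u v" using assms by (auto simp: mem_ropes)
  have up: "(w, v) \<in> K" if "w \<in> up" for w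
  proof -
    have w: "w \<in> between u v" "w \<notin> dn" "w \<noteq> v" using r that arc_neq by auto
    then have "(u, w) \<notin> K" using K by (auto simp: J_def)
    then show ?thesis using AR_coclosed[OF K(1,3)] w by auto
  qed
  have dn: "(u, w) \<in> K" if "w \<in> dn" for w
  proof -
    have w: "w \<in> between u v" "w \<notin> up" "w \<noteq> u" using r that arc_neq by auto
    then have "(w, v) \<notin> K" using K by (auto simp: J_def)
    then show ?thesis using AR_coclosed[OF K(1,3)] w by auto
  qed
  have "(w, w') \<in> K" if "w \<in> up" "w' \<in> dn" "(w, w') \<in> A" for w w'
  proof -
    have w: "w \<in> between u v" "w \<notin> dn" "w \<noteq> v" using r that arc_neq by auto
    then have "(u, w) \<notin> K" using K by (auto simp: J_def)
    then show ?thesis using AR_coclosed[OF K(1) dn[OF that(2)]] w that by auto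
  qed
  then have "J \<subseteq> K" using up dn K by (auto simp: J_def)
  then show ?thesis using K by blast
qed

lemma covered_by_rope_join_irreducible:
  assumes "(u, v, dn, up) \<in> ropes A"
  defines "J \<equiv> rope_join_irreducible A (u, v, dn, up)"
  shows "covered_by (AR A) K J \<longleftrightarrow> K = J - {(u, v)}"
proof -
  note J = rope_join_irreducible_flip[OF assms(1), folded J_def]
  have less: "x \<sqsubset>\<^bsub>AR A\<^esub> y \<longleftrightarrow> x \<subset> y" for x y by (auto simp: AR_def lless_def)
  have below: "K' \<subseteq> J - {(u, v)}" if "K' \<in> \<R>" "K' \<subset> J" for K'
    using below_rope_join_irreducible[OF assms(1) that(1)] that by (auto simp: J_def)
  show ?thesis
  proof
    assume c: "covered_by (AR A) K J"
    then have "K \<in> \<R>" "K \<subset> J" by (auto simp: covered_by_def less)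
    then show "K = J - {(u, v)}" using below[of K] c J by (auto simp: covered_by_def less)
  next
    assume "K = J - {(u, v)}"
    then show "covered_by (AR A) K J" using J below by (force simp: covered_by_def less)
  qed
qed

lemma mem_rope_ideal:
  assumes "(u, v, dn, up) \<in> ropes A"
  defines "J \<equiv> rope_join_irreducible A (u, v, dn, up)"
  shows "(u, v, dn, up) \<in> rope_ideal A r \<longleftrightarrow> (J - {(u, v)}, J) \<notin> r"
proof -
  note J = rope_join_irreducible_flip[OF assms(1), folded J_def]
  note cov = covered_by_rope_join_irreducible[OF assms(1), folded J_def]
  have "join_irreducible (AR A) J" "(THE K. covered_by (AR A) K J) = J - {(u, v)}"
    unfolding join_irreducible_def cov using J by auto
  then show ?thesis using assms(1) unfolding rope_ideal_def contracts_def J_def by simp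
qed

text \<open>Closedness of \<open>E\<close> excludes both arcs, since \<open>(u, v)\<close> is
  absent. Coclosedness after the flip excludes that both are missing.\<close>

lemma flip_dichotomy:
  assumes "flip E u v" "w \<in> between u v"
  shows "(u, w) \<in> E \<longleftrightarrow> (w, v) \<notin> E"
proof -
  have E: "E \<in> \<R>" "insert (u, v) E \<in> \<R>" "(u, v) \<in> A" "(u, v) \<notin> E" using assms
    by (auto simp: flip_def)
  have w: "(u, w) \<in> A" "(w, v) \<in> A" "u \<noteq> w" "w \<noteq> v" using assms arc_neq by auto
  have "\<not> ((u, w) \<in> E \<and> (w, v) \<in> E)" using AR_closed[OF E(1)] E by blast
  moreover have "(u, w) \<in> E \<or> (w, v) \<in> E" using AR_coclosed[OF E(2), of u v w] w by auto
  ultimately show ?thesis by blast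
qed

lemma flip_join_irreducible_subset:
  assumes fl: "flip E u v"
  shows "rope_join_irreducible A (flip_rope E u v) \<subseteq> insert (u, v) E"
proof -
  have E: "E \<in> \<R>" using fl by (auto simp: flip_def)
  have "(w, w') \<in> insert (u, v) E"
    if "(w, w') \<in> A" "w \<in> insert u {w \<in> between u v. (u, w) \<notin> E}" "w' \<in> insert v {w \<in> between u v. (u, w) \<in> E}"
    for w w'
  proof (cases "w = u \<or> w' = v")
    case True
    then show ?thesis using that flip_dichotomy[OF fl, of w] by auto
  next
    case False
    then show ?thesis using that AR_coclosed[OF E, of u w' w] by auto
  qed
  then show ?thesis by (auto simp: flip_rope_def)
qed

text \<open>The cover of the flip and the cover below the join irreducible \<open>J\<close> of its
  rope are perspective: meeting the flip with \<open>J\<close> yields the cover below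
  \<open>J\<close>, and joining that one with \<open>E\<close> yields the flip. So each is
  contracted when the other is.\<close>

lemma flip_congruence_iff:
  assumes r: "lattice_congruence (AR A) r" and fl: "flip E u v"
  shows "(E, insert (u, v) E) \<in> r \<longleftrightarrow> flip_rope E u v \<notin> rope_ideal A r"
proof -
  have E: "E \<in> \<R>" "insert (u, v) E \<in> \<R>" "(u, v) \<in> A" "(u, v) \<notin> E" using fl by (auto simp: flip_def)
  obtain dn up where \<rho>: "flip_rope E u v = (u, v, dn, up)" by (simp add: flip_rope_def)
  have rope: "(u, v, dn, up) \<in> ropes A" using flip_rope_in_ropes[OF E(3), of E] \<rho> by simp
  define J where "J = rope_join_irreducible A (u, v, dn, up)"
  note J = rope_join_irreducible_flip[OF rope, folded J_def]
  have JE: "J \<subseteq> insert (u, v) E" unfolding J_def \<rho>[symmetric]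
    by (rule flip_join_irreducible_subset[OF fl])
  note refl = congruence_props(2)[OF r]
  have "(E, insert (u, v) E) \<in> r \<longleftrightarrow> (J - {(u, v)}, J) \<in> r"
  proof
    assume "(E, insert (u, v) E) \<in> r"
    from lattice_congruenceD(2)[OF r this refl[OF J(1)]]
    have "(E \<sqinter>\<^bsub>AR A\<^esub> J, insert (u, v) E \<sqinter>\<^bsub>AR A\<^esub> J) \<in> r" .
    moreover have "E \<sqinter>\<^bsub>AR A\<^esub> J = J - {(u, v)}" using E J JE by (intro meet_AR) auto
    moreover have "insert (u, v) E \<sqinter>\<^bsub>AR A\<^esub> J = J" using E J JE by (intro meet_AR) auto
    ultimately show "(J - {(u, v)}, J) \<in> r" by simp
  next
    assume "(J - {(u, v)}, J) \<in> r"
    from lattice_congruenceD(3)[OF r this refl[OF E(1)]]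
    have "((J - {(u, v)}) \<squnion>\<^bsub>AR A\<^esub> E, J \<squnion>\<^bsub>AR A\<^esub> E) \<in> r" .
    moreover have "(J - {(u, v)}) \<squnion>\<^bsub>AR A\<^esub> E = E" using E J JE by (intro join_AR) auto
    moreover have "J \<squnion>\<^bsub>AR A\<^esub> E = insert (u, v) E" using E J JE by (intro join_AR) auto
    ultimately show "(E, insert (u, v) E) \<in> r" by simp
  qed
  then show ?thesis using mem_rope_ideal[OF rope, of r, folded J_def] unfolding \<rho> by blast
qed

text \<open>Among the arcs on which two acyclic reorientations differ, choose one joining the ends of a
  smallest interval of the first reorientation.\<close>

lemma exists_flip_towards:
  assumes E: "E \<in> \<R>" "E' \<in> \<R>" "E \<noteq> E'"
  obtains u v where "flip E u v" "(u, v) \<in> E'" | u v where "(u, v) \<in> E" "(u, v) \<notin> E'" "flip (E - {(u, v)}) u v"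
proof -
  let ?B = "reorient A E" and ?B' = "reorient A E'"
  note EA = E(1,2)[THEN AR_subset]
  have acyc: "acyclic ?B" "acyclic ?B'" using E by (auto simp: acyclic_reorientations_def)
  define D where "D = {(a, b) \<in> ?B. (b, a) \<in> ?B'}"
  have "D \<noteq> {}"
  proof -
    obtain a b where "(a, b) \<in> E \<and> (a, b) \<notin> E' \<or> (a, b) \<notin> E \<and> (a, b) \<in> E'" using E by auto
    then have "(b, a) \<in> D \<or> (a, b) \<in> D"
      unfolding D_def using EA by (auto simp: mem_reorient)
    then show ?thesis by blast
  qed
  define size where "size = (\<lambda>(a, b). card {w. (a, w) \<in> ?B\<^sup>+ \<and> (w, b) \<in> ?B\<^sup>+})"
  obtain p where "p \<in> D" and least: "\<And>q. q \<in> D \<Longrightarrow> size p \<le> size q"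
    using \<open>D \<noteq> {}\<close> ex_has_least_nat[of "\<lambda>p. p \<in> D" _ size] by (metis ex_in_conv)
  then obtain a b where p: "p = (a, b)" "(a, b) \<in> ?B" "(b, a) \<in> ?B'" by (auto simp: D_def)
  have irr: "(x, x) \<notin> ?B\<^sup>+" for x using acyc by (auto simp: acyclic_def)
  \<comment> \<open>If \<open>c\<close> lay between, one of the two shorter pairs would also be
    reversed in the second reorientation, since it has no cyclic triangle. The interval of that pair
    is smaller because it misses \<open>c\<close>.\<close>
  have tr: "\<not> ((a, c) \<in> ?B \<and> (c, b) \<in> ?B)" for c
  proof
    assume c: "(a, c) \<in> ?B \<and> (c, b) \<in> ?B"
    have "(a, c) \<in> D \<or> (c, b) \<in> D"
    proof (rule ccontr)
      assume "\<not> ?thesis"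
      then have "(a, c) \<in> ?B'" "(c, b) \<in> ?B'"
        using c reorient_adjacent[OF EA(1)] reorient_cases[OF EA(2)] unfolding D_def by blast+
      then show False using p acyclic_no_triangle[OF acyc(2)] by blast
    qed
    moreover have "size (a, c) < size (a, b)" unfolding size_def prod.case
    proof (intro psubset_card_mono psubsetI)
      show "{w. (a, w) \<in> ?B\<^sup>+ \<and> (w, c) \<in> ?B\<^sup>+} \<subseteq> {w. (a, w) \<in> ?B\<^sup>+ \<and> (w, b) \<in> ?B\<^sup>+}"
        using c by (auto intro: trancl.intros)
      show "{w. (a, w) \<in> ?B\<^sup>+ \<and> (w, c) \<in> ?B\<^sup>+} \<noteq> {w. (a, w) \<in> ?B\<^sup>+ \<and> (w, b) \<in> ?B\<^sup>+}"
        using c irr[of c] by blast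
    qed auto
    moreover have "size (c, b) < size (a, b)" unfolding size_def prod.case
    proof (intro psubset_card_mono psubsetI)
      show "{w. (c, w) \<in> ?B\<^sup>+ \<and> (w, b) \<in> ?B\<^sup>+} \<subseteq> {w. (a, w) \<in> ?B\<^sup>+ \<and> (w, b) \<in> ?B\<^sup>+}"
        using c by (auto intro: trancl_into_trancl2)
      show "{w. (c, w) \<in> ?B\<^sup>+ \<and> (w, b) \<in> ?B\<^sup>+} \<noteq> {w. (a, w) \<in> ?B\<^sup>+ \<and> (w, b) \<in> ?B\<^sup>+}"
        using c irr[of c] by blast
    qed auto
    ultimately show False using least p by fastforce
  qed
  \<comment> \<open>A cyclic triangle created by turning \<open>(a, b)\<close> around would contain
    the new arc and a path of length two from \<open>a\<close> to \<open>b\<close>, which was just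
    excluded.\<close>
  have flipped: "acyclic (reorient A F)"
    if F: "F \<subseteq> A" "reorient A F = ?B - {(a, b)} \<union> {(b, a)}" for F
  proof -
    have "(z, x) \<notin> reorient A F" if "(x, y) \<in> reorient A F" "(y, z) \<in> reorient A F" for x y z
    proof
      assume "(z, x) \<in> reorient A F"
      with that have t: "(x, y) \<in> ?B - {(a, b)} \<union> {(b, a)}" "(y, z) \<in> ?B - {(a, b)} \<union> {(b, a)}"
        "(z, x) \<in> ?B - {(a, b)} \<union> {(b, a)}" using F by auto
      have "a \<noteq> b" "(b, a) \<notin> ?B"
        by (rule acyclic_imp_neq[OF acyc(1) p(2)], rule acyclic_imp_asym[OF acyc(1) p(2)])
      moreover have "(s, s) \<notin> ?B" for s using acyclic_imp_neq[OF acyc(1)] by metis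
      moreover have "\<not> ((x, y) \<in> ?B \<and> (y, z) \<in> ?B \<and> (z, x) \<in> ?B)"
        using acyclic_no_triangle[OF acyc(1)] by blast
      ultimately show False using t tr by blast
    qed
    then show ?thesis using acyclic_reorient_iff[OF F(1)] by blast
  qed
  consider "(a, b) \<in> A" "(a, b) \<notin> E" | "(b, a) \<in> E" using p mem_reorient[OF EA(1)] by blast
  then show thesis
  proof cases
    case 1
    have "reorient A (insert (a, b) E) = ?B - {(a, b)} \<union> {(b, a)}"
      using 1 EA asym by (auto simp: reorient_def)
    then have "insert (a, b) E \<in> \<R>" using flipped[of "insert (a, b) E"] 1 EA
      by (auto simp: acyclic_reorientations_def)
    moreover have "(a, b) \<in> E'" using p 1 EA asym by (auto simp: mem_reorient)
    ultimately show thesis using that(1)[of a b] 1 E by (auto simp: flip_def)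
  next
    case 2
    have "reorient A (E - {(b, a)}) = ?B - {(a, b)} \<union> {(b, a)}"
      using 2 EA asym by (auto simp: reorient_def)
    then have "E - {(b, a)} \<in> \<R>" using flipped[of "E - {(b, a)}"] EA
      by (auto simp: acyclic_reorientations_def)
    moreover have "(b, a) \<notin> E'" using p 2 EA asym by (auto simp: mem_reorient)
    ultimately show thesis using that(2)[of b a] 2 E EA by (auto simp: flip_def insert_absorb)
  qed
qed

lemma chain_of_flips:
  assumes E: "M \<in> \<R>" "E \<in> \<R>" "M \<subseteq> E"
    and refl: "\<And>K. K \<in> \<R> \<Longrightarrow> (K, K) \<in> Q" and trans: "trans Q"
    and step: "\<And>K u v. flip K u v \<Longrightarrow> M \<subseteq> K \<Longrightarrow> insert (u, v) K \<subseteq> E \<Longrightarrow> (K, insert (u, v) K) \<in> Q"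
  shows "(M, E) \<in> Q"
proof -
  have "(K, E) \<in> Q" if "K \<in> \<R>" "M \<subseteq> K" "K \<subseteq> E" for K
    using that
  proof (induction "card (E - K)" arbitrary: K rule: less_induct)
    case less
    show ?case
    proof (cases "K = E")
      case False
      \<comment> \<open>A flip towards \<open>E\<close> cannot remove an arc, as \<open>K\<close> is
        contained in \<open>E\<close>.\<close>
      obtain u v where uv: "flip K u v" "(u, v) \<in> E"
        by (rule exists_flip_towards[OF less(2) E(2) False]) (use less(4) in auto)
      let ?K = "insert (u, v) K"
      have "E - ?K \<subset> E - K" using uv by (auto simp: flip_def)
      then have "card (E - ?K) < card (E - K)" by (intro psubset_card_mono) auto
      then have "(?K, E) \<in> Q" by (rule less(1)) (use less(2-4) uv in \<open>auto simp: flip_def\<close>)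
      moreover have "(K, ?K) \<in> Q" using step[OF uv(1)] less uv by auto
      ultimately show ?thesis using trans by (meson transD)
    qed (use refl[OF less(2)] in simp)
  qed
  then show ?thesis using E by blast
qed

text \<open>A congruence is generated, as an equivalence relation, by the flips that it contracts:
  descend from \<open>E\<close> to the meet and ascend to \<open>E'\<close>, which stays within the
  class. As \<open>Q\<close> is an arbitrary equivalence, this applies both to other congruences and
  to equality of selected vertices.\<close>

lemma congruence_subset:
  assumes r: "lattice_congruence (AR A) r" and Q: "equiv \<R> Q"
    and step: "\<And>K u v. flip K u v \<Longrightarrow> flip_rope K u v \<notin> rope_ideal A r \<Longrightarrow> (K, insert (u, v) K) \<in> Q"
  shows "r \<subseteq> Q"
proof clarify
  fix E E' assume e: "(E, E') \<in> r"
  let ?M = "closure_meet E E'"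
  have EE': "E \<in> \<R>" "E' \<in> \<R>" using congruence_props(1)[OF r] e by auto
  have Qp: "\<And>K. K \<in> \<R> \<Longrightarrow> (K, K) \<in> Q" "trans Q" "sym Q" using Q by (auto simp: equiv_def refl_on_def)
  have "(?M, F) \<in> Q" if F: "F \<in> \<R>" "(?M, F) \<in> r" "?M \<subseteq> F" for F
  proof (rule chain_of_flips)
    fix K u v assume K: "flip K u v" "?M \<subseteq> K" "insert (u, v) K \<subseteq> F"
    then have "(?M, K) \<in> r" "(?M, insert (u, v) K) \<in> r"
      using congruence_interval[OF r F(2)] by (auto simp: flip_def)
    then have "(K, insert (u, v) K) \<in> r" using congruence_props(3,4)[OF r] by blast
    then show "(K, insert (u, v) K) \<in> Q" using step flip_congruence_iff[OF r K(1)] K by blast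
  qed (use F Qp closure_meet[OF EE'] in auto)
  then have "(?M, E) \<in> Q" "(?M, E') \<in> Q"
    using congruence_meet[OF r e] closure_meet[OF EE'] EE' by auto
  then show "(E, E') \<in> Q" using Qp by (meson symD transD)
qed

lemma congruence_determined:
  assumes "lattice_congruence (AR A) r" "lattice_congruence (AR A) r'" "rope_ideal A r = rope_ideal A r'"
  shows "r = r'"
proof (rule equalityI)
  show "r \<subseteq> r'"
    by (rule congruence_subset[OF assms(1)])
       (use assms flip_congruence_iff[OF assms(2)] lattice_congruenceD(1)[OF assms(2)] in auto)
  show "r' \<subseteq> r"
    by (rule congruence_subset[OF assms(2)])
       (use assms flip_congruence_iff[OF assms(1)] lattice_congruenceD(1)[OF assms(1)] in auto)
qed

section \<open>The congruence of a lower ideal of ropes\<close>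

definition below_relation :: "'v rope set \<Rightarrow> (('v \<times> 'v) set \<times> ('v \<times> 'v) set) set" where
  "below_relation I = {(E, E') \<in> \<R> \<times> \<R>.
     \<forall>\<rho> \<in> I. rope_join_irreducible A \<rho> \<subseteq> E \<longleftrightarrow> rope_join_irreducible A \<rho> \<subseteq> E'}"

lemma equiv_below_relation: "equiv \<R> (below_relation I)"
  by (auto simp: below_relation_def equiv_def refl_on_def sym_def trans_def)

definition lower_ideal :: "'v rope set \<Rightarrow> bool" where
  "lower_ideal I \<longleftrightarrow> I \<subseteq> ropes A \<and> (\<forall>\<rho> \<in> I. \<forall>\<sigma> \<in> ropes A. subrope \<sigma> \<rho> \<longrightarrow> \<sigma> \<in> I)"

lemma lower_ideal_join_irreducible:
  assumes "lower_ideal I" "\<rho> \<in> I"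
  shows "rope_join_irreducible A \<rho> \<in> \<R>"
  using assms rope_join_irreducible_flip(1) unfolding lower_ideal_def by (cases \<rho>) blast

lemma lower_ideal_swap: "lower_ideal I \<Longrightarrow> lower_ideal (swap_rope ` I)"
  unfolding lower_ideal_def
proof (intro conjI ballI impI)
  assume I: "I \<subseteq> ropes A \<and> (\<forall>\<rho> \<in> I. \<forall>\<sigma> \<in> ropes A. subrope \<sigma> \<rho> \<longrightarrow> \<sigma> \<in> I)"
  then show "swap_rope ` I \<subseteq> ropes A" using swap_rope_in_ropes by auto
  fix \<rho> \<sigma> assume "\<rho> \<in> swap_rope ` I" "\<sigma> \<in> ropes A" "subrope \<sigma> \<rho>"
  then have "swap_rope \<rho> \<in> I" "swap_rope \<sigma> \<in> ropes A" "subrope (swap_rope \<sigma>) (swap_rope \<rho>)"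
    by (auto simp: swap_rope_in_ropes subrope_swap)
  then have "swap_rope \<sigma> \<in> I" using I by blast
  then show "\<sigma> \<in> swap_rope ` I" by (metis image_eqI swap_rope_swap)
qed

text \<open>The join irreducible of the flip rope lies below the upper end of the flip only, so it
  separates the two ends if its rope is in \<open>I\<close>. Conversely, a separating join
  irreducible contains \<open>(u, v)\<close>. Then \<open>u\<close>, \<open>v\<close> and all
  vertices between them lie on its rope, and the arcs that it shares with \<open>E\<close> sort
  these vertices in the same way, so the flip rope is a subrope and belongs to
  \<open>I\<close>.\<close>

lemma flip_below_relation:
  assumes I: "lower_ideal I" and fl: "flip E u v"
  shows "(E, insert (u, v) E) \<in> below_relation I \<longleftrightarrow> flip_rope E u v \<notin> I"
proof -
  have E: "E \<in> \<R>" "insert (u, v) E \<in> \<R>" "(u, v) \<in> A" "(u, v) \<notin> E" using fl by (auto simp: flip_def)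
  show ?thesis
  proof
    assume b: "(E, insert (u, v) E) \<in> below_relation I"
    have "(u, v) \<in> rope_join_irreducible A (flip_rope E u v)" using E by (simp add: flip_rope_def)
    then show "flip_rope E u v \<notin> I"
      using flip_join_irreducible_subset[OF fl] E(4) b unfolding below_relation_def by blast
  next
    assume notin: "flip_rope E u v \<notin> I"
    have "rope_join_irreducible A \<rho> \<subseteq> E"
      if \<rho>: "\<rho> \<in> I" "rope_join_irreducible A \<rho> \<subseteq> insert (u, v) E" for \<rho>
    proof (rule ccontr)
      assume n: "\<not> ?thesis"
      obtain a b dn up where e: "\<rho> = (a, b, dn, up)" by (cases \<rho>) auto
      let ?J = "rope_join_irreducible A \<rho>"
      have r: "(a, b) \<in> A" "dn \<inter> up = {}" "dn \<union> up = between a b"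
        using I \<rho>(1) mem_ropes[of a b dn up] e unfolding lower_ideal_def by blast+
      have uv: "(u, v) \<in> ?J" using n \<rho> by blast
      then have ends: "u \<in> insert a up" "v \<in> insert b dn" by (auto simp: e)
      have supp: "transitive_support A a b = insert a (insert b (dn \<union> up))"
        using transitive_support_arc[OF r(1)] r by auto
      then have uvS: "u \<in> transitive_support A a b" "v \<in> transitive_support A a b" using ends
        by auto
      have inJ: "(x, y) \<in> E" if "(x, y) \<in> ?J" "(x, y) \<noteq> (u, v)" for x y using \<rho> that by blast
      have mid: "w \<in> dn \<and> (u, w) \<in> E \<or> w \<in> up \<and> (u, w) \<notin> E" if w: "w \<in> between u v" for w
      proof -
        have wn: "w \<noteq> u" "w \<noteq> v" using w arc_neq by auto
        have "w \<in> transitive_support A a b" using support_convex[OF r(1) uvS] w by auto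
        moreover have "w \<noteq> a"
        proof
          assume "w = a"
          then have "u \<in> up" "(u, a) \<in> A" using ends w wn by auto
          then show False using r asym by auto
        qed
        moreover have "w \<noteq> b"
        proof
          assume "w = b"
          then have "v \<in> dn" "(b, v) \<in> A" using ends w wn by auto
          then show False using r asym by auto
        qed
        ultimately consider "w \<in> dn" | "w \<in> up" using supp by auto
        then show ?thesis
        proof cases
          case 1
          then have "(u, w) \<in> ?J" using ends w by (simp add: e)
          then show ?thesis using inJ wn 1 by auto
        next
          case 2
          then have "(w, v) \<in> ?J" using ends w by (simp add: e)
          then have "(w, v) \<in> E" using inJ wn by auto
          then show ?thesis using 2 AR_closed[OF E(1), of u w v] E by auto
        qed
      qed
      have "subrope (flip_rope E u v) \<rho>"
        unfolding e flip_rope_def using ends mid r(2) by auto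
      then have "flip_rope E u v \<in> I"
        using I \<rho>(1) flip_rope_in_ropes[OF E(3)] unfolding lower_ideal_def by blast
      then show False using notin by simp
    qed
    then show "(E, insert (u, v) E) \<in> below_relation I"
      using E unfolding below_relation_def by blast
  qed
qed

text \<open>The analogue of \<open>congruence_subset\<close> before the relation is known to be a
  congruence. A relevant join irreducible below \<open>E\<close> is also below \<open>E'\<close>,
  hence below their meet, so every chain from the meet up to \<open>E\<close> or \<open>E'\<close>
  stays within the class.\<close>

lemma below_relation_subset:
  assumes I: "lower_ideal I" and Q: "equiv \<R> Q"
    and step: "\<And>K u v. flip K u v \<Longrightarrow> flip_rope K u v \<notin> I \<Longrightarrow> (K, insert (u, v) K) \<in> Q"
  shows "below_relation I \<subseteq> Q"
proof clarify
  fix E E' assume e: "(E, E') \<in> below_relation I"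
  let ?M = "closure_meet E E'" and ?J = "rope_join_irreducible A"
  have EE': "E \<in> \<R>" "E' \<in> \<R>" and J: "\<And>\<rho>. \<rho> \<in> I \<Longrightarrow> ?J \<rho> \<subseteq> E \<longleftrightarrow> ?J \<rho> \<subseteq> E'"
    using e by (auto simp: below_relation_def)
  note M = closure_meet[OF EE']
  have Qp: "\<And>K. K \<in> \<R> \<Longrightarrow> (K, K) \<in> Q" "trans Q" "sym Q" using Q by (auto simp: equiv_def refl_on_def)
  note JR = lower_ideal_join_irreducible[OF I]
  have JM: "?J \<rho> \<subseteq> ?M" if "\<rho> \<in> I" "?J \<rho> \<subseteq> E \<or> ?J \<rho> \<subseteq> E'" for \<rho>
    using M(4)[OF JR[OF that(1)]] J[OF that(1)] that(2) by blast
  have "(?M, F) \<in> Q" if F: "F \<in> \<R>" "F = E \<or> F = E'" for F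
  proof (rule chain_of_flips)
    fix K u v assume K: "flip K u v" "?M \<subseteq> K" "insert (u, v) K \<subseteq> F"
    have "?J \<rho> \<subseteq> K" if "\<rho> \<in> I" "?J \<rho> \<subseteq> insert (u, v) K" for \<rho>
      using JM[OF that(1)] that(2) K F by blast
    then have "(K, insert (u, v) K) \<in> below_relation I"
      using K unfolding below_relation_def flip_def by blast
    then show "(K, insert (u, v) K) \<in> Q" using step flip_below_relation[OF I K(1)] K by blast
  qed (use F Qp M in auto)
  then have "(?M, E) \<in> Q" "(?M, E') \<in> Q" using EE' by auto
  then show "(E, E') \<in> Q" using Qp by (meson symD transD)
qed

lemma flip_complement:
  assumes "flip E u v"
  shows "flip (A - insert (u, v) E) u v" "flip_rope (A - insert (u, v) E) u v = swap_rope (flip_rope E u v)"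
    "insert (u, v) (A - insert (u, v) E) = A - E"
proof -
  have E: "E \<in> \<R>" "insert (u, v) E \<in> \<R>" "(u, v) \<in> A" "(u, v) \<notin> E" using assms
    by (auto simp: flip_def)
  show *: "insert (u, v) (A - insert (u, v) E) = A - E" using E by auto
  show "flip (A - insert (u, v) E) u v"
    unfolding flip_def * using E AR_complement by auto
  show "flip_rope (A - insert (u, v) E) u v = swap_rope (flip_rope E u v)"
    using arc_neq by (auto simp: flip_rope_def)
qed

text \<open>The meet irreducible dual to a rope is the complement of the join irreducible of the rope with
  both sides exchanged. Comparing with join irreducibles below or with meet irreducibles above gives
  the same relation, the former being evidently compatible with meets and the latter with joins.\<close>

lemma below_relation_complement:
  assumes I: "lower_ideal I"
  shows "below_relation I = {(E, E') \<in> \<R> \<times> \<R>. (A - E, A - E') \<in> below_relation (swap_rope ` I)}"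
proof -
  have sub: "below_relation I \<subseteq> {(E, E') \<in> \<R> \<times> \<R>. (A - E, A - E') \<in> below_relation (swap_rope ` I)}"
    if I: "lower_ideal I" for I
  proof (rule below_relation_subset[OF I])
    let ?Q = "{(E, E') \<in> \<R> \<times> \<R>. (A - E, A - E') \<in> below_relation (swap_rope ` I)}"
    show "equiv \<R> ?Q"
      using equiv_below_relation[of "swap_rope ` I"] AR_complement
      unfolding equiv_def refl_on_def sym_def trans_def by blast
    fix K u v assume K: "flip K u v" "flip_rope K u v \<notin> I"
    note c = flip_complement[OF K(1)]
    have "flip_rope (A - insert (u, v) K) u v \<notin> swap_rope ` I"
      unfolding c(2) using K(2) by (metis image_iff swap_rope_swap)
    then have "(A - insert (u, v) K, A - K) \<in> below_relation (swap_rope ` I)"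
      using flip_below_relation[OF lower_ideal_swap[OF I] c(1)] c(3) by simp
    then show "(K, insert (u, v) K) \<in> ?Q"
      using K equiv_below_relation by (auto simp: flip_def equiv_def dest: symD)
  qed
  have rev: "swap_rope ` swap_rope ` I = I" by (simp add: image_image)
  have "(E, E') \<in> below_relation I"
    if "E \<in> \<R>" "E' \<in> \<R>" "(A - E, A - E') \<in> below_relation (swap_rope ` I)" for E E'
  proof -
    have "(A - (A - E), A - (A - E')) \<in> below_relation I"
      using sub[OF lower_ideal_swap[OF I]] that(3) unfolding rev by blast
    moreover have "A - (A - E) = E" "A - (A - E') = E'" using that AR_subset by blast+
    ultimately show ?thesis by simp
  qed
  then show ?thesis using sub[OF I] by blast
qed

lemma below_relation_meet:
  assumes I: "lower_ideal I" and EF: "(E, E') \<in> below_relation I" "(F, F') \<in> below_relation I"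
  shows "(closure_meet E F, closure_meet E' F') \<in> below_relation I"
proof -
  have R: "E \<in> \<R>" "E' \<in> \<R>" "F \<in> \<R>" "F' \<in> \<R>" using EF by (auto simp: below_relation_def)
  have "rope_join_irreducible A \<rho> \<subseteq> closure_meet E F \<longleftrightarrow> rope_join_irreducible A \<rho> \<subseteq> closure_meet E' F'"
    if "\<rho> \<in> I" for \<rho>
  proof -
    have J: "rope_join_irreducible A \<rho> \<in> \<R>" by (rule lower_ideal_join_irreducible[OF I that])
    have "rope_join_irreducible A \<rho> \<subseteq> closure_meet X Y \<longleftrightarrow>
        rope_join_irreducible A \<rho> \<subseteq> X \<and> rope_join_irreducible A \<rho> \<subseteq> Y" if XY: "X \<in> \<R>" "Y \<in> \<R>" for X Y
      using closure_meet[OF XY] J by blast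
    then show ?thesis using R EF \<open>\<rho> \<in> I\<close> by (simp add: below_relation_def)
  qed
  then show ?thesis using closure_meet(1) R unfolding below_relation_def by blast
qed

lemma lattice_congruence_below_relation:
  assumes I: "lower_ideal I"
  shows "lattice_congruence (AR A) (below_relation I)"
proof -
  have "(x \<sqinter>\<^bsub>AR A\<^esub> y, x' \<sqinter>\<^bsub>AR A\<^esub> y') \<in> below_relation I \<and> (x \<squnion>\<^bsub>AR A\<^esub> y, x' \<squnion>\<^bsub>AR A\<^esub> y') \<in> below_relation I"
    if xy: "(x, x') \<in> below_relation I" "(y, y') \<in> below_relation I" for x x' y y'
  proof
    have R: "x \<in> \<R>" "x' \<in> \<R>" "y \<in> \<R>" "y' \<in> \<R>" using xy by (auto simp: below_relation_def)
    show "(x \<sqinter>\<^bsub>AR A\<^esub> y, x' \<sqinter>\<^bsub>AR A\<^esub> y') \<in> below_relation I"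
      using below_relation_meet[OF I xy] R by (simp add: meet_closure)
    have "(A - x, A - x') \<in> below_relation (swap_rope ` I)" "(A - y, A - y') \<in> below_relation (swap_rope ` I)"
      using xy below_relation_complement[OF I] by auto
    from below_relation_meet[OF lower_ideal_swap[OF I] this]
    have "(A - closure_join x y, A - closure_join x' y') \<in> below_relation (swap_rope ` I)"
      using R AR_subset by (simp add: closure_meet_def double_diff)
    then show "(x \<squnion>\<^bsub>AR A\<^esub> y, x' \<squnion>\<^bsub>AR A\<^esub> y') \<in> below_relation I"
      using R closure_join_AR by (simp add: join_closure below_relation_complement[OF I])
  qed
  then show ?thesis using equiv_below_relation[of I] unfolding lattice_congruence_def carrier_AR
    by blast
qed

lemma rope_ideal_below_relation:
  assumes I: "lower_ideal I"
  shows "rope_ideal A (below_relation I) = I"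
proof -
  have "\<rho> \<in> rope_ideal A (below_relation I) \<longleftrightarrow> \<rho> \<in> I" if \<rho>: "\<rho> \<in> ropes A" for \<rho>
  proof -
    obtain u v dn up where e: "\<rho> = (u, v, dn, up)" by (cases \<rho>) auto
    note J = rope_join_irreducible_flip[OF \<rho>[unfolded e]]
    show ?thesis
      using flip_below_relation[OF I J(4)] J(3) unfolding e mem_rope_ideal[OF \<rho>[unfolded e]] J(5)
      by (simp add: insert_absorb)
  qed
  moreover have "rope_ideal A (below_relation I) \<subseteq> ropes A" unfolding rope_ideal_def by blast
  ultimately show ?thesis using I unfolding lower_ideal_def by blast
qed

lemma rope_congruence:
  assumes "\<rho> \<in> ropes A"
  shows "lattice_congruence (AR A) (rope_congruence A \<rho>)"
    "rope_ideal A (rope_congruence A \<rho>) = {\<sigma> \<in> ropes A. subrope \<sigma> \<rho>}"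
    "generating_ropes A (rope_congruence A \<rho>) = {\<rho>}"
proof -
  let ?I = "{\<sigma> \<in> ropes A. subrope \<sigma> \<rho>}"
  have I: "lower_ideal ?I" using subrope_trans unfolding lower_ideal_def by blast
  have "\<exists>!r. lattice_congruence (AR A) r \<and> rope_ideal A r = ?I"
    using lattice_congruence_below_relation[OF I] rope_ideal_below_relation[OF I] congruence_determined
    by (intro ex1I[of _ "below_relation ?I"]) auto
  from theI'[OF this] show c: "lattice_congruence (AR A) (rope_congruence A \<rho>)"
    "rope_ideal A (rope_congruence A \<rho>) = ?I" by (auto simp: rope_congruence_def)
  show "generating_ropes A (rope_congruence A \<rho>) = {\<rho>}"
    unfolding generating_ropes_def c(2) using assms subrope_refl subrope_antisym by blast
qed

text \<open>Forcing in a hexagon: two chains lead from \<open>E\<close> to the set with all three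
  arcs, and each flips \<open>(u, v)\<close> in its middle. Joining a contracted bottom edge with
  the other atom, or meeting a contracted top edge with the other coatom, contracts an interval that
  contains the middle edge of the other chain.\<close>

lemma congruence_hexagon:
  assumes r: "lattice_congruence (AR A) r"
    and tri: "(u, w) \<in> A" "(w, v) \<in> A" "(u, v) \<in> A"
    and fresh: "(u, w) \<notin> E" "(w, v) \<notin> E" "(u, v) \<notin> E"
    and R: "E \<in> \<R>" "insert (u, w) E \<in> \<R>" "insert (w, v) E \<in> \<R>"
      "insert (u, v) (insert (u, w) E) \<in> \<R>" "insert (u, v) (insert (w, v) E) \<in> \<R>"
      "insert (u, v) (insert (u, w) (insert (w, v) E)) \<in> \<R>"
  shows "(E, insert (u, w) E) \<in> r \<Longrightarrow> (insert (w, v) E, insert (u, v) (insert (w, v) E)) \<in> r"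
    "(E, insert (w, v) E) \<in> r \<Longrightarrow> (insert (u, w) E, insert (u, v) (insert (u, w) E)) \<in> r"
    "(insert (u, v) (insert (u, w) E), insert (u, v) (insert (u, w) (insert (w, v) E))) \<in> r
      \<Longrightarrow> (insert (w, v) E, insert (u, v) (insert (w, v) E)) \<in> r"
    "(insert (u, v) (insert (w, v) E), insert (u, v) (insert (u, w) (insert (w, v) E))) \<in> r
      \<Longrightarrow> (insert (u, w) E, insert (u, v) (insert (u, w) E)) \<in> r"
proof -
  let ?P = "insert (u, w) E" and ?Q = "insert (w, v) E"
  let ?PP = "insert (u, v) ?P" and ?QQ = "insert (u, v) ?Q" and ?T = "insert (u, v) (insert (u, w) ?Q)"
  note refl = congruence_props(2)[OF r] and sym = congruence_props(3)[OF r] and trans = congruence_props(4)[OF r]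
  have neq: "(u, w) \<noteq> (w, v)" "(u, w) \<noteq> (u, v)" "(w, v) \<noteq> (u, v)" using tri arc_neq by auto
  have top: "?T \<subseteq> K" if "K \<in> \<R>" "?P \<subseteq> K" "?Q \<subseteq> K" for K
    using that AR_closed[OF that(1), of u w v] tri by auto
  have bot: "K \<subseteq> E" if "K \<in> \<R>" "K \<subseteq> ?PP" "K \<subseteq> ?QQ" for K
    using that AR_coclosed[OF that(1), of u v w] tri neq fresh by blast
  have PQ: "?P \<squnion>\<^bsub>AR A\<^esub> ?Q = ?T" "?Q \<squnion>\<^bsub>AR A\<^esub> ?P = ?T" using R top by (intro join_AR; blast)+
  have PPQQ: "?PP \<sqinter>\<^bsub>AR A\<^esub> ?QQ = E" "?QQ \<sqinter>\<^bsub>AR A\<^esub> ?PP = E" using R bot by (intro meet_AR; blast)+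
  have joinE: "E \<squnion>\<^bsub>AR A\<^esub> X = X" if "X \<in> \<R>" "E \<subseteq> X" for X using R that by (intro join_AR) auto
  have meetT: "?T \<sqinter>\<^bsub>AR A\<^esub> X = X" if "X \<in> \<R>" "X \<subseteq> ?T" for X using R that by (intro meet_AR) auto
  show "(?Q, ?QQ) \<in> r" if "(E, ?P) \<in> r"
  proof -
    have "(?Q, ?T) \<in> r" using lattice_congruenceD(3)[OF r that refl[OF R(3)]] R
      by (simp add: joinE PQ subset_insertI)
    then show ?thesis by (rule congruence_interval[OF r]) (use R in auto)
  qed
  show "(?P, ?PP) \<in> r" if "(E, ?Q) \<in> r"
  proof -
    have "(?P, ?T) \<in> r" using lattice_congruenceD(3)[OF r that refl[OF R(2)]] R
      by (simp add: joinE PQ subset_insertI)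
    then show ?thesis by (rule congruence_interval[OF r]) (use R in auto)
  qed
  show "(?Q, ?QQ) \<in> r" if "(?PP, ?T) \<in> r"
  proof -
    have "?QQ \<subseteq> ?T" by auto
    then have E: "(E, ?QQ) \<in> r" using lattice_congruenceD(2)[OF r that refl[OF R(5)]] R
      by (simp add: meetT PPQQ)
    then have "(E, ?Q) \<in> r" by (rule congruence_interval[OF r]) (use R in auto)
    then show ?thesis using E sym trans by blast
  qed
  show "(?P, ?PP) \<in> r" if "(?QQ, ?T) \<in> r"
  proof -
    have "?PP \<subseteq> ?T" by auto
    then have E: "(E, ?PP) \<in> r" using lattice_congruenceD(2)[OF r that refl[OF R(4)]] R
      by (simp add: meetT PPQQ)
    then have "(E, ?P) \<in> r" by (rule congruence_interval[OF r]) (use R in auto)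
    then show ?thesis using E sym trans by blast
  qed
qed

text \<open>A hexagon is built in which \<open>u\<close>, \<open>w\<close>, \<open>v\<close> are
  permuted while all other vertices of the support keep the side prescribed by the rope. Its end
  edges carry the two halves of the rope cut at \<open>w\<close>, and one of its middle edges
  carries the rope itself; contracting a half would contract the whole.\<close>

lemma rope_ideal_shorten:
  assumes r: "lattice_congruence (AR A) r" and \<rho>: "(u, v, dn, up) \<in> rope_ideal A r" and w: "w \<in> between u v"
  shows "(u, w, dn \<inter> between u w, up \<inter> between u w) \<in> rope_ideal A r"
    "(w, v, dn \<inter> between w v, up \<inter> between w v) \<in> rope_ideal A r"
proof -
  let ?s = "(u, w, dn \<inter> between u w, up \<inter> between u w)" and ?t = "(w, v, dn \<inter> between w v, up \<inter> between w v)"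
  have ro: "(u, v) \<in> A" "dn \<inter> up = {}" "dn \<union> up = between u v"
    using \<rho> by (auto simp: rope_ideal_def mem_ropes)
  have tri: "(u, w) \<in> A" "(w, v) \<in> A" using w by auto
  have neq: "u \<noteq> w" "w \<noteq> v" "u \<noteq> v" using tri ro arc_neq by auto
  have rev: "(w, u) \<notin> A" "(v, w) \<notin> A" "(v, u) \<notin> A" using tri ro asym by auto
  let ?S = "transitive_support A u v"
  have S: "u \<in> ?S" "w \<in> ?S" "v \<in> ?S" using transitive_support_arc[OF ro(1)] w by auto
  \<comment> \<open>The heights 0 for \<open>dn\<close> and 4 for \<open>up\<close> leave 1, 2, 3
    for the permutations of \<open>u\<close>, \<open>w\<close>, \<open>v\<close>. The rest of the
    rope thus never interferes.\<close>
  define f where "f = (\<lambda>a b c z. if z = u then a else if z = w then b else if z = v then c else if z \<in> dn then 0 else 4 :: nat)"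
  have fz: "f a b c z = (if z = u then a else if z = w then b else if z = v then c else if z \<in> dn then 0 else 4)"
    for a b c :: nat and z by (simp add: f_def)
  let ?L = "\<lambda>a b c. levels u v (f a b c)"
  have LR: "?L a b c \<in> \<R>" for a b c by (rule levels_AR[OF ro(1)])
  have mem: "(x, y) \<in> ?L a b c \<longleftrightarrow> (x, y) \<in> A \<and> x \<in> ?S \<and> y \<in> ?S \<and> f a b c y < f a b c x" for x y a b c
    by (simp add: levels_def)
  let ?E = "?L 1 2 3"
  have eqs: "insert (u, w) ?E = ?L 2 1 3" "insert (w, v) ?E = ?L 1 3 2"
    "insert (u, v) (insert (u, w) ?E) = ?L 3 1 2" "insert (u, v) (insert (w, v) ?E) = ?L 2 3 1"
    "insert (u, v) (insert (u, w) (insert (w, v) ?E)) = ?L 3 2 1"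
    by (rule Set.set_eqI; clarify; simp add: mem; (insert neq tri ro(1) rev S; simp add: fz; fastforce))+
  have fresh: "(u, w) \<notin> ?E" "(w, v) \<notin> ?E" "(u, v) \<notin> ?E" using neq by (auto simp: mem fz)
  have ins: "insert (u, v) (?L 2 1 3) = ?L 3 1 2" "insert (u, v) (?L 1 3 2) = ?L 2 3 1"
    "insert (u, w) (?L 2 3 1) = ?L 3 2 1" "insert (w, v) (?L 3 1 2) = ?L 3 2 1"
    "insert (u, v) (insert (u, w) (?L 1 3 2)) = ?L 3 2 1"
    by (simp_all only: eqs[symmetric] insert_commute)
  note hex = congruence_hexagon[OF r tri ro(1) fresh, unfolded eqs(1,2) ins, OF LR LR LR LR LR LR]
  have uwS: "z \<in> between u v \<and> z \<noteq> w" if "z \<in> between u w" for z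
    using support_convex[OF ro(1) S(1,2), of z] that tri arc_neq rev asym
    unfolding transitive_support_arc[OF ro(1)] by auto
  have wvS: "z \<in> between u v \<and> z \<noteq> w" if "z \<in> between w v" for z
    using support_convex[OF ro(1) S(2,3), of z] that tri arc_neq rev asym
    unfolding transitive_support_arc[OF ro(1)] by auto
  have betw: "z \<noteq> u" "z \<noteq> v" "z \<in> ?S" "z \<in> up \<longleftrightarrow> z \<notin> dn" if "z \<in> between u v" for z
    using that arc_neq ro unfolding transitive_support_arc[OF ro(1)] by auto
  have side: "(x, z) \<in> ?L a b c \<longleftrightarrow> (x, z) \<in> A \<and> z \<in> dn"
    if "z \<in> between u v" "z \<noteq> w" "x \<in> {u, w, v}" "a \<in> {1, 2, 3}" "b \<in> {1, 2, 3}" "c \<in> {1, 2, 3}" for x z a b c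
    using that betw[OF that(1)] S neq by (auto simp: mem fz)
  have rope_uw: "flip_rope (?L a b c) u w = ?s" if "a \<in> {1, 2, 3}" "b \<in> {1, 2, 3}" "c \<in> {1, 2, 3}" for a b c
    unfolding flip_rope_def using uwS side[OF _ _ _ that, of _ u] betw(4) by auto
  have rope_wv: "flip_rope (?L a b c) w v = ?t" if "a \<in> {1, 2, 3}" "b \<in> {1, 2, 3}" "c \<in> {1, 2, 3}" for a b c
    unfolding flip_rope_def using wvS side[OF _ _ _ that, of _ w] betw(4) by auto
  have rope_uv: "flip_rope (?L a b c) u v = (u, v, dn, up)"
    if "w \<in> dn \<longleftrightarrow> b < a" "a \<in> {1, 2, 3}" "b \<in> {1, 2, 3}" "c \<in> {1, 2, 3}" for a b c
  proof -
    have "(u, z) \<in> ?L a b c \<longleftrightarrow> z \<in> dn" if z: "z \<in> between u v" for z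
    proof (cases "z = w")
      case True
      then show ?thesis using that tri S neq \<open>w \<in> dn \<longleftrightarrow> b < a\<close> by (auto simp: mem fz)
    next
      case False
      then show ?thesis using side[OF z False _ \<open>a \<in> _\<close> \<open>b \<in> _\<close> \<open>c \<in> _\<close>, of u] z by auto
    qed
    then show ?thesis unfolding flip_rope_def using ro by auto
  qed
  have flipI: "flip (?L a b c) x y"
    if "insert (x, y) (?L a b c) = ?L a' b' c'" "(x, y) \<in> A" "\<not> f a b c y < f a b c x" for a b c a' b' c' x y
    unfolding flip_def that(1) using LR that(2,3) mem by blast
  have flips: "flip ?E u w" "flip ?E w v" "flip (?L 2 1 3) u v" "flip (?L 1 3 2) u v" "flip (?L 2 3 1) u w" "flip (?L 3 1 2) w v"
    by (rule flipI, rule eqs ins, (simp add: tri ro(1)), (use neq in \<open>simp add: fz\<close>))+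
  note cong = flips[THEN flip_congruence_iff[OF r], unfolded eqs(1,2) ins]
  \<comment> \<open>Which middle edge carries the given rope depends on the side of
    \<open>w\<close>: height 1 puts it below \<open>u\<close> and \<open>v\<close>, height 3 above
    them.\<close>
  have "\<not> (?L 2 1 3, ?L 3 1 2) \<in> r" if "w \<in> dn" using cong(3) rope_uv[of 1 2 3] that \<rho> by simp
  moreover have "\<not> (?L 1 3 2, ?L 2 3 1) \<in> r" if "w \<notin> dn" using cong(4) rope_uv[of 3 1 2] that \<rho>
    by simp
  ultimately show "?s \<in> rope_ideal A r" "?t \<in> rope_ideal A r"
    using hex cong(1,2,5,6) by (simp_all add: rope_uw rope_wv) blast+
qed

text \<open>Every subrope arises by at most two cuts, first at its initial vertex \<open>a\<close>
  and then at its final vertex \<open>b\<close>.\<close>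

lemma lower_ideal_rope_ideal:
  assumes r: "lattice_congruence (AR A) r"
  shows "lower_ideal (rope_ideal A r)"
  unfolding lower_ideal_def
proof (intro conjI ballI impI)
  show "rope_ideal A r \<subseteq> ropes A" by (auto simp: rope_ideal_def)
  fix \<rho> \<sigma> assume \<rho>: "\<rho> \<in> rope_ideal A r" and \<sigma>: "\<sigma> \<in> ropes A" "subrope \<sigma> \<rho>"
  obtain u v dn up a b dn' up' where e: "\<rho> = (u, v, dn, up)" "\<sigma> = (a, b, dn', up')"
    by (cases \<rho>; cases \<sigma>) auto
  have ro: "(u, v) \<in> A" "dn \<inter> up = {}" "dn \<union> up = between u v"
    using \<rho> by (auto simp: e rope_ideal_def mem_ropes)
  have so: "(a, b) \<in> A" "dn' \<inter> up' = {}" "dn' \<union> up' = between a b" using \<sigma>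
    by (auto simp: e mem_ropes)
  have sub: "a \<in> {u, v} \<union> between u v" "b \<in> {u, v} \<union> between u v" "dn' \<subseteq> dn" "up' \<subseteq> up" using \<sigma> ro
    by (auto simp: e)
  have av: "a \<noteq> v" using sub(2) so(1) ro(1) asym arc_neq by auto
  have bu: "b \<noteq> u" using sub(1) so(1) ro(1) asym arc_neq by auto
  have dn': "dn' = dn \<inter> between a b" "up' = up \<inter> between a b" using sub so ro by auto
  have 1: "(a, v, dn \<inter> between a v, up \<inter> between a v) \<in> rope_ideal A r"
  proof (cases "a = u")
    case True
    then have "dn \<inter> between a v = dn" "up \<inter> between a v = up" using ro by auto
    then show ?thesis using \<rho> True by (simp add: e)
  next
    case False
    then show ?thesis using rope_ideal_shorten(2)[OF r \<rho>[unfolded e]] sub av by auto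
  qed
  show "\<sigma> \<in> rope_ideal A r"
  proof (cases "b = v")
    case True
    then show ?thesis using 1 dn' by (simp add: e)
  next
    case False
    then have bv: "b \<in> between a v" using sub so bu by auto
    have "between a b \<subseteq> between a v"
    proof
      fix z assume z: "z \<in> between a b"
      have "(a, v) \<in> A" using 1 by (auto simp: rope_ideal_def mem_ropes)
      then show "z \<in> between a v"
        using filled_between[of a z v] z bv by (auto intro: trancl.intros)
    qed
    then have "dn \<inter> between a v \<inter> between a b = dn'" "up \<inter> between a v \<inter> between a b = up'"
      using dn' by auto
    then show ?thesis using rope_ideal_shorten(1)[OF r 1 bv] by (simp add: e)
  qed
qed

lemma rope_ideal_generated:
  assumes r: "lattice_congruence (AR A) r"
  shows "\<tau> \<in> rope_ideal A r \<longleftrightarrow> \<tau> \<in> ropes A \<and> (\<exists>\<rho> \<in> generating_ropes A r. subrope \<tau> \<rho>)"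
proof
  assume \<tau>: "\<tau> \<in> rope_ideal A r"
  let ?I = "rope_ideal A r"
  have "finite ?I" by simp
  have "\<exists>\<rho> \<in> generating_ropes A r. subrope \<tau> \<rho>" using \<tau>
  proof (induction "card {\<sigma> \<in> ?I. subrope \<tau> \<sigma>}" arbitrary: \<tau> rule: less_induct)
    case less
    show ?case
    proof (cases "\<tau> \<in> generating_ropes A r")
      case True
      then show ?thesis using subrope_refl by blast
    next
      case False
      then obtain \<sigma> where \<sigma>: "\<sigma> \<in> ?I" "subrope \<tau> \<sigma>" "\<sigma> \<noteq> \<tau>" using less
        by (auto simp: generating_ropes_def)
      have ro: "\<tau> \<in> ropes A" "\<sigma> \<in> ropes A" using less \<sigma> by (auto simp: rope_ideal_def)
      have "{\<kappa> \<in> ?I. subrope \<sigma> \<kappa>} \<subset> {\<kappa> \<in> ?I. subrope \<tau> \<kappa>}"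
        using \<sigma> less(2) subrope_trans subrope_refl subrope_antisym[OF ro] by blast
      then have "card {\<kappa> \<in> ?I. subrope \<sigma> \<kappa>} < card {\<kappa> \<in> ?I. subrope \<tau> \<kappa>}"
        by (intro psubset_card_mono) auto
      then obtain \<rho> where "\<rho> \<in> generating_ropes A r" "subrope \<sigma> \<rho>" using less \<sigma> by blast
      then show ?thesis using \<sigma> subrope_trans by blast
    qed
  qed
  then show "\<tau> \<in> ropes A \<and> (\<exists>\<rho> \<in> generating_ropes A r. subrope \<tau> \<rho>)" using \<tau>
    by (auto simp: rope_ideal_def)
next
  assume "\<tau> \<in> ropes A \<and> (\<exists>\<rho> \<in> generating_ropes A r. subrope \<tau> \<rho>)"
  then show "\<tau> \<in> rope_ideal A r"
    using lower_ideal_rope_ideal[OF r] unfolding lower_ideal_def generating_ropes_def by blast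
qed

end

section \<open>Paths in a polygon\<close>

text \<open>A finite set of numbers encodes the increasing path through its elements, and the steps
  are the edges of this path; inserting a vertex only splits one of them.\<close>

definition steps :: "nat set \<Rightarrow> (nat \<times> nat) set" where
  "steps V = {(x, y). x \<in> V \<and> y \<in> V \<and> x < y \<and> V \<inter> {x<..<y} = {}}"

definition step_sum :: "(nat \<Rightarrow> nat \<Rightarrow> 'a::ab_group_add) \<Rightarrow> nat set \<Rightarrow> 'a" where
  "step_sum c V = (\<Sum>(x, y) \<in> steps V. c x y)"

lemma finite_steps: "finite V \<Longrightarrow> finite (steps V)"
  by (rule finite_subset[of _ "V \<times> V"]) (auto simp: steps_def)

lemma steps_insert:
  assumes "(l, r) \<in> steps V" "l < z" "z < r"
  shows "steps (insert z V) = insert (l, z) (insert (z, r) (steps V - {(l, r)}))"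
proof -
  have *: "l \<in> V" "r \<in> V" "V \<inter> {l<..<r} = {}" and "z \<notin> V" using assms by (auto simp: steps_def)
  show ?thesis
  proof (intro equalityI subsetI)
    fix p assume "p \<in> steps (insert z V)"
    then obtain x y where p: "p = (x, y)" "x \<in> insert z V" "y \<in> insert z V" "x < y"
      "insert z V \<inter> {x<..<y} = {}" by (auto simp: steps_def)
    consider "x = z" | "y = z" | "x \<noteq> z" "y \<noteq> z" by auto
    then show "p \<in> insert (l, z) (insert (z, r) (steps V - {(l, r)}))"
    proof cases
      case 1
      then have "y \<in> V" using p by auto
      then have "y = r" using 1 p * assms
        by (metis Int_iff greaterThanLessThan_iff insert_iff linorder_neqE_nat less_trans empty_iff)
      then show ?thesis using 1 p by auto
    next
      case 2
      then have "x \<in> V" using p by auto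
      then have "x = l" using 2 p * assms
        by (metis Int_iff greaterThanLessThan_iff insert_iff linorder_neqE_nat less_trans empty_iff)
      then show ?thesis using 2 p by auto
    next
      case 3
      then show ?thesis using p assms by (auto simp: steps_def)
    qed
  next
    fix p assume "p \<in> insert (l, z) (insert (z, r) (steps V - {(l, r)}))"
    then consider "p = (l, z)" | "p = (z, r)" | x y where "p = (x, y)" "(x, y) \<in> steps V" "(x, y) \<noteq> (l, r)"
      by (cases p) auto
    then show "p \<in> steps (insert z V)"
    proof cases
      case 3
      have "\<not> (x < z \<and> z < y)"
      proof
        assume "x < z \<and> z < y"
        then have "x \<ge> l \<and> y \<le> r" "x \<le> l" "y \<ge> r" using 3 * assms
          by (auto simp: steps_def disjoint_iff)
        then show False using 3(3) by auto
      qed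
      then show ?thesis using 3 by (auto simp: steps_def)
    qed (use * assms in \<open>auto simp: steps_def\<close>)
  qed
qed

lemma step_sum_insert:
  assumes "finite V" "(l, r) \<in> steps V" "l < z" "z < r"
  shows "step_sum c (insert z V) = step_sum c V - c l r + c l z + c z r"
proof -
  have z: "z \<notin> V" using assms by (auto simp: steps_def)
  have fin: "finite (steps V)" by (simp add: assms finite_steps)
  have "(l, z) \<notin> steps V" "(z, r) \<notin> steps V" using z by (auto simp: steps_def)
  then have "step_sum c (insert z V) = c l z + (c z r + (\<Sum>(x, y) \<in> steps V - {(l, r)}. c x y))"
    unfolding step_sum_def steps_insert[OF assms(2-4)] using fin assms by simp
  moreover have "step_sum c V = c l r + (\<Sum>(x, y) \<in> steps V - {(l, r)}. c x y)"
    unfolding step_sum_def by (subst sum.remove[OF fin assms(2)]) simp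
  ultimately show ?thesis by (simp add: algebra_simps)
qed

lemma step_around:
  assumes "finite V" "lo \<in> V" "hi \<in> V" "lo < z" "z < hi" "z \<notin> V"
  obtains l r where "(l, r) \<in> steps V" "l < z" "z < r"
proof
  let ?L = "{x \<in> V. x < z}" and ?R = "{x \<in> V. z < x}"
  have L: "finite ?L" "?L \<noteq> {}" and R: "finite ?R" "?R \<noteq> {}" using assms by auto
  note maxL = Max_in[OF L] and minR = Min_in[OF R]
  show "Max ?L < z" "z < Min ?R" using maxL minR by auto
  have "V \<inter> {Max ?L<..<Min ?R} = {}"
  proof (rule ccontr)
    assume "V \<inter> {Max ?L<..<Min ?R} \<noteq> {}"
    then obtain y where y: "y \<in> V" "Max ?L < y" "y < Min ?R" by auto
    then have "y \<notin> ?L" "y \<notin> ?R" using Max_ge[OF L(1), of y] Min_le[OF R(1), of y] by fastforce+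
    then show False using y assms by (auto simp: not_less)
  qed
  then show "(Max ?L, Min ?R) \<in> steps V" using maxL minR by (auto simp: steps_def)
qed

text \<open>Each inner vertex is the end of one step and the start of the next, so it receives both
  its \<open>P\<close> and its \<open>Q\<close> term; the first and the last vertex receive one term
  each.\<close>

lemma step_sum_telescope:
  fixes P Q :: "nat \<Rightarrow> 'a::ab_group_add"
  assumes "finite V" "V \<subseteq> {1..n}"
  shows "step_sum (\<lambda>x y. P y - Q x) (insert 0 (insert (Suc n) V)) =
    P (Suc n) - Q 0 + (\<Sum>v \<in> V. P v - Q v)"
  using assms
proof (induction V rule: finite_induct)
  case empty
  have "steps {0, Suc n} = {(0, Suc n)}" by (auto simp: steps_def)
  then show ?case by (simp add: step_sum_def)
next
  case (insert z V)
  let ?V = "insert 0 (insert (Suc n) V)"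
  have z: "0 < z" "z < Suc n" "z \<notin> ?V" using insert by auto
  obtain l r where "(l, r) \<in> steps ?V" "l < z" "z < r"
    using step_around[of ?V 0 "Suc n" z] insert z by auto
  then have "step_sum (\<lambda>x y. P y - Q x) (insert z ?V) =
    step_sum (\<lambda>x y. P y - Q x) ?V - (P r - Q l) + (P z - Q l) + (P r - Q z)"
    using insert by (subst step_sum_insert) auto
  then show ?case using insert by (simp add: insert_commute algebra_simps)
qed

text \<open>A pair \<open>x < y\<close> stands for a diagonal of a polygon with vertices \<open>0, \<dots>, n + 1\<close>, where the
  vertices in \<open>D\<close> lie above and all others below the segment from \<open>0\<close> to \<open>n + 1\<close>. The set
  \<open>diagonal_set n D x y\<close> consists of the labels below the diagonal. A subset \<open>W\<close> of
  \<open>{1..n}\<close> determines the path through \<open>0\<close>, \<open>n + 1\<close>, the upper vertices in \<open>W\<close> and the lower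
  vertices not in \<open>W\<close>.\<close>

definition diagonal_set :: "nat \<Rightarrow> nat set \<Rightarrow> nat \<Rightarrow> nat \<Rightarrow> nat set" where
  "diagonal_set n D x y = ({x<..<y} - D) \<union> (if x \<in> D then {1..x} else {}) \<union> (if y \<in> D then {y..n} else {})"

definition polygon_path :: "nat \<Rightarrow> nat set \<Rightarrow> nat set \<Rightarrow> nat set" where
  "polygon_path n D W = insert 0 (insert (Suc n) {i \<in> {1..n}. i \<in> D \<longleftrightarrow> i \<in> W})"

text \<open>The right-hand side of a facet inequality, as a real polynomial in the size of the set.
  Its degree two is what lets second differences factor in
  \<open>diagonal_height_exchange\<close>.\<close>

definition triangular :: "real \<Rightarrow> real" where
  "triangular s = s * (s + 1) / 2"

lemma triangular_of_nat: "triangular (real k) = real (Suc k choose 2)"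
proof -
  have "even (k * Suc k)" by simp
  then have "real (Suc k choose 2) * 2 = real (k * Suc k)"
    by (simp add: choose_two real_of_nat_div ac_simps)
  then show ?thesis by (simp add: triangular_def algebra_simps)
qed

text \<open>Chosen with \<open>right_weight\<close> such that the weight of the set below a diagonal
  is a difference of one term per end: the lower labels up to \<open>x\<close> are counted in both
  and cancel.\<close>

definition left_weight :: "nat \<Rightarrow> nat set \<Rightarrow> (nat \<Rightarrow> real) \<Rightarrow> nat \<Rightarrow> real" where
  "left_weight n D z x = sum z ({1..x} - D) - (if x \<in> D then sum z {1..x} else 0)"

definition right_weight :: "nat \<Rightarrow> nat set \<Rightarrow> (nat \<Rightarrow> real) \<Rightarrow> nat \<Rightarrow> real" where
  "right_weight n D z y = sum z ({1..<y} - D) + (if y \<in> D then sum z {y..n} else 0)"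

lemma sum_diagonal_set:
  assumes "x < y"
  shows "sum z (diagonal_set n D x y) = right_weight n D z y - left_weight n D z x"
proof -
  have "sum z (diagonal_set n D x y) = sum z ({x<..<y} - D) + (if x \<in> D then sum z {1..x} else 0)
    + (if y \<in> D then sum z {y..n} else 0)"
    unfolding diagonal_set_def
    by (subst sum.union_disjoint; (subst sum.union_disjoint)?) (use assms in \<open>auto\<close>)
  moreover have "{1..<y} - D = ({1..x} - D) \<union> ({x<..<y} - D)" using assms by auto
  then have "sum z ({1..<y} - D) = sum z ({1..x} - D) + sum z ({x<..<y} - D)"
    by (simp add: sum.union_disjoint disjoint_iff)
  ultimately show ?thesis by (simp add: left_weight_def right_weight_def)
qed

definition diagonal_height :: "nat \<Rightarrow> nat set \<Rightarrow> nat \<Rightarrow> nat \<Rightarrow> real" where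
  "diagonal_height n D x y = triangular (card (diagonal_set n D x y))"

text \<open>By \<open>path_decomposition\<close>, the sets below the steps of the path of
  \<open>W\<close> cover each label of \<open>W\<close> exactly once more than each other label, and
  the latter \<open>card (W \<inter> D)\<close> times. Adding the facet inequalities along the path
  and subtracting that many copies of the total sum therefore bounds the sum over \<open>W\<close>;
  this is the resulting bound.\<close>

definition path_support :: "nat \<Rightarrow> nat set \<Rightarrow> nat set \<Rightarrow> real" where
  "path_support n D W = step_sum (diagonal_height n D) (polygon_path n D W)
     - real (card (W \<inter> D)) * triangular n"

lemma finite_polygon_path: "finite (polygon_path n D W)"
  by (simp add: polygon_path_def)

lemma step_sum_cong:
  assumes "\<And>x y. x \<in> V \<Longrightarrow> y \<in> V \<Longrightarrow> x < y \<Longrightarrow> c x y = c' x y"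
  shows "step_sum c V = step_sum c' V"
  unfolding step_sum_def by (rule sum.cong) (use assms in \<open>auto simp: steps_def\<close>)

lemma step_sum_mono:
  fixes c :: "nat \<Rightarrow> nat \<Rightarrow> real"
  assumes "\<And>x y. (x, y) \<in> steps V \<Longrightarrow> c x y \<le> c' x y"
  shows "step_sum c V \<le> step_sum c' V"
  unfolding step_sum_def by (rule sum_mono) (use assms in auto)

text \<open>Since \<open>z\<close> is arbitrary, this is an identity of indicator functions.
  Telescoping starts from the sum over all lower labels; a lower label on the path, hence outside
  \<open>W\<close>, removes itself, and an upper label on the path, hence in \<open>W\<close>, adds
  itself together with one copy of the total.\<close>

lemma path_decomposition:
  assumes "D \<subseteq> {1..n}" "W \<subseteq> {1..n}"
  shows "step_sum (\<lambda>x y. sum z (diagonal_set n D x y)) (polygon_path n D W) =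
    sum z W + real (card (W \<inter> D)) * sum z {1..n}"
proof -
  let ?X = "{i \<in> {1..n}. i \<in> D \<longleftrightarrow> i \<in> W}"
  have "step_sum (\<lambda>x y. sum z (diagonal_set n D x y)) (polygon_path n D W) =
    step_sum (\<lambda>x y. right_weight n D z y - left_weight n D z x) (polygon_path n D W)"
    by (rule step_sum_cong) (simp add: sum_diagonal_set)
  also have "\<dots> = right_weight n D z (Suc n) - left_weight n D z 0
      + (\<Sum>v \<in> ?X. right_weight n D z v - left_weight n D z v)"
    unfolding polygon_path_def by (rule step_sum_telescope) auto
  also have "right_weight n D z (Suc n) = sum z ({1..n} - D)"
    using assms by (auto simp: right_weight_def atLeastLessThanSuc_atLeastAtMost)
  also have "left_weight n D z 0 = 0" using assms by (auto simp: left_weight_def)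
  also have "(\<Sum>v \<in> ?X. right_weight n D z v - left_weight n D z v) =
     (\<Sum>v \<in> ?X. if v \<in> D then sum z {1..n} + z v else - z v)"
  proof (rule sum.cong[OF refl])
    fix v assume v: "v \<in> ?X"
    then have e: "{1..v} = insert v {1..<v}" "{1..n} = {1..v} \<union> {v<..n}" "{v..n} = insert v {v<..n}"
      by auto
    have "sum z {1..n} = sum z {1..v} + sum z {v<..n}" unfolding e(2)
      by (rule sum.union_disjoint) auto
    then show "right_weight n D z v - left_weight n D z v = (if v \<in> D then sum z {1..n} + z v else - z v)"
      unfolding right_weight_def left_weight_def e(1,3) using v by (auto simp: insert_Diff_if)
  qed
  also have "\<dots> = (\<Sum>v \<in> W \<inter> D. sum z {1..n} + z v) + (\<Sum>v \<in> {1..n} - D - W. - z v)"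
  proof -
    have "?X = (W \<inter> D) \<union> ({1..n} - D - W)" using assms by auto
    moreover have "finite W" using assms(2) finite_subset by auto
    ultimately show ?thesis by (simp add: sum.union_disjoint disjoint_iff)
  qed
  also have "(\<Sum>v \<in> W \<inter> D. sum z {1..n} + z v) = real (card (W \<inter> D)) * sum z {1..n} + sum z (W \<inter> D)"
    by (simp add: sum.distrib)
  also have "sum z ({1..n} - D) = sum z (W - D) + sum z ({1..n} - D - W)"
  proof -
    have "{1..n} - D = (W - D) \<union> ({1..n} - D - W)" using assms by auto
    moreover have "finite W" using assms(2) finite_subset by auto
    ultimately show ?thesis using sum.union_disjoint[of "W - D" "{1..n} - D - W" z] by auto
  qed
  also have "sum z W = sum z (W - D) + sum z (W \<inter> D)"
  proof -
    have "finite W" using assms(2) finite_subset by auto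
    then show ?thesis by (metis sum.Int_Diff add.commute)
  qed
  ultimately show ?thesis by (simp add: sum_negf)
qed

section \<open>Supermodularity of the path bound\<close>

abbreviation left_key :: "nat \<Rightarrow> nat set \<Rightarrow> nat \<Rightarrow> real" where
  "left_key n D \<equiv> left_weight n D (\<lambda>_. 1)"

abbreviation right_key :: "nat \<Rightarrow> nat set \<Rightarrow> nat \<Rightarrow> real" where
  "right_key n D \<equiv> right_weight n D (\<lambda>_. 1)"

lemma diagonal_height_eq: "x < y \<Longrightarrow> diagonal_height n D x y = triangular (right_key n D y - left_key n D x)"
  using sum_diagonal_set[of x y "\<lambda>_. 1 :: real" n D] by (simp add: diagonal_height_def)

text \<open>The mixed second difference of a quadratic polynomial with leading coefficient 1/2,
  evaluated at differences of keys.\<close>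

lemma diagonal_height_exchange:
  assumes "l < a" "a < b" "b < r"
  shows "diagonal_height n D a b + diagonal_height n D l r - diagonal_height n D a r - diagonal_height n D l b =
    (right_key n D r - right_key n D b) * (left_key n D a - left_key n D l)"
  using assms by (simp add: diagonal_height_eq triangular_def field_simps)

text \<open>The key of a lower vertex counts the lower labels up to it, the key of an upper vertex
  is minus the number of upper labels up to it. So the sign of the increment depends only on the
  side of the later vertex \<open>a\<close>.\<close>

lemma left_key_less:
  assumes "l < a"
  shows "a \<notin> D \<Longrightarrow> left_key n D l < left_key n D a" "a \<in> D \<Longrightarrow> left_key n D a < left_key n D l"
proof -
  have e: "{1..a} - D = ({1..l} - D) \<union> ({l<..a} - D)" using assms by auto
  have k: "left_key n D a - left_key n D l =
      real (card ({l<..a} - D)) - (if a \<in> D then real a else 0) + (if l \<in> D then real l else 0)"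
  proof -
    have "real (card ({1..a} - D)) = real (card ({1..l} - D)) + real (card ({l<..a} - D))"
      unfolding e by (subst card_Un_disjoint) auto
    then show ?thesis by (simp add: left_weight_def)
  qed
  define t where "t = (if l \<in> D then real l else 0)"
  have t: "0 \<le> t" "t \<le> real l" by (auto simp: t_def)
  show "left_key n D l < left_key n D a" if "a \<notin> D"
  proof -
    have "card ({l<..a} - D) > 0" using assms that by (auto simp: card_gt_0_iff)
    then have "real (card ({l<..a} - D)) > 0" by simp
    moreover have "left_key n D a - left_key n D l = real (card ({l<..a} - D)) + t"
      using k that by (simp add: t_def)
    ultimately show ?thesis using t by linarith
  qed
  show "left_key n D a < left_key n D l" if "a \<in> D"
  proof -
    have "{l<..a} - D \<subseteq> {l<..<a}" using that by (auto simp: le_less)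
    then have "card ({l<..a} - D) \<le> card {l<..<a}" by (intro card_mono) auto
    then have "card ({l<..a} - D) + l < a" using assms by simp
    then have "real (card ({l<..a} - D)) + real l < real a" by linarith
    moreover have "left_key n D a - left_key n D l = real (card ({l<..a} - D)) - real a + t"
      using k that by (simp add: t_def)
    ultimately show ?thesis using t by linarith
  qed
qed

text \<open>Here the side of the earlier vertex \<open>b\<close> decides. A lower label counts the
  lower labels before it; an upper label in \<open>{1..n}\<close> counts all lower labels of that
  interval plus the upper ones from itself on.\<close>

lemma right_key_less:
  assumes "0 < b" "b < r" "r \<le> Suc n"
  shows "b \<notin> D \<Longrightarrow> right_key n D b < right_key n D r" "b \<in> D \<Longrightarrow> right_key n D r < right_key n D b"
proof -
  have r1: "right_key n D y = real (card ({1..<y} - D)) + (if y \<in> D then real (Suc n - y) else 0)" for y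
    by (auto simp: right_weight_def)
  have k: "real (card ({1..<r} - D)) \<ge> real (card ({1..<b} - D))"
    using assms by (intro of_nat_mono card_mono) auto
  show "right_key n D b < right_key n D r" if "b \<notin> D"
  proof -
    have "card ({1..<r} - D) > card ({1..<b} - D)" using assms that
      by (intro psubset_card_mono) auto
    then show ?thesis using r1 that by auto
  qed
  show "right_key n D r < right_key n D b" if "b \<in> D"
  proof -
    have "{1..<r} - D \<subseteq> ({1..<b} - D) \<union> {b<..<r}" using that
      by (auto, metis nat_neq_iff)
    then have "card ({1..<r} - D) \<le> card (({1..<b} - D) \<union> {b<..<r})" by (intro card_mono) auto
    also have "\<dots> \<le> card ({1..<b} - D) + card {b<..<r}" by (rule card_Un_le)
    finally show ?thesis using r1 that assms by (auto simp: of_nat_diff)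
  qed
qed

text \<open>If a vertex of \<open>V\<close> lies between \<open>a\<close> and \<open>b\<close>, the
  two insertions split different steps and do not interact. Otherwise both split the same step from
  \<open>l\<close> to \<open>r\<close>, and only the edges among these four vertices remain.\<close>

lemma step_sum_mixed_difference:
  fixes c :: "nat \<Rightarrow> nat \<Rightarrow> real"
  assumes "finite V" "lo \<in> V" "hi \<in> V" "lo < a" and ab: "a < b" and "b < hi" "a \<notin> V" "b \<notin> V"
  defines "M \<equiv> step_sum c (insert a (insert b V)) + step_sum c V
     - step_sum c (insert a V) - step_sum c (insert b V)"
  shows "V \<inter> {a<..<b} \<noteq> {} \<Longrightarrow> M = 0"
    and "V \<inter> {a<..<b} = {} \<Longrightarrow> \<exists>l r. l \<in> V \<and> r \<in> V \<and> l < a \<and> b < r \<and> M = c a b + c l r - c a r - c l b"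
proof -
  obtain l r where lr: "(l, r) \<in> steps V" "l < a" "a < r" using step_around[of V lo hi a] assms
    by auto
  then have lrV: "l \<in> V" "r \<in> V" and gap: "\<And>x. x \<in> V \<Longrightarrow> l < x \<Longrightarrow> r \<le> x"
    by (auto simp: steps_def disjoint_iff not_less)
  note ia = step_sum_insert[OF assms(1) lr, of c]
  show "M = 0" if "V \<inter> {a<..<b} \<noteq> {}"
  proof -
    from that obtain x where x: "x \<in> V" "a < x" "x < b" by auto
    then have "r < b" using lr gap[of x] by linarith
    then have "(l, r) \<in> steps (insert b V)" using lr(1) unfolding steps_def by auto
    then have "step_sum c (insert a (insert b V)) = step_sum c (insert b V) - c l r + c l a + c a r"
      using lr assms by (intro step_sum_insert) auto
    then show ?thesis using ia by (simp add: M_def)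
  qed
  show "\<exists>l r. l \<in> V \<and> r \<in> V \<and> l < a \<and> b < r \<and> M = c a b + c l r - c a r - c l b"
    if "V \<inter> {a<..<b} = {}"
  proof -
    have "r \<notin> {a<..<b}" "r \<noteq> b" using that lrV assms by auto
    then have r: "b < r" using lr by auto
    then have "step_sum c (insert b V) = step_sum c V - c l r + c l b + c b r"
      using lr assms by (intro step_sum_insert) auto
    moreover have "(l, b) \<in> steps (insert b V)"
      unfolding steps_def using lr(2) lrV(1) r gap ab by fastforce
    then have "step_sum c (insert a (insert b V)) = step_sum c (insert b V) - c l b + c l a + c a b"
      using lr assms by (intro step_sum_insert) auto
    ultimately have "M = c a b + c l r - c a r - c l b" using ia by (simp add: M_def)
    then show ?thesis using lr lrV r by blast
  qed
qed

text \<open>Adding a label to \<open>W\<close> toggles its vertex on the path: an upper vertex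
  enters, a lower one leaves. So the four paths are \<open>V\<close> with or without
  \<open>a\<close> and \<open>b\<close>, and \<open>L\<close> is the mixed difference
  \<open>M\<close>, negated if \<open>a\<close> and \<open>b\<close> are on opposite sides; the
  multiples of \<open>triangular n\<close> cancel. The signs of the two key increments then make
  \<open>L\<close> positive in each of the four cases.\<close>

lemma path_support_exchange:
  assumes D: "D \<subseteq> {1..n}" and W: "W \<subseteq> {1..n}" and ab: "1 \<le> a" "a < b" "b \<le> n" "a \<notin> W" "b \<notin> W"
  defines "L \<equiv> path_support n D (insert a (insert b W)) + path_support n D W
     - path_support n D (insert a W) - path_support n D (insert b W)"
  shows "W \<inter> {a<..<b} \<noteq> {a<..<b} - D \<Longrightarrow> L = 0" and "W \<inter> {a<..<b} = {a<..<b} - D \<Longrightarrow> L > 0"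
proof -
  define V where "V = polygon_path n D W - {a, b}"
  define M where "M = step_sum (diagonal_height n D) (insert a (insert b V)) + step_sum (diagonal_height n D) V
     - step_sum (diagonal_height n D) (insert a V) - step_sum (diagonal_height n D) (insert b V)"
  have path: "polygon_path n D W' = V \<union> X"
    if "\<And>i. i \<noteq> a \<Longrightarrow> i \<noteq> b \<Longrightarrow> i \<in> W' \<longleftrightarrow> i \<in> W" "X \<subseteq> {a, b}"
      "a \<in> X \<longleftrightarrow> (a \<in> D \<longleftrightarrow> a \<in> W')" "b \<in> X \<longleftrightarrow> (b \<in> D \<longleftrightarrow> b \<in> W')" for W' X
  proof (rule Set.set_eqI)
    fix i
    consider "i = a" | "i = b" | "i \<noteq> a" "i \<noteq> b" by blast
    then show "i \<in> polygon_path n D W' \<longleftrightarrow> i \<in> V \<union> X"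
      by cases (use that ab in \<open>auto simp: V_def polygon_path_def\<close>)
  qed
  have paths: "polygon_path n D W = V \<union> ({a, b} - D)"
    "polygon_path n D (insert a W) = V \<union> ({b} - D \<union> {a} \<inter> D)"
    "polygon_path n D (insert b W) = V \<union> ({a} - D \<union> {b} \<inter> D)"
    "polygon_path n D (insert a (insert b W)) = V \<union> ({a, b} \<inter> D)"
    by (rule path; use ab in auto)+
  have fW: "finite W" using W finite_subset by auto
  have card: "real (card (insert a (insert b W) \<inter> D)) + real (card (W \<inter> D))
     = real (card (insert a W \<inter> D)) + real (card (insert b W \<inter> D))"
    using fW ab by (simp add: Int_insert_left card_insert_if)
  have "L = step_sum (diagonal_height n D) (polygon_path n D (insert a (insert b W)))
     + step_sum (diagonal_height n D) (polygon_path n D W)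
     - step_sum (diagonal_height n D) (polygon_path n D (insert a W))
     - step_sum (diagonal_height n D) (polygon_path n D (insert b W))
     - (real (card (insert a (insert b W) \<inter> D)) + real (card (W \<inter> D))
        - real (card (insert a W \<inter> D)) - real (card (insert b W \<inter> D))) * triangular n"
    unfolding L_def path_support_def by (simp add: algebra_simps)
  also have "\<dots> = (if a \<in> D \<longleftrightarrow> b \<in> D then M else - M)"
    unfolding paths M_def using card by (auto simp: insert_commute insert_Diff_if)
  finally have L: "L = (if a \<in> D \<longleftrightarrow> b \<in> D then M else - M)" .
  have V: "finite V" "0 \<in> V" "Suc n \<in> V" "0 < a" "b < Suc n" "a \<notin> V" "b \<notin> V"
    using ab by (auto simp: V_def finite_polygon_path polygon_path_def)
  have gap: "V \<inter> {a<..<b} = {} \<longleftrightarrow> W \<inter> {a<..<b} = {a<..<b} - D"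
  proof -
    have "x \<in> V \<longleftrightarrow> (x \<in> D \<longleftrightarrow> x \<in> W)" if "a < x" "x < b" for x
      using that ab by (simp add: V_def polygon_path_def)
    then show ?thesis by (simp add: set_eq_iff) blast
  qed
  note mixed = step_sum_mixed_difference[OF V(1-4) ab(2) V(5-7), of "diagonal_height n D", folded M_def]
  show "L = 0" if "W \<inter> {a<..<b} \<noteq> {a<..<b} - D" using mixed(1) that gap L by auto
  show "L > 0" if "W \<inter> {a<..<b} = {a<..<b} - D"
  proof -
    from that obtain l r where lr: "r \<in> V" "l < a" "b < r"
      "M = (right_key n D r - right_key n D b) * (left_key n D a - left_key n D l)"
      using mixed(2) gap ab diagonal_height_exchange[of _ a b] by (metis (no_types, lifting))
    have "r \<le> Suc n" using lr by (auto simp: V_def polygon_path_def)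
    then show ?thesis
      using left_key_less[OF lr(2), of D n] right_key_less[OF _ lr(3), of n D] ab lr(4)
      by (cases "a \<in> D"; cases "b \<in> D") (auto simp: L mult_pos_pos mult_neg_neg mult_neg_pos mult_pos_neg)
  qed
qed

section \<open>Agreement of the path bound with the facet inequalities\<close>

lemma mem_polygon_path:
  "i \<in> polygon_path n D W \<longleftrightarrow> i = 0 \<or> i = Suc n \<or> 1 \<le> i \<and> i \<le> n \<and> (i \<in> D \<longleftrightarrow> i \<in> W)"
  by (auto simp: polygon_path_def)

lemma polygon_stepD:
  assumes "(x, y) \<in> steps (polygon_path n D W)"
  shows "x < y" "y \<le> Suc n" "1 \<le> x \<Longrightarrow> x \<in> D \<longleftrightarrow> x \<in> W" "y \<le> n \<Longrightarrow> y \<in> D \<longleftrightarrow> y \<in> W"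
    "x < i \<Longrightarrow> i < y \<Longrightarrow> i \<in> D \<longleftrightarrow> i \<notin> W"
proof -
  have *: "x \<in> polygon_path n D W" "y \<in> polygon_path n D W" "x < y"
    "\<And>i. x < i \<Longrightarrow> i < y \<Longrightarrow> i \<notin> polygon_path n D W"
    using assms by (auto simp: steps_def disjoint_iff)
  show "x < y" by (rule *)
  show y: "y \<le> Suc n" using *(2) unfolding mem_polygon_path by linarith
  show "x \<in> D \<longleftrightarrow> x \<in> W" if "1 \<le> x" using *(1,3) y that unfolding mem_polygon_path by linarith
  show "y \<in> D \<longleftrightarrow> y \<in> W" if "y \<le> n" using *(2,3) that unfolding mem_polygon_path by linarith
  show "i \<in> D \<longleftrightarrow> i \<notin> W" if "x < i" "i < y"
    using *(4)[OF that] that y unfolding mem_polygon_path by linarith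
qed

lemma mem_diagonal_set:
  "i \<in> diagonal_set n D x y \<longleftrightarrow>
     x < i \<and> i < y \<and> i \<notin> D \<or> x \<in> D \<and> 1 \<le> i \<and> i \<le> x \<or> y \<in> D \<and> y \<le> i \<and> i \<le> n"
  by (auto simp: diagonal_set_def)

lemma diagonal_set_subset: "x < y \<Longrightarrow> y \<le> Suc n \<Longrightarrow> D \<subseteq> {1..n} \<Longrightarrow> diagonal_set n D x y \<subseteq> {1..n}"
  by (auto simp: diagonal_set_def split: if_splits)

lemma diagonal_set_full:
  assumes "x < y" "y \<le> Suc n" "x = 0 \<or> x \<in> D" "y = Suc n \<or> y \<in> D"
    and gap: "\<And>i. x < i \<Longrightarrow> i < y \<Longrightarrow> i \<notin> D" and "D \<subseteq> {1..n}"
  shows "diagonal_set n D x y = {1..n}"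
proof (rule Set.set_eqI)
  fix i
  have "0 \<notin> D" "Suc n \<notin> D" using assms by auto
  then show "i \<in> diagonal_set n D x y \<longleftrightarrow> i \<in> {1..n}"
    using assms(1-4) gap[of i] unfolding mem_diagonal_set atLeastAtMost_iff by linarith
qed

text \<open>The facet condition on one-based positions. Every label outside \<open>D\<close> counts
  as lower, including the two ends, which have no side in a rope.\<close>

definition facet_set :: "nat \<Rightarrow> nat set \<Rightarrow> nat set \<Rightarrow> bool" where
  "facet_set n D U \<longleftrightarrow> U \<noteq> {} \<and> U \<subset> {1..n} \<and>
     (\<forall>i j k. 1 \<le> i \<and> i < j \<and> j < k \<and> k \<le> n \<longrightarrow>
        (i \<in> U \<and> k \<in> U \<and> j \<notin> D \<longrightarrow> j \<in> U) \<and> (i \<notin> U \<and> k \<notin> U \<and> j \<in> D \<longrightarrow> j \<notin> U))"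

text \<open>The two exceptional values belong to the edges of the lower and the upper boundary of
  the polygon, for which the inequality is trivial or the equation for the total.\<close>

lemma diagonal_set_cases:
  assumes "D \<subseteq> {1..n}" "x < y" "y \<le> Suc n"
  shows "diagonal_set n D x y = {} \<or> diagonal_set n D x y = {1..n} \<or> facet_set n D (diagonal_set n D x y)"
proof -
  have "(i \<in> diagonal_set n D x y \<and> k \<in> diagonal_set n D x y \<and> j \<notin> D \<longrightarrow> j \<in> diagonal_set n D x y) \<and>
     (i \<notin> diagonal_set n D x y \<and> k \<notin> diagonal_set n D x y \<and> j \<in> D \<longrightarrow> j \<notin> diagonal_set n D x y)"
    if "1 \<le> i" "i < j" "j < k" "k \<le> n" for i j k
    using that assms(2) unfolding mem_diagonal_set
    by (cases "x \<in> D"; cases "y \<in> D"; cases "j \<in> D"; simp; linarith)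
  then show ?thesis unfolding facet_set_def using diagonal_set_subset[OF assms(2,3,1)] by blast
qed

lemma path_support_le:
  assumes D: "D \<subseteq> {1..n}" and W: "W \<subseteq> {1..n}"
    and total: "sum z {1..n} = triangular n"
    and facets: "\<And>U. facet_set n D U \<Longrightarrow> triangular (card U) \<le> sum z U"
  shows "path_support n D W \<le> sum z W"
proof -
  have "step_sum (diagonal_height n D) (polygon_path n D W)
     \<le> step_sum (\<lambda>x y. sum z (diagonal_set n D x y)) (polygon_path n D W)"
  proof (rule step_sum_mono)
    fix x y assume "(x, y) \<in> steps (polygon_path n D W)"
    note polygon_stepD(1,2)[OF this]
    then consider "diagonal_set n D x y = {}" | "diagonal_set n D x y = {1..n}"
      | "facet_set n D (diagonal_set n D x y)" using diagonal_set_cases[OF D] by blast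
    then show "diagonal_height n D x y \<le> sum z (diagonal_set n D x y)"
      unfolding diagonal_height_def
    proof cases
      case 1
      then show "triangular (card (diagonal_set n D x y)) \<le> sum z (diagonal_set n D x y)"
        by (simp add: triangular_def)
    next
      case 2
      then show "triangular (card (diagonal_set n D x y)) \<le> sum z (diagonal_set n D x y)"
        using total by simp
    next
      case 3
      then show "triangular (card (diagonal_set n D x y)) \<le> sum z (diagonal_set n D x y)"
        by (rule facets)
    qed
  qed
  then show ?thesis unfolding path_decomposition[OF D W] path_support_def total by simp
qed

text \<open>The vertex \<open>y\<close> lies on the path strictly between 0 and
  \<open>n + 1\<close>. If it is lower, it is outside \<open>U\<close>, and the facet condition
  keeps \<open>U\<close> away from one side of \<open>y\<close>; a step on that side then runs along
  the lower boundary. If it is upper, \<open>U\<close> contains all labels on one side, and a step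
  there runs along the upper boundary.\<close>

lemma steps_trivial:
  assumes D: "D \<subseteq> {1..n}" and U: "facet_set n D U"
    and st: "(x, y) \<in> steps (polygon_path n D U)" "(x', y') \<in> steps (polygon_path n D U)" "y \<le> x'"
  shows "diagonal_set n D x y \<in> {{}, {1..n}} \<or> diagonal_set n D x' y' \<in> {{}, {1..n}}"
proof -
  have *: "x < y" "x' < y'" "y' \<le> Suc n" "1 \<le> y" "y \<le> n" "y \<in> D \<longleftrightarrow> y \<in> U"
    "1 \<le> x \<Longrightarrow> x \<in> D \<longleftrightarrow> x \<in> U" "x' \<in> D \<longleftrightarrow> x' \<in> U" "y' \<le> n \<Longrightarrow> y' \<in> D \<longleftrightarrow> y' \<in> U"
    "\<And>i. x < i \<Longrightarrow> i < y \<Longrightarrow> i \<in> D \<longleftrightarrow> i \<notin> U" "\<And>i. x' < i \<Longrightarrow> i < y' \<Longrightarrow> i \<in> D \<longleftrightarrow> i \<notin> U"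
    using polygon_stepD[OF st(1)] polygon_stepD[OF st(2)] st(3) by auto
  have conv: "i \<in> U \<and> k \<in> U \<and> j \<notin> D \<longrightarrow> j \<in> U" "i \<notin> U \<and> k \<notin> U \<and> j \<in> D \<longrightarrow> j \<notin> U"
    if "1 \<le> i" "i < j" "j < k" "k \<le> n" for i j k using U that unfolding facet_set_def by blast+
  have z: "0 \<notin> D" "Suc n \<notin> D" using D by auto
  show ?thesis
  proof (cases "y \<in> D")
    case False
    then have "(\<forall>i. 1 \<le> i \<and> i < y \<longrightarrow> i \<notin> U) \<or> (\<forall>k. y < k \<and> k \<le> n \<longrightarrow> k \<notin> U)"
      using conv(1)[of _ y] * by blast
    then show ?thesis
    proof
      assume l: "\<forall>i. 1 \<le> i \<and> i < y \<longrightarrow> i \<notin> U"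
      have "x \<notin> D" using * l z by (cases "x = 0") auto
      moreover have "{x<..<y} - D = {}" using * l by auto
      ultimately show ?thesis using False by (simp add: diagonal_set_def)
    next
      assume l: "\<forall>k. y < k \<and> k \<le> n \<longrightarrow> k \<notin> U"
      have "y' \<notin> D" using * l z st(3) by (cases "y' = Suc n") auto
      moreover have "{x'<..<y'} - D = {}" using * l st(3) by auto
      moreover have "x' \<notin> D" using * l st(3) False by (cases "x' = y") auto
      ultimately show ?thesis using False by (simp add: diagonal_set_def)
    qed
  next
    case True
    then have "(\<forall>i. 1 \<le> i \<and> i < y \<longrightarrow> i \<in> U) \<or> (\<forall>k. y < k \<and> k \<le> n \<longrightarrow> k \<in> U)"
      using conv(2)[of _ y] * by blast
    then show ?thesis
    proof
      assume l: "\<forall>i. 1 \<le> i \<and> i < y \<longrightarrow> i \<in> U"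
      have "x = 0 \<or> x \<in> D" using * l by (cases "x = 0") auto
      moreover have "\<And>i. x < i \<Longrightarrow> i < y \<Longrightarrow> i \<notin> D" using * l by simp
      ultimately have "diagonal_set n D x y = {1..n}"
        using True *(1,5) D by (intro diagonal_set_full) simp_all
      then show ?thesis by simp
    next
      assume l: "\<forall>k. y < k \<and> k \<le> n \<longrightarrow> k \<in> U"
      have "y' = Suc n \<or> y' \<in> D" using *(2,3,9) l st(3) by (cases "y' = Suc n") simp_all
      moreover have "\<And>i. x' < i \<Longrightarrow> i < y' \<Longrightarrow> i \<notin> D" using *(3,11) l st(3) by simp
      moreover have "x' \<in> D" using *(2,3,8) l st(3) True by (cases "x' = y") simp_all
      ultimately have "diagonal_set n D x' y' = {1..n}"
        using *(2,3) D by (intro diagonal_set_full) simp_all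
      then show ?thesis by simp
    qed
  qed
qed

text \<open>By \<open>steps_trivial\<close> at most one step \<open>t\<close> is not a boundary
  edge. The sizes along the path add up to \<open>card U + ?m * n\<close> and all but that of
  \<open>t\<close> are 0 or \<open>n\<close>. As \<open>card U\<close> is not divisible by
  \<open>n\<close>, such a \<open>t\<close> exists, and comparing remainders modulo \<open>n\<close>
  yields that its set has the size of \<open>U\<close>; the number of full sets is then
  \<open>?m\<close>.\<close>

lemma path_support_facet:
  assumes D: "D \<subseteq> {1..n}" and U: "facet_set n D U"
  shows "path_support n D U = triangular (card U)"
proof -
  let ?V = "polygon_path n D U" and ?m = "card (U \<inter> D)"
  define s where "s = (\<lambda>(x, y). card (diagonal_set n D x y))"
  have Un: "U \<subseteq> {1..n}" "U \<noteq> {}" "U \<noteq> {1..n}" using U by (auto simp: facet_set_def)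
  have fU: "finite U" using Un finite_subset by auto
  have cU: "0 < card U" "card U < n"
    using Un fU psubset_card_mono[of "{1..n}" U] by (auto simp: card_gt_0_iff)
  have fin: "finite (steps ?V)" by (simp add: finite_polygon_path finite_steps)
  have "real (\<Sum>t \<in> steps ?V. s t) = real (card U) + real ?m * real n"
    using path_decomposition[OF D Un(1), of "\<lambda>_. 1"]
    by (simp add: step_sum_def s_def case_prod_unfold)
  then have sums: "(\<Sum>t \<in> steps ?V. s t) = card U + ?m * n"
    by (metis of_nat_add of_nat_eq_iff of_nat_mult)
  have dvd: "n dvd s t" if "diagonal_set n D (fst t) (snd t) \<in> {{}, {1..n}}" for t
    using that by (auto simp: s_def case_prod_unfold)
  have "\<exists>t \<in> steps ?V. diagonal_set n D (fst t) (snd t) \<notin> {{}, {1..n}}"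
  proof (rule ccontr)
    assume "\<not> ?thesis"
    then have "n dvd (\<Sum>t \<in> steps ?V. s t)" by (intro dvd_sum) (use dvd in blast)
    then have "n dvd card U" using sums by (metis dvd_add_left_iff dvd_triv_right)
    then show False using cU by (simp add: nat_dvd_not_less)
  qed
  then obtain t where t: "t \<in> steps ?V" "diagonal_set n D (fst t) (snd t) \<notin> {{}, {1..n}}" by blast
  have triv: "diagonal_set n D (fst t') (snd t') \<in> {{}, {1..n}}" if "t' \<in> steps ?V - {t}" for t'
  proof -
    obtain x y x' y' where e: "t = (x, y)" "t' = (x', y')" by fastforce
    then have xy: "(x, y) \<in> steps ?V" "(x', y') \<in> steps ?V" "(x, y) \<noteq> (x', y')" using t that by auto
    have "y \<le> x' \<or> y' \<le> x"
    proof (rule ccontr)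
      assume "\<not> ?thesis"
      moreover have "x' \<notin> {x<..<y}" "y' \<notin> {x<..<y}" "x \<notin> {x'<..<y'}" "y \<notin> {x'<..<y'}"
        using xy(1,2) by (auto simp: steps_def disjoint_iff)
      moreover have "x < y" "x' < y'" using xy(1,2) by (auto simp: steps_def)
      ultimately show False using xy(3) by auto
    qed
    then show ?thesis using steps_trivial[OF D U] xy t e by fastforce
  qed
  define K where "K = card {t' \<in> steps ?V - {t}. s t' = n}"
  have s: "s t' = (if s t' = n then n else 0)" if "t' \<in> steps ?V - {t}" for t'
    using triv[OF that] by (auto simp: s_def case_prod_unfold)
  have "(\<Sum>t' \<in> steps ?V - {t}. s t') = (\<Sum>t' \<in> steps ?V - {t}. if s t' = n then n else 0)"
    by (rule sum.cong[OF refl]) (use s in auto)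
  also have "\<dots> = K * n" using fin by (simp add: K_def sum.If_cases Int_def)
  finally have rest: "(\<Sum>t' \<in> steps ?V - {t}. s t') = K * n" .
  have "(\<Sum>t' \<in> steps ?V - {t}. triangular (s t')) =
      (\<Sum>t' \<in> steps ?V - {t}. if s t' = n then triangular n else 0)"
  proof (rule sum.cong[OF refl])
    fix t' assume "t' \<in> steps ?V - {t}"
    from s[OF this] show "triangular (s t') = (if s t' = n then triangular n else 0)"
      by (cases "s t' = n") (simp_all add: triangular_def)
  qed
  also have "\<dots> = K * triangular n" using fin by (simp add: K_def sum.If_cases Int_def)
  finally have rest': "(\<Sum>t' \<in> steps ?V - {t}. triangular (s t')) = K * triangular n" .
  have "fst t < snd t" "snd t \<le> Suc n" using t(1) polygon_stepD(1,2)[of "fst t" "snd t" n D U]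
    by auto
  then have sub: "diagonal_set n D (fst t) (snd t) \<subset> {1..n}" "diagonal_set n D (fst t) (snd t) \<noteq> {}"
    using diagonal_set_subset[OF _ _ D] t by auto
  then have "finite (diagonal_set n D (fst t) (snd t))" using finite_subset by blast
  then have st: "0 < s t" "s t < n"
    using sub psubset_card_mono[OF _ sub(1)] by (auto simp: s_def case_prod_unfold card_gt_0_iff)
  have "s t + K * n = card U + ?m * n" using sums rest fin t by (simp add: sum.remove)
  then have "s t = card U" using st cU by (metis mod_less mod_mult_self1)
  moreover have "K = ?m" using \<open>s t + K * n = card U + ?m * n\<close> calculation st by simp
  moreover have "path_support n D U = triangular (s t) + K * triangular n - ?m * triangular n"
    unfolding path_support_def step_sum_def using rest' fin t
    by (simp add: s_def diagonal_height_def case_prod_unfold sum.remove)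
  ultimately show ?thesis by simp
qed

lemma path_support_empty: assumes "D \<subseteq> {1..n}" shows "path_support n D {} = 0"
proof -
  have "step_sum (diagonal_height n D) (polygon_path n D {}) = 0"
    unfolding step_sum_def
  proof (rule sum.neutral, clarify)
    fix x y assume "(x, y) \<in> steps (polygon_path n D {})"
    note step = polygon_stepD[OF this]
    have "x \<notin> D" "y \<notin> D" "{x<..<y} - D = {}" using step assms by fastforce+
    then have "diagonal_set n D x y = {}" by (simp add: diagonal_set_def)
    then show "diagonal_height n D x y = 0" by (simp add: diagonal_height_def triangular_def)
  qed
  then show ?thesis by (simp add: path_support_def)
qed

lemma path_support_full: assumes "D \<subseteq> {1..n}" shows "path_support n D {1..n} = triangular n"
proof -
  have full: "diagonal_set n D x y = {1..n}" if "(x, y) \<in> steps (polygon_path n D {1..n})" for x y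
  proof -
    note step = polygon_stepD[OF that]
    have "x = 0 \<or> x \<in> D" "y = Suc n \<or> y \<in> D" using step(1-4) by force+
    moreover have "\<And>i. x < i \<Longrightarrow> i < y \<Longrightarrow> i \<notin> D" using step(2,5) by simp
    ultimately show ?thesis using step(1,2) assms by (intro diagonal_set_full)
  qed
  have *: "step_sum (\<lambda>x y. c (diagonal_set n D x y)) (polygon_path n D {1..n})
      = real (card (steps (polygon_path n D {1..n}))) * c {1..n}" for c :: "nat set \<Rightarrow> real"
  proof -
    have "step_sum (\<lambda>x y. c (diagonal_set n D x y)) (polygon_path n D {1..n})
        = (\<Sum>t \<in> steps (polygon_path n D {1..n}). c {1..n})"
      unfolding step_sum_def by (rule sum.cong) (auto simp: full)
    then show ?thesis by simp
  qed
  \<comment> \<open>The number of steps is read off from \<open>path_decomposition\<close> with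
    constant weight 1 rather than counted.\<close>
  have "real (card (steps (polygon_path n D {1..n}))) * real n = real n + real (card ({1..n} \<inter> D)) * real n"
    using path_decomposition[OF assms order.refl, of "\<lambda>_. 1"] *[of "\<lambda>X. real (card X)"] by simp
  then have "real (card (steps (polygon_path n D {1..n}))) * triangular n = (1 + real (card ({1..n} \<inter> D))) * triangular n"
    by (cases "n = 0") (auto simp: algebra_simps triangular_def)
  moreover have "step_sum (diagonal_height n D) (polygon_path n D {1..n})
      = real (card (steps (polygon_path n D {1..n}))) * triangular n"
    using *[of "\<lambda>X. triangular (card X)"] by (simp add: diagonal_height_def[abs_def])
  ultimately show ?thesis by (simp add: path_support_def algebra_simps)
qed

section \<open>Normal fans\<close>

text \<open>The common maximizers of all functionals in \<open>G\<close>. With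
  \<open>normal_cone\<close> it forms a Galois connection between sets of functionals and subsets of
  \<open>P\<close>.\<close>

definition max_face :: "'a::real_inner set \<Rightarrow> 'a set \<Rightarrow> 'a set" where
  "max_face P G = {x \<in> P. \<forall>v \<in> G. \<forall>y \<in> P. v \<bullet> y \<le> v \<bullet> x}"

lemma max_face_face_of:
  assumes "convex P"
  shows "max_face P G face_of P"
  unfolding face_of_def
proof (intro conjI ballI impI)
  show "max_face P G \<subseteq> P" by (auto simp: max_face_def)
  show "convex (max_face P G)"
    unfolding convex_def
  proof (intro ballI allI impI)
    fix x y and s t :: real
    assume *: "x \<in> max_face P G" "y \<in> max_face P G" "0 \<le> s" "0 \<le> t" "s + t = 1"
    then have "s *\<^sub>R x + t *\<^sub>R y \<in> P" using assms by (auto simp: convex_def max_face_def)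
    moreover have "v \<bullet> z \<le> v \<bullet> (s *\<^sub>R x + t *\<^sub>R y)" if "v \<in> G" "z \<in> P" for v z
    proof -
      have "s * (v \<bullet> z) + t * (v \<bullet> z) \<le> s * (v \<bullet> x) + t * (v \<bullet> y)"
        using * that by (intro add_mono mult_left_mono) (auto simp: max_face_def)
      moreover have "s * (v \<bullet> z) + t * (v \<bullet> z) = v \<bullet> z" using * by (metis distrib_right mult_1)
      ultimately show ?thesis by (simp add: inner_add_right)
    qed
    ultimately show "s *\<^sub>R x + t *\<^sub>R y \<in> max_face P G" by (auto simp: max_face_def)
  qed
next
  fix a b x assume *: "a \<in> P" "b \<in> P" "x \<in> max_face P G" "x \<in> open_segment a b"
  then obtain u where u: "0 < u" "u < 1" "x = (1 - u) *\<^sub>R a + u *\<^sub>R b" by (auto simp: in_segment)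
  have eq: "v \<bullet> x = v \<bullet> a \<and> v \<bullet> x = v \<bullet> b" if "v \<in> G" for v
  proof -
    have "v \<bullet> a \<le> v \<bullet> x" "v \<bullet> b \<le> v \<bullet> x" using * that by (auto simp: max_face_def)
    moreover have "v \<bullet> x = (1 - u) * (v \<bullet> a) + u * (v \<bullet> b)" by (simp add: u inner_add_right)
    then have "(1 - u) * (v \<bullet> x - v \<bullet> a) + u * (v \<bullet> x - v \<bullet> b) = 0" by (simp add: algebra_simps)
    ultimately show ?thesis using u
      by (smt (verit) mult_nonneg_nonneg mult_pos_pos)
  qed
  have mx: "v \<bullet> y \<le> v \<bullet> x" if "v \<in> G" "y \<in> P" for v y using * that by (simp add: max_face_def)
  show "a \<in> max_face P G" "b \<in> max_face P G"
    unfolding max_face_def using *(1,2) mx eq by (auto, metis+)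
qed

lemma max_face_normal_cone: "G \<subseteq> normal_cone P (max_face P G)"
  by (auto simp: max_face_def normal_cone_def)

lemma mem_normal_fanI: "convex P \<Longrightarrow> max_face P G \<noteq> {} \<Longrightarrow> normal_cone P (max_face P G) \<in> normal_fan P"
  using max_face_face_of unfolding normal_fan_def by blast

section \<open>Minkowski sums and common refinements\<close>

lemma max_sum_iff:
  fixes P :: "'i \<Rightarrow> 'a::real_inner set"
  assumes I: "finite I" and x: "\<And>i. i \<in> I \<Longrightarrow> x i \<in> P i"
  shows "(\<forall>y \<in> (\<Sum>i \<in> I. P i). v \<bullet> y \<le> v \<bullet> (\<Sum>i \<in> I. x i)) \<longleftrightarrow> (\<forall>i \<in> I. \<forall>y \<in> P i. v \<bullet> y \<le> v \<bullet> x i)"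
proof (intro iffI ballI)
  fix i y assume *: "\<forall>y \<in> (\<Sum>i \<in> I. P i). v \<bullet> y \<le> v \<bullet> (\<Sum>i \<in> I. x i)" "i \<in> I" "y \<in> P i"
  let ?x = "x(i := y)"
  have "(\<Sum>i \<in> I. ?x i) \<in> (\<Sum>i \<in> I. P i)" using I x * by (auto simp: set_sum_alt)
  then have "v \<bullet> (\<Sum>i \<in> I. ?x i) \<le> v \<bullet> (\<Sum>i \<in> I. x i)" using * by blast
  moreover have "(\<Sum>j \<in> I. ?x j) = y + (\<Sum>j \<in> I - {i}. x j)" using I *
    by (subst sum.remove[of _ i]) auto
  moreover have "(\<Sum>j \<in> I. x j) = x i + (\<Sum>j \<in> I - {i}. x j)" using I *
    by (subst sum.remove[of _ i]) auto
  ultimately show "v \<bullet> y \<le> v \<bullet> x i" by (simp add: inner_add_right)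
next
  fix y assume *: "\<forall>i \<in> I. \<forall>y \<in> P i. v \<bullet> y \<le> v \<bullet> x i" "y \<in> (\<Sum>i \<in> I. P i)"
  then obtain s where "y = (\<Sum>i \<in> I. s i)" "\<And>i. i \<in> I \<Longrightarrow> s i \<in> P i" using I
    by (auto simp: set_sum_alt)
  then show "v \<bullet> y \<le> v \<bullet> (\<Sum>i \<in> I. x i)" using * by (auto simp: inner_sum_right intro!: sum_mono)
qed

lemma convex_sum_sets:
  fixes P :: "'i \<Rightarrow> 'a::real_inner set"
  assumes "finite I" "\<And>i. i \<in> I \<Longrightarrow> convex (P i)"
  shows "convex (\<Sum>i \<in> I. P i)"
  using assms by (induction I rule: finite_induct) (auto simp: convex_set_plus set_zero)

text \<open>A functional is maximal at a sum of points iff it is maximal at each summand. So a cone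
  of the sum is the intersection of the cones of the faces that it selects in the summands.
  Conversely, any choice of points in faces \<open>F i\<close> adds up to a common maximizer of the
  intersection \<open>N\<close>, and varying one summand at a time recovers the condition on each
  \<open>F i\<close>.\<close>

lemma normal_fan_sum:
  fixes P :: "'i \<Rightarrow> 'a::real_inner set"
  assumes I: "finite I" and conv: "\<And>i. i \<in> I \<Longrightarrow> convex (P i)"
  shows "normal_fan (\<Sum>i \<in> I. P i) = common_refinement I (\<lambda>i. normal_fan (P i))"
proof (intro equalityI subsetI)
  let ?P = "\<Sum>i \<in> I. P i"
  have cP: "convex ?P" using I conv by (rule convex_sum_sets)
  fix N assume "N \<in> normal_fan ?P"
  then obtain F where F: "F face_of ?P" "F \<noteq> {}" "N = normal_cone ?P F"
    by (auto simp: normal_fan_def)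
  have FP: "F \<subseteq> ?P" using F(1) by (rule face_of_imp_subset)
  have split: "\<exists>s. x = (\<Sum>i \<in> I. s i) \<and> (\<forall>i \<in> I. s i \<in> max_face (P i) N)" if x: "x \<in> F" for x
  proof -
    obtain s where s: "x = (\<Sum>i \<in> I. s i)" "\<And>i. i \<in> I \<Longrightarrow> s i \<in> P i" using FP x I
      by (auto simp: set_sum_alt)
    have "s i \<in> max_face (P i) N" if "i \<in> I" for i
      using max_sum_iff[OF I, of s P] s x that F(3) by (auto simp: max_face_def normal_cone_def)
    then show ?thesis using s by blast
  qed
  have "N = (\<Inter>i \<in> I. normal_cone (P i) (max_face (P i) N))"
  proof (intro equalityI subsetI)
    fix v assume "v \<in> N"
    then show "v \<in> (\<Inter>i \<in> I. normal_cone (P i) (max_face (P i) N))" using max_face_normal_cone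
      by blast
  next
    fix v assume v: "v \<in> (\<Inter>i \<in> I. normal_cone (P i) (max_face (P i) N))"
    have "v \<bullet> y \<le> v \<bullet> x" if "x \<in> F" "y \<in> ?P" for x y
    proof -
      obtain s where s: "x = (\<Sum>i \<in> I. s i)" "\<And>i. i \<in> I \<Longrightarrow> s i \<in> max_face (P i) N" using split \<open>x \<in> F\<close>
        by blast
      then have "\<forall>i \<in> I. \<forall>y \<in> P i. v \<bullet> y \<le> v \<bullet> s i" using v by (auto simp: normal_cone_def)
      then show ?thesis using max_sum_iff[OF I, of s P v] s that by (auto simp: max_face_def)
    qed
    then show "v \<in> N" by (auto simp: F(3) normal_cone_def)
  qed
  moreover have "normal_cone (P i) (max_face (P i) N) \<in> normal_fan (P i)" if "i \<in> I" for i
    using split F(2) that by (intro mem_normal_fanI conv) blast+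
  ultimately show "N \<in> common_refinement I (\<lambda>i. normal_fan (P i))" unfolding common_refinement_def
    by blast
next
  let ?P = "\<Sum>i \<in> I. P i"
  have cP: "convex ?P" using I conv by (rule convex_sum_sets)
  fix N assume "N \<in> common_refinement I (\<lambda>i. normal_fan (P i))"
  then obtain C where N: "N = (\<Inter>i \<in> I. C i)" "\<forall>i \<in> I. C i \<in> normal_fan (P i)"
    by (auto simp: common_refinement_def)
  then have "\<forall>i \<in> I. \<exists>F. F face_of P i \<and> F \<noteq> {} \<and> C i = normal_cone (P i) F"
    by (auto simp: normal_fan_def)
  then obtain F where F: "\<And>i. i \<in> I \<Longrightarrow> F i face_of P i \<and> F i \<noteq> {} \<and> C i = normal_cone (P i) (F i)"
    by metis
  have FP: "F i \<subseteq> P i" if "i \<in> I" for i using F that face_of_imp_subset by blast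
  have inmax: "(\<Sum>i \<in> I. s i) \<in> max_face ?P N" if s: "\<And>i. i \<in> I \<Longrightarrow> s i \<in> F i" for s
  proof -
    have sP: "\<And>i. i \<in> I \<Longrightarrow> s i \<in> P i" using s FP by blast
    have "\<forall>y \<in> ?P. v \<bullet> y \<le> v \<bullet> (\<Sum>i \<in> I. s i)" if "v \<in> N" for v
    proof -
      have "\<forall>i \<in> I. \<forall>y \<in> P i. v \<bullet> y \<le> v \<bullet> s i" using s that F N by (auto simp: normal_cone_def)
      then show ?thesis by (subst max_sum_iff[OF I sP])
    qed
    then show ?thesis using sP I by (auto simp: max_face_def set_sum_alt)
  qed
  have "\<exists>s. \<forall>i \<in> I. s i \<in> F i" using F by (intro bchoice) auto
  then obtain s where s: "\<And>i. i \<in> I \<Longrightarrow> s i \<in> F i" by blast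
  have "normal_cone ?P (max_face ?P N) \<subseteq> N"
  proof
    fix v assume v: "v \<in> normal_cone ?P (max_face ?P N)"
    have "v \<bullet> y \<le> v \<bullet> x" if i: "i \<in> I" "x \<in> F i" "y \<in> P i" for i x y
    proof -
      let ?s = "s(i := x)"
      have *: "\<And>j. j \<in> I \<Longrightarrow> ?s j \<in> F j" using s i by auto
      then have "\<forall>y \<in> ?P. v \<bullet> y \<le> v \<bullet> (\<Sum>j \<in> I. ?s j)"
        using inmax[of ?s] v by (auto simp: normal_cone_def)
      then have "\<forall>j \<in> I. \<forall>y \<in> P j. v \<bullet> y \<le> v \<bullet> ?s j"
        by (subst (asm) max_sum_iff[OF I]) (use * FP in blast)+
      then have "v \<bullet> y \<le> v \<bullet> ?s i" using i by blast
      then show ?thesis by simp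
    qed
    then show "v \<in> N" using F N by (auto simp: normal_cone_def)
  qed
  then have "N = normal_cone ?P (max_face ?P N)" using max_face_normal_cone by blast
  then show "N \<in> normal_fan ?P" using inmax[OF s] mem_normal_fanI[OF cP, of N] by auto
qed

text \<open>The link between cones and polytope in the abstract: \<open>p E\<close> maximizes over
  \<open>P\<close> every functional in \<open>C E\<close>, and the closed solid cones cover the
  space. Different indices may share a point, as congruent reorientations do.\<close>

locale vertex_cones =
  fixes R :: "'e set" and C :: "'e \<Rightarrow> 'a::euclidean_space set" and p :: "'e \<Rightarrow> 'a" and P :: "'a set"
  assumes finite: "finite R" and convex: "convex P"
    and vertex: "E \<in> R \<Longrightarrow> p E \<in> P"
    and maximal: "E \<in> R \<Longrightarrow> x \<in> C E \<Longrightarrow> z \<in> P \<Longrightarrow> x \<bullet> z \<le> x \<bullet> p E"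
    and cover: "\<exists>E \<in> R. x \<in> C E"
    and closed: "E \<in> R \<Longrightarrow> closed (C E)"
    and solid: "E \<in> R \<Longrightarrow> interior (C E) \<noteq> {}"
begin

text \<open>A point of \<open>P\<close> outside the hull would be separated from it by a functional,
  but that functional lies in some cone \<open>C E\<close> and is maximized over \<open>P\<close> at
  \<open>p E\<close>.\<close>

lemma hull: "P = convex hull (p ` R)"
proof (rule equalityI)
  show "convex hull (p ` R) \<subseteq> P" using vertex convex by (intro hull_minimal) auto
  show "P \<subseteq> convex hull (p ` R)"
  proof (rule subsetI, rule ccontr)
    fix z assume z: "z \<in> P" "z \<notin> convex hull (p ` R)"
    have "closed (convex hull (p ` R))"
      using finite by (intro compact_imp_closed compact_convex_hull finite_imp_compact) auto
    then obtain a b where ab: "a \<bullet> z < b" "\<And>x. x \<in> convex hull (p ` R) \<Longrightarrow> b < a \<bullet> x"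
      using separating_hyperplane_closed_point[of "convex hull (p ` R)" z] z
      by (auto simp: convex_convex_hull)
    obtain E where E: "E \<in> R" "- a \<in> C E" using cover by blast
    have "b < a \<bullet> p E" using E by (intro ab hull_inc) auto
    moreover have "- a \<bullet> z \<le> - a \<bullet> p E" using maximal[OF E z(1)] .
    ultimately show False using ab by simp
  qed
qed

text \<open>From the interior of the cone, \<open>y\<close> can be moved a little in direction
  \<open>p E' - p E\<close>. If \<open>p E'\<close> tied with \<open>p E\<close> at
  \<open>y\<close>, it would win after the move.\<close>

lemma unique_maximal:
  assumes E: "E \<in> R" "y \<in> interior (C E)" and E': "E' \<in> R" "p E' \<noteq> p E"
  shows "y \<bullet> p E' < y \<bullet> p E"
proof -
  define d where "d = p E' - p E"
  have d: "0 < d \<bullet> d" using E' by (simp add: d_def)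
  obtain e where e: "0 < e" "ball y e \<subseteq> C E" using E(2) mem_interior by blast
  define t where "t = e / 2 / norm d"
  have nd: "0 < norm d" using E' by (simp add: d_def)
  then have t: "0 < t" "norm (t *\<^sub>R d) = e / 2" using e by (auto simp: t_def)
  then have "y + t *\<^sub>R d \<in> ball y e" using e by (simp add: dist_norm)
  then have "(y + t *\<^sub>R d) \<bullet> p E' \<le> (y + t *\<^sub>R d) \<bullet> p E" using maximal[OF E(1)] vertex[OF E'(1)] e
    by blast
  then have "y \<bullet> p E' + t * (d \<bullet> d) \<le> y \<bullet> p E" by (simp add: d_def algebra_simps inner_simps)
  moreover have "0 < t * (d \<bullet> d)" using t d by simp
  ultimately show ?thesis by linarith
qed

text \<open>Perturb a functional \<open>x\<close> of the normal cone by a small positive multiple of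
  an interior point of \<open>C E0\<close>: now \<open>p E0\<close> beats every other point
  strictly, so each cone that contains the perturbed functional has the vertex \<open>p E0\<close>.
  A finite union of closed cones also contains the limit \<open>x\<close>.\<close>

lemma chamber:
  assumes E0: "E0 \<in> R"
  shows "(\<Union>E \<in> {E \<in> R. p E = p E0}. C E) = normal_cone P {p E0}"
proof (intro equalityI subsetI)
  fix x assume "x \<in> (\<Union>E \<in> {E \<in> R. p E = p E0}. C E)"
  then show "x \<in> normal_cone P {p E0}" using maximal by (force simp: normal_cone_def)
next
  let ?U = "\<Union>E \<in> {E \<in> R. p E = p E0}. C E"
  have cl: "closed ?U" using finite closed by (intro closed_UN) auto
  fix x assume x: "x \<in> normal_cone P {p E0}"
  obtain y where y: "y \<in> interior (C E0)" using solid[OF E0] by auto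
  have near: "x + t *\<^sub>R y \<in> ?U" if "0 < t" for t
  proof -
    obtain E where E: "E \<in> R" "x + t *\<^sub>R y \<in> C E" using cover by blast
    have "p E = p E0"
    proof (rule ccontr)
      assume n: "p E \<noteq> p E0"
      have "x \<bullet> p E \<le> x \<bullet> p E0" using x vertex[OF E(1)] by (simp add: normal_cone_def)
      moreover have "t * (y \<bullet> p E) < t * (y \<bullet> p E0)" using unique_maximal[OF E0 y E(1) n] that
        by simp
      moreover have "(x + t *\<^sub>R y) \<bullet> p E0 \<le> (x + t *\<^sub>R y) \<bullet> p E" using maximal[OF E vertex[OF E0]] .
      ultimately show False by (simp add: inner_add_left)
    qed
    then show ?thesis using E by blast
  qed
  have "(\<lambda>n. x + inverse (real (Suc n)) *\<^sub>R y) \<longlonglongrightarrow> x + 0 *\<^sub>R y"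
    by (intro tendsto_intros LIMSEQ_inverse_real_of_nat)
  then have lim: "(\<lambda>n. x + inverse (real (Suc n)) *\<^sub>R y) \<longlonglongrightarrow> x" by simp
  have "x + inverse (real (Suc n)) *\<^sub>R y \<in> ?U" for n by (rule near) simp
  then show "x \<in> ?U" by (rule closed_sequentially[OF cl _ lim])
qed

lemma normal_cone_vertex: "v \<in> normal_cone P {q} \<longleftrightarrow> (\<forall>E \<in> R. v \<bullet> p E \<le> v \<bullet> q)"
proof
  assume "v \<in> normal_cone P {q}"
  then show "\<forall>E \<in> R. v \<bullet> p E \<le> v \<bullet> q" using vertex by (simp add: normal_cone_def)
next
  assume *: "\<forall>E \<in> R. v \<bullet> p E \<le> v \<bullet> q"
  obtain E where "E \<in> R" "v \<in> C E" using cover by blast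
  then show "v \<in> normal_cone P {q}" using maximal * by (force simp: normal_cone_def)
qed

lemma normal_cone_face:
  assumes "p0 \<in> F" "F \<subseteq> P"
  shows "normal_cone P F face_of normal_cone P {p0}"
  unfolding face_of_def
proof (intro conjI ballI impI)
  show "normal_cone P F \<subseteq> normal_cone P {p0}" using assms by (auto simp: normal_cone_def)
  show "convex (normal_cone P F)"
    unfolding convex_def normal_cone_def
    by (auto simp: inner_add_left intro!: add_mono mult_left_mono)
next
  fix a b v assume *: "a \<in> normal_cone P {p0}" "b \<in> normal_cone P {p0}" "v \<in> normal_cone P F" "v \<in> open_segment a b"
  then obtain u where u: "0 < u" "u < 1" "v = (1 - u) *\<^sub>R a + u *\<^sub>R b" by (auto simp: in_segment)
  have "a \<bullet> x = a \<bullet> p0 \<and> b \<bullet> x = b \<bullet> p0" if x: "x \<in> F" for x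
  proof -
    have "a \<bullet> x \<le> a \<bullet> p0" "b \<bullet> x \<le> b \<bullet> p0" using * x assms by (auto simp: normal_cone_def)
    moreover have "v \<bullet> p0 \<le> v \<bullet> x" using * x assms by (auto simp: normal_cone_def)
    then have "(1 - u) * (a \<bullet> p0 - a \<bullet> x) + u * (b \<bullet> p0 - b \<bullet> x) \<le> 0"
      by (simp add: u inner_add_left algebra_simps)
    ultimately show ?thesis using u by (smt (verit) mult_nonneg_nonneg mult_pos_pos)
  qed
  then show "a \<in> normal_cone P F" "b \<in> normal_cone P F" using * by (auto simp: normal_cone_def)
qed

text \<open>Averaging finitely many elements of \<open>G\<close> gives one \<open>g\<close> that
  separates \<open>p E0\<close> strictly from all points outside the face. For \<open>v\<close> in
  the normal cone of that face, the segment from \<open>v\<close> to \<open>g\<close> can therefore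
  be prolonged beyond \<open>g\<close> within the normal cone of \<open>p E0\<close>. So
  \<open>g\<close> lies inside a segment starting at \<open>v\<close>, and the face property puts
  \<open>v\<close> into \<open>G\<close>.\<close>

lemma face_of_normal_cone:
  assumes E0: "E0 \<in> R" and G: "G face_of normal_cone P {p E0}" "G \<noteq> {}"
  shows "G = normal_cone P (max_face P G)" "p E0 \<in> max_face P G"
proof -
  let ?F = "max_face P G"
  have GN: "G \<subseteq> normal_cone P {p E0}" using G by (simp add: face_of_imp_subset)
  have le: "g \<bullet> p E \<le> g \<bullet> p E0" if "g \<in> G" "E \<in> R" for g E using GN that normal_cone_vertex by blast
  show pF: "p E0 \<in> ?F" using GN vertex[OF E0] by (auto simp: max_face_def normal_cone_def)
  have cG: "convex G" using G(1) by (rule face_of_imp_convex)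
  have "\<exists>g \<in> G. \<forall>E \<in> T. g \<bullet> p E < g \<bullet> p E0" if "finite T" "T \<subseteq> {E \<in> R. p E \<notin> ?F}" for T
    using that
  proof (induction T rule: finite_induct)
    case empty
    then show ?case using G(2) by auto
  next
    case (insert E T)
    then obtain g where g: "g \<in> G" "\<forall>E \<in> T. g \<bullet> p E < g \<bullet> p E0" by auto
    have E: "E \<in> R" "p E \<notin> ?F" using insert by auto
    then obtain h y where h: "h \<in> G" "y \<in> P" "h \<bullet> p E < h \<bullet> y" using vertex
      by (auto simp: max_face_def not_le)
    then have hE: "h \<bullet> p E < h \<bullet> p E0" using GN by (fastforce simp: normal_cone_def)
    let ?m = "(1/2) *\<^sub>R g + (1/2) *\<^sub>R h"
    have "?m \<in> G" using cG g(1) h(1) by (intro convexD) auto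
    moreover have "?m \<bullet> p E' < ?m \<bullet> p E0" if "E' \<in> insert E T" for E'
    proof -
      have "E' \<in> R" using that insert by auto
      then have "g \<bullet> p E' \<le> g \<bullet> p E0" "h \<bullet> p E' \<le> h \<bullet> p E0" using le g h by auto
      moreover have "g \<bullet> p E' < g \<bullet> p E0 \<or> h \<bullet> p E' < h \<bullet> p E0" using that g hE by auto
      ultimately show ?thesis by (auto simp: inner_add_left)
    qed
    ultimately show ?case by blast
  qed
  from this[of "{E \<in> R. p E \<notin> ?F}"] obtain g
    where g: "g \<in> G" "\<And>E. E \<in> R \<Longrightarrow> p E \<notin> ?F \<Longrightarrow> g \<bullet> p E < g \<bullet> p E0"
    using finite by auto
  have "normal_cone P ?F \<subseteq> G"
  proof
    fix v assume v: "v \<in> normal_cone P ?F"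
    show "v \<in> G"
    proof (cases "v = g")
      case False
      have vF: "v \<bullet> q = v \<bullet> p E0" if "q \<in> ?F" for q
        using v pF that by (intro antisym) (auto simp: normal_cone_def max_face_def)
      have gF: "g \<bullet> q = g \<bullet> p E0" if "q \<in> ?F" for q
        using g(1) pF that by (intro antisym) (auto simp: max_face_def)
      have "\<forall>\<^sub>F e in at_right 0. \<forall>E \<in> R. (g + e *\<^sub>R (g - v)) \<bullet> p E \<le> (g + e *\<^sub>R (g - v)) \<bullet> p E0"
      proof (intro eventually_ball_finite[OF finite] ballI)
        fix E assume E: "E \<in> R"
        show "\<forall>\<^sub>F e in at_right 0. (g + e *\<^sub>R (g - v)) \<bullet> p E \<le> (g + e *\<^sub>R (g - v)) \<bullet> p E0"
        proof (cases "p E \<in> ?F")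
          case True
          then show ?thesis by (simp add: inner_add_left inner_diff_left vF gF)
        next
          case False
          have "((\<lambda>e. (g + e *\<^sub>R (g - v)) \<bullet> (p E0 - p E)) \<longlongrightarrow> (g + 0 *\<^sub>R (g - v)) \<bullet> (p E0 - p E)) (at_right 0)"
            by (intro tendsto_intros)
          moreover have "0 < (g + 0 *\<^sub>R (g - v)) \<bullet> (p E0 - p E)" using g(2)[OF E False]
            by (simp add: inner_diff_right)
          ultimately have "\<forall>\<^sub>F e in at_right 0. 0 < (g + e *\<^sub>R (g - v)) \<bullet> (p E0 - p E)"
            by (rule order_tendstoD(1))
          then show ?thesis by eventually_elim (simp add: inner_diff_right)
        qed
      qed
      from eventually_happens'[OF _ eventually_conj[OF eventually_at_right_less this]] obtain e :: real
        where e: "e > 0" "\<forall>E \<in> R. (g + e *\<^sub>R (g - v)) \<bullet> p E \<le> (g + e *\<^sub>R (g - v)) \<bullet> p E0" by auto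
      let ?w = "g + e *\<^sub>R (g - v)"
      have wN: "?w \<in> normal_cone P {p E0}" using e normal_cone_vertex by blast
      have vN: "v \<in> normal_cone P {p E0}" using v pF by (auto simp: normal_cone_def)
      define u where "u = 1 / (1 + e)"
      have u: "0 < u" "u < 1" "u * (1 + e) = 1" using e by (auto simp: u_def field_simps)
      have "(1 - u) *\<^sub>R v + u *\<^sub>R ?w = (u * (1 + e)) *\<^sub>R g + (1 - u * (1 + e)) *\<^sub>R v"
        by (simp add: algebra_simps)
      then have "g = (1 - u) *\<^sub>R v + u *\<^sub>R ?w" using u by simp
      moreover have "v \<noteq> ?w"
      proof
        assume "v = ?w"
        then have "(1 + e) *\<^sub>R (g - v) = 0" by (simp add: algebra_simps)
        then show False using e False by auto
      qed
      ultimately have "g \<in> open_segment v ?w" using u by (auto simp: in_segment)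
      then show "v \<in> G" using G(1) vN wN g(1) unfolding face_of_def by blast
    qed (simp add: g)
  qed
  then show "G = normal_cone P ?F" using max_face_normal_cone by blast
qed

lemma fan_eq_normal_fan:
  assumes r: "equiv R r" and r_iff: "\<And>E E'. E \<in> R \<Longrightarrow> E' \<in> R \<Longrightarrow> (E, E') \<in> r \<longleftrightarrow> p E = p E'"
  shows "{G. G \<noteq> {} \<and> (\<exists>K \<in> (\<lambda>X. \<Union>E \<in> X. C E) ` (R // r). G face_of K)} = normal_fan P"
proof -
  have cls: "r `` {E} = {E' \<in> R. p E' = p E}" if "E \<in> R" for E
    using r r_iff that by (auto simp: equiv_def)
  have chambers: "(\<lambda>X. \<Union>E \<in> X. C E) ` (R // r) = (\<lambda>E. normal_cone P {p E}) ` R"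
    unfolding quotient_def using chamber cls by (auto simp: image_iff)
  show ?thesis unfolding chambers
  proof (intro equalityI subsetI)
    fix G assume "G \<in> {G. G \<noteq> {} \<and> (\<exists>K \<in> (\<lambda>E. normal_cone P {p E}) ` R. G face_of K)}"
    then obtain E where "E \<in> R" "G face_of normal_cone P {p E}" "G \<noteq> {}" by auto
    then show "G \<in> normal_fan P"
      using face_of_normal_cone[of E G] mem_normal_fanI[OF convex, of G] by auto
  next
    fix N assume "N \<in> normal_fan P"
    then obtain F where F: "F face_of P" "F \<noteq> {}" "N = normal_cone P F"
      by (auto simp: normal_fan_def)
    have "compact (p ` R)" using finite by (intro finite_imp_compact) auto
    \<comment> \<open>A face of the hull of finitely many points is the hull of some of them, so a
      nonempty face contains some \<open>p E\<close>.\<close>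
    then obtain S where S: "S \<subseteq> p ` R" "F = convex hull S"
      using face_of_convex_hull_subset[of "p ` R" F] F(1) hull by metis
    then obtain E where E: "E \<in> R" "p E \<in> F" using F(2)
      by (metis convex_hull_eq_empty ex_in_conv hull_inc imageE subsetD)
    have "N face_of normal_cone P {p E}"
      unfolding F(3) using E F(1) by (intro normal_cone_face) (auto simp: face_of_imp_subset)
    moreover have "0 \<in> N" by (auto simp: F(3) normal_cone_def)
    ultimately show "N \<in> {G. G \<noteq> {} \<and> (\<exists>K \<in> (\<lambda>E. normal_cone P {p E}) ` R. G face_of K)}" using E
      by auto
  qed
qed

end

section \<open>Vertices of Cambrian associahedra\<close>

lemma sorted_list_of_acyclic:
  assumes "finite S" "acyclic B" "finite B"
    and total: "\<And>x y. x \<in> S \<Longrightarrow> y \<in> S \<Longrightarrow> x \<noteq> y \<Longrightarrow> (x, y) \<in> B \<or> (y, x) \<in> B"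
  obtains xs where "set xs = S" "distinct xs" "sorted_wrt (\<lambda>x y. (x, y) \<in> B) xs"
proof -
  have "\<exists>xs. set xs = S \<and> distinct xs \<and> sorted_wrt (\<lambda>x y. (x, y) \<in> B) xs"
    using assms(1) total
  proof (induction "card S" arbitrary: S)
    case 0
    then show ?case by simp
  next
    case (Suc k)
    have "wf B" using assms by (simp add: finite_acyclic_wf)
    moreover have "S \<noteq> {}" using Suc by auto
    ultimately obtain x where x: "x \<in> S" "\<And>y. (y, x) \<in> B \<Longrightarrow> y \<notin> S" by (metis ex_in_conv wfE_min)
    have "k = card (S - {x})" "finite (S - {x})" using Suc(2,3) x by auto
    from Suc(1)[OF this] Suc(4) obtain xs
      where xs: "set xs = S - {x}" "distinct xs" "sorted_wrt (\<lambda>x y. (x, y) \<in> B) xs"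
      by (metis DiffD1)
    have "(x, y) \<in> B" if "y \<in> S - {x}" for y using Suc(4)[of x y] x that by blast
    then have "set (x # xs) = S \<and> distinct (x # xs) \<and> sorted_wrt (\<lambda>x y. (x, y) \<in> B) (x # xs)"
      using x(1) xs by (simp add: insert_absorb)
    then show ?case by blast
  qed
  then show ?thesis using that by blast
qed

lemma sorted_wrt_set_unique:
  assumes "\<And>x y. R x y \<Longrightarrow> \<not> R y x" "sorted_wrt R xs" "sorted_wrt R ys" "set xs = set ys"
  shows "xs = ys"
  using assms(2-4)
proof (induction xs arbitrary: ys)
  case (Cons x xs)
  then obtain y ys' where ys: "ys = y # ys'" by (cases ys) auto
  have irr: "\<not> R z z" for z using assms(1) by blast
  have xy: "x = y"
  proof (rule ccontr)
    assume "x \<noteq> y"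
    then have "x \<in> set ys'" "y \<in> set xs" using Cons(4) ys by auto
    then have "R y x" "R x y" using Cons(2,3) ys by auto
    then show False using assms(1) by blast
  qed
  have "x \<notin> set xs" "y \<notin> set ys'" using Cons(2,3) ys irr by auto
  then have "set xs = set ys'" using Cons(4) ys xy by auto
  then show ?case using Cons ys xy by auto
qed simp

text \<open>Counting from 1 leaves the numbers 0 and \<open>length vs + 1\<close> for the two ends
  of the polygon.\<close>

definition positions :: "'v list \<Rightarrow> 'v set \<Rightarrow> nat set" where
  "positions vs W = {i \<in> {1..length vs}. vs ! (i - 1) \<in> W}"

lemma positions_subset: "positions vs W \<subseteq> {1..length vs}"
  by (auto simp: positions_def)

lemma bij_betw_positions:
  assumes "distinct vs"
  shows "bij_betw (\<lambda>i. vs ! (i - 1)) (positions vs W) (W \<inter> set vs)"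
  unfolding bij_betw_def
proof
  show "inj_on (\<lambda>i. vs ! (i - 1)) (positions vs W)"
  proof (rule inj_onI)
    fix i j assume "i \<in> positions vs W" "j \<in> positions vs W" "vs ! (i - 1) = vs ! (j - 1)"
    moreover from this have "i - 1 < length vs" "j - 1 < length vs" by (auto simp: positions_def)
    ultimately have "i - 1 = j - 1" "1 \<le> i" "1 \<le> j" using assms
      by (auto simp: nth_eq_iff_index_eq positions_def)
    then show "i = j" by simp
  qed
  show "(\<lambda>i. vs ! (i - 1)) ` positions vs W = W \<inter> set vs"
  proof (intro equalityI subsetI)
    fix w assume w: "w \<in> W \<inter> set vs"
    then obtain k where "k < length vs" "vs ! k = w" by (auto simp: in_set_conv_nth)
    then have "Suc k \<in> positions vs W" "vs ! (Suc k - 1) = w" using w by (auto simp: positions_def)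
    then show "w \<in> (\<lambda>i. vs ! (i - 1)) ` positions vs W" by blast
  qed (auto simp: positions_def)
qed

lemma sum_positions: "distinct vs \<Longrightarrow> (\<Sum>i \<in> positions vs W. z (vs ! (i - 1))) = sum z (W \<inter> set vs)"
  by (rule sum.reindex_bij_betw[OF bij_betw_positions])

lemma card_positions: "distinct vs \<Longrightarrow> card (positions vs W) = card (W \<inter> set vs)"
  using bij_betw_positions bij_betw_same_card by blast

lemma positions_set: "positions vs (set vs) = {1..length vs}"
  by (auto simp: positions_def)

lemma positions_empty [simp]: "positions vs {} = {}"
  by (simp add: positions_def)

lemma positions_insert:
  assumes "distinct vs" "k < length vs"
  shows "positions vs (insert (vs ! k) W) = insert (Suc k) (positions vs W)"
  using assms by (auto simp: positions_def nth_eq_iff_index_eq)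

lemma positions_Int: "positions vs (W \<inter> set vs) = positions vs W"
  by (auto simp: positions_def)

lemma associahedron_facet_set_positions:
  assumes vs: "distinct vs" and sig: "dn \<inter> up = {}" "dn \<union> up = set vs - {hd vs, last vs}"
    and U: "U \<subseteq> set vs"
  shows "associahedron_facet_set vs dn up U \<longleftrightarrow> facet_set (length vs) (positions vs up) (positions vs U)"
proof -
  let ?n = "length vs"
  have mem: "Suc k \<in> positions vs W \<longleftrightarrow> vs ! k \<in> W" if "k < ?n" for k W using that
    by (simp add: positions_def)
  \<comment> \<open>An entry strictly between two others is neither the first nor the last, so it
    belongs to exactly one side of the signature.\<close>
  have mid: "vs ! j \<in> dn \<longleftrightarrow> vs ! j \<notin> up" if "i < j" "j < k" "k < ?n" for i j k
  proof -
    have "vs \<noteq> []" using that by auto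
    then have "vs ! j \<noteq> hd vs" "vs ! j \<noteq> last vs"
      using vs that by (auto simp: hd_conv_nth last_conv_nth nth_eq_iff_index_eq)
    then have "vs ! j \<in> dn \<union> up" using that by (simp add: sig(2))
    then show ?thesis using sig(1) by auto
  qed
  have "positions vs U = {} \<longleftrightarrow> U = {}"
  proof
    assume "positions vs U = {}"
    then have "U \<inter> set vs = {}" using bij_betw_positions[OF vs, of U] by (simp add: bij_betw_def)
    then show "U = {}" using U by auto
  qed simp
  moreover have "positions vs U \<subset> {1..?n} \<longleftrightarrow> U \<subset> set vs"
  proof
    assume "positions vs U \<subset> {1..?n}"
    then show "U \<subset> set vs" using U positions_set[of vs] by auto
  next
    assume a: "U \<subset> set vs"
    have "positions vs U \<noteq> {1..?n}"
    proof
      assume "positions vs U = {1..?n}"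
      then have "U \<inter> set vs = set vs \<inter> set vs"
        using bij_betw_positions[OF vs, of U] bij_betw_positions[OF vs, of "set vs"]
        by (simp add: positions_set bij_betw_def)
      then show False using a by auto
    qed
    then show "positions vs U \<subset> {1..?n}" using positions_subset by blast
  qed
  moreover have "(\<forall>i j k. i < j \<and> j < k \<and> k < ?n \<longrightarrow>
        (vs ! i \<in> U \<and> vs ! k \<in> U \<and> vs ! j \<in> dn \<longrightarrow> vs ! j \<in> U) \<and>
        (vs ! i \<notin> U \<and> vs ! k \<notin> U \<and> vs ! j \<in> up \<longrightarrow> vs ! j \<notin> U)) \<longleftrightarrow>
     (\<forall>i j k. 1 \<le> i \<and> i < j \<and> j < k \<and> k \<le> ?n \<longrightarrow>
        (i \<in> positions vs U \<and> k \<in> positions vs U \<and> j \<notin> positions vs up \<longrightarrow> j \<in> positions vs U) \<and>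
        (i \<notin> positions vs U \<and> k \<notin> positions vs U \<and> j \<in> positions vs up \<longrightarrow> j \<notin> positions vs U))"
    (is "?L \<longleftrightarrow> ?R")
  proof
    assume L: ?L
    show ?R
    proof (intro allI impI)
      fix i j k assume ijk: "1 \<le> i \<and> i < j \<and> j < k \<and> k \<le> ?n"
      define i' j' k' where "i' = i - 1" "j' = j - 1" "k' = k - 1"
      then have "i = Suc i'" "j = Suc j'" "k = Suc k'" "i' < j'" "j' < k'" "k' < ?n" using ijk
        by auto
      then show "(i \<in> positions vs U \<and> k \<in> positions vs U \<and> j \<notin> positions vs up \<longrightarrow> j \<in> positions vs U) \<and>
        (i \<notin> positions vs U \<and> k \<notin> positions vs U \<and> j \<in> positions vs up \<longrightarrow> j \<notin> positions vs U)"
        using L mid[of i' j' k'] by (simp add: mem)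
    qed
  next
    assume R: ?R
    show ?L
    proof (intro allI impI)
      fix i j k assume ijk: "i < j \<and> j < k \<and> k < ?n"
      then show "(vs ! i \<in> U \<and> vs ! k \<in> U \<and> vs ! j \<in> dn \<longrightarrow> vs ! j \<in> U) \<and>
        (vs ! i \<notin> U \<and> vs ! k \<notin> U \<and> vs ! j \<in> up \<longrightarrow> vs ! j \<notin> U)"
        using R[rule_format, of "Suc i" "Suc j" "Suc k"] mid[of i j k] by (simp add: mem)
    qed
  qed
  ultimately show ?thesis unfolding associahedron_facet_set_def facet_set_def by simp
qed

lemma inner_ones: "ones U \<bullet> x = (\<Sum>w \<in> U. x $ w)"
  by (simp add: ones_def inner_sum_left inner_axis')

section \<open>Greedy vertices of supermodular functions\<close>

lemma supermodular_increment:
  fixes g :: "'v set \<Rightarrow> real"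
  assumes "finite S"
    and ex: "\<And>W a b. W \<subseteq> S \<Longrightarrow> a \<in> S - W \<Longrightarrow> b \<in> S - W \<Longrightarrow> a \<noteq> b \<Longrightarrow>
      g (insert a W) + g (insert b W) \<le> g (insert a (insert b W)) + g W"
    and W: "W \<subseteq> W'" "W' \<subseteq> S" "a \<in> S - W'"
  shows "g (insert a W) - g W \<le> g (insert a W') - g W'"
proof -
  have "finite W'" using W assms(1) finite_subset by blast
  \<comment> \<open>The exchange inequality for two elements extends to larger sets by adding the
    elements of \<open>W' - W\<close> one at a time.\<close>
  have "T \<subseteq> W' - W \<Longrightarrow> g (insert a W) - g W \<le> g (insert a (W \<union> T)) - g (W \<union> T)" if "finite T" for T
    using that
  proof (induction T rule: finite_induct)
    case (insert b T)
    then have "g (insert a (W \<union> T)) + g (insert b (W \<union> T)) \<le> g (insert a (insert b (W \<union> T))) + g (W \<union> T)"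
      using W by (intro ex) auto
    then show ?case using insert by simp
  qed simp
  from this[of "W' - W"] show ?thesis using W \<open>finite W'\<close> by (simp add: Un_absorb1)
qed

lemma greedy_prefix:
  fixes g :: "'v set \<Rightarrow> real"
  assumes ws: "distinct ws"
    and z: "\<And>k. k < length ws \<Longrightarrow> z (ws ! k) = g (insert (ws ! k) (set (take k ws))) - g (set (take k ws))"
  shows "k \<le> length ws \<Longrightarrow> sum z (set (take k ws)) = g (set (take k ws)) - g {}"
proof (induction k)
  case (Suc k)
  then have "set (take (Suc k) ws) = insert (ws ! k) (set (take k ws))" "ws ! k \<notin> set (take k ws)"
    using ws by (auto simp: take_Suc_conv_app_nth distinct_conv_nth in_set_conv_nth)
  then show ?case using Suc z[of k] by simp
qed simp

text \<open>Scan \<open>ws\<close> and keep only the elements of \<open>U\<close>. Each kept element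
  is charged its increment over a full prefix, which by supermodularity is at least its increment
  over the kept part.\<close>

lemma greedy_feasible:
  fixes g :: "'v set \<Rightarrow> real"
  assumes ws: "distinct ws"
    and ex: "\<And>W a b. W \<subseteq> set ws \<Longrightarrow> a \<in> set ws - W \<Longrightarrow> b \<in> set ws - W \<Longrightarrow> a \<noteq> b \<Longrightarrow>
      g (insert a W) + g (insert b W) \<le> g (insert a (insert b W)) + g W"
    and z: "\<And>k. k < length ws \<Longrightarrow> z (ws ! k) = g (insert (ws ! k) (set (take k ws))) - g (set (take k ws))"
    and U: "U \<subseteq> set ws"
  shows "g U - g {} \<le> sum z U"
proof -
  have "k \<le> length ws \<Longrightarrow> g (U \<inter> set (take k ws)) - g {} \<le> sum z (U \<inter> set (take k ws))" for k
  proof (induction k)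
    case (Suc k)
    let ?a = "ws ! k"
    have t: "set (take (Suc k) ws) = insert ?a (set (take k ws))" "?a \<notin> set (take k ws)"
      using ws Suc(2) by (auto simp: take_Suc_conv_app_nth distinct_conv_nth in_set_conv_nth)
    show ?case
    proof (cases "?a \<in> U")
      case True
      have "g (insert ?a (U \<inter> set (take k ws))) - g (U \<inter> set (take k ws)) \<le> z ?a"
        using Suc(2) t set_take_subset[of k ws] z[of k]
        by (simp, intro supermodular_increment[of "set ws" g] ex) auto
      moreover have "U \<inter> set (take (Suc k) ws) = insert ?a (U \<inter> set (take k ws))" using t True
        by auto
      ultimately show ?thesis using Suc t by simp
    next
      case False
      then have "U \<inter> set (take (Suc k) ws) = U \<inter> set (take k ws)" using t by auto
      then show ?thesis using Suc by simp
    qed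
  qed simp
  from this[of "length ws"] show ?thesis using U by (simp add: Int_absorb2)
qed

text \<open>Abel summation: the weights \<open>x\<close> increase along \<open>ws\<close> while the
  prefix sums of \<open>d\<close> stay nonpositive and end at zero. The induction needs the stronger
  bound by the last weight times the prefix sum.\<close>

lemma sum_by_parts_nonneg:
  fixes x d :: "'v \<Rightarrow> real"
  assumes ws: "distinct ws"
    and x: "sorted_wrt (\<lambda>a b. x a \<le> x b) ws"
    and d: "\<And>k. k \<le> length ws \<Longrightarrow> sum d (set (take k ws)) \<le> 0" "sum d (set ws) = 0"
  shows "0 \<le> (\<Sum>w \<in> set ws. x w * d w)"
proof -
  have prefix: "k < length ws \<Longrightarrow>
    x (ws ! k) * sum d (set (take (Suc k) ws)) \<le> (\<Sum>w \<in> set (take (Suc k) ws). x w * d w)" for k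
  proof (induction k)
    case 0
    then show ?case by (cases ws) auto
  next
    case (Suc k)
    let ?T = "set (take (Suc k) ws)" and ?b = "ws ! Suc k"
    have t: "set (take (Suc (Suc k)) ws) = insert ?b ?T" "?b \<notin> ?T"
      using ws Suc(2)
      by (auto simp: take_Suc_conv_app_nth[of "Suc k"] distinct_conv_nth in_set_conv_nth)
    have "x (ws ! k) \<le> x ?b" using x Suc(2) sorted_wrt_nth_less by fastforce
    then have "x ?b * sum d ?T \<le> x (ws ! k) * sum d ?T"
      using d(1)[of "Suc k"] Suc(2) by (intro mult_right_mono_neg) auto
    then have "x ?b * sum d ?T \<le> (\<Sum>w \<in> ?T. x w * d w)" using Suc by linarith
    then show ?case unfolding t(1) using t(2) by (simp add: distrib_left)
  qed
  show ?thesis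
  proof (cases ws rule: rev_cases)
    case (snoc ws' a)
    then show ?thesis using prefix[of "length ws'"] d(2) by simp
  qed simp
qed

fun rope_vertices :: "'v rope \<Rightarrow> 'v set" where
  "rope_vertices (u, v, dn, up) = {u, v} \<union> dn \<union> up"

fun rope_support :: "('v \<times> 'v) set \<Rightarrow> 'v rope \<Rightarrow> 'v set \<Rightarrow> real" where
  "rope_support A (u, v, dn, up) W = (let vs = THE vs. path_from_to (transitive_reduction A) u vs v in
     path_support (length vs) (positions vs up) (positions vs W))"

text \<open>Edmonds' greedy vertex for the order given by \<open>E\<close>: each coordinate is the
  increment caused by \<open>w\<close> on top of its predecessors. Predecessors outside the rope
  drop out, as \<open>positions\<close> ignores them.\<close>

definition rope_vertex :: "('v::finite \<times> 'v) set \<Rightarrow> 'v rope \<Rightarrow> ('v \<times> 'v) set \<Rightarrow> real ^ 'v" where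
  "rope_vertex A \<rho> E = (\<chi> w. if w \<in> rope_vertices \<rho>
     then rope_support A \<rho> (insert w {z. (z, w) \<in> reorient A E}) - rope_support A \<rho> {z. (z, w) \<in> reorient A E}
     else 0)"

section \<open>The path underlying a rope\<close>

context skeletal_dag
begin

lemma mem_transitive_reduction:
  "(x, y) \<in> transitive_reduction A \<longleftrightarrow> (x, y) \<in> A \<and> between x y = {}"
  using mem_transitive_reduction_induced[of x y UNIV] by (simp add: induced_subgraph_def)

text \<open>Follow the path with \<open>w\<close> lying after the current vertex. It cannot lie
  before the next one, as it would bypass an arc of the transitive reduction; being comparable, it
  lies after that one too.\<close>

lemma backbone_cover:
  assumes "successively (\<lambda>x y. (x, y) \<in> transitive_reduction A) p" "p \<noteq> []"
    and "\<And>y. y \<in> set p \<Longrightarrow> y \<noteq> w \<Longrightarrow> (y, w) \<in> A \<or> (w, y) \<in> A" "w \<notin> set p" "(hd p, w) \<in> A"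
  shows "(w, last p) \<notin> A"
  using assms
proof (induction p)
  case (Cons x q)
  show ?case
  proof (cases "q = []")
    case True
    then show ?thesis using Cons asym by simp
  next
    case False
    have "(x, hd q) \<in> transitive_reduction A" using Cons(2) False by (simp add: successively_Cons)
    then have "(w, hd q) \<notin> A" using Cons(6) unfolding mem_transitive_reduction by auto
    moreover have "hd q \<in> set q" using False by simp
    ultimately have "(hd q, w) \<in> A" using Cons(4)[of "hd q"] Cons(5) by auto
    then have "(w, last q) \<notin> A" using Cons False by (intro Cons(1)) (auto simp: successively_Cons)
    then show ?thesis using False by simp
  qed
qed simp

text \<open>The definite description denotes. The support listed in the order of \<open>A\<close> is
  such a path, since convexity leaves no room between consecutive entries. Any other such path
  visits the whole support by \<open>backbone_cover\<close>, and its order is forced.\<close>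

lemma backbone:
  assumes uv: "(u, v) \<in> A"
  defines "vs \<equiv> THE vs. path_from_to (transitive_reduction A) u vs v"
  shows "set vs = transitive_support A u v" "distinct vs" "sorted_wrt (\<lambda>x y. (x, y) \<in> A) vs"
    "hd vs = u" "last vs = v" "vs \<noteq> []"
proof -
  let ?S = "transitive_support A u v" and ?T = "transitive_reduction A"
  note S = transitive_support_arc[OF uv]
  have props: "set p = ?S \<and> sorted_wrt (\<lambda>x y. (x, y) \<in> A) p" if p: "path_from_to ?T u p v" for p
  proof -
    have "successively (\<lambda>x y. (x, y) \<in> A) p"
      using p unfolding path_from_to_def directed_path_def
      by (elim conjE) (erule successively_mono, auto simp: mem_transitive_reduction)
    then have dp: "directed_path A p" "hd p = u" "last p = v" "p \<noteq> []"
      using p by (auto simp: path_from_to_def directed_path_def)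
    have sub: "set p \<subseteq> ?S" using dp by (auto simp: transitive_support_def path_from_to_def)
    have "w \<in> set p" if w: "w \<in> ?S" for w
    proof (rule ccontr)
      assume n: "w \<notin> set p"
      then have "w \<noteq> u" "w \<noteq> v" using dp by (metis hd_in_set, metis last_in_set)
      then have "(hd p, w) \<in> A" "(w, last p) \<in> A" using w dp by (auto simp: S)
      moreover have "(y, w) \<in> A \<or> (w, y) \<in> A" if "y \<in> set p" "y \<noteq> w" for y
        using support_clique[OF uv _ w that(2)] sub that by blast
      ultimately show False using backbone_cover[of p w] p n dp(4)
        by (auto simp: path_from_to_def directed_path_def)
    qed
    then show ?thesis using sub filled_sorted[OF dp(1)] dp uv by blast
  qed
  obtain xs where xs: "set xs = ?S" "distinct xs" "sorted_wrt (\<lambda>x y. (x, y) \<in> A) xs"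
    by (rule sorted_list_of_acyclic[of ?S A]) (use acyclic support_clique[OF uv] in auto)
  have ne: "xs \<noteq> []" using xs S by auto
  have "hd xs = u"
  proof (rule ccontr)
    assume n: "hd xs \<noteq> u"
    have "hd xs \<in> ?S" using xs(1) hd_in_set[OF ne] by simp
    then have "(u, hd xs) \<in> A" using n uv unfolding S by auto
    moreover have "u \<in> set xs" using xs(1) S by simp
    then have "u \<in> set (tl xs)" using n ne by (cases xs) auto
    then have "(hd xs, u) \<in> A" using xs ne by (cases xs) auto
    ultimately show False using asym by blast
  qed
  moreover have "last xs = v"
  proof (rule ccontr)
    assume n: "last xs \<noteq> v"
    have "last xs \<in> ?S" using xs(1) last_in_set[OF ne] by simp
    then have "(last xs, v) \<in> A" using n uv unfolding S by auto
    moreover have "v \<in> set xs" using xs(1) S by simp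
    then have "v \<in> set (butlast xs)" using n ne by (cases xs rule: rev_cases) auto
    then have "(v, last xs) \<in> A" using xs ne
      by (cases xs rule: rev_cases) (auto simp: sorted_wrt_append)
    ultimately show False using asym by blast
  qed
  moreover have "successively (\<lambda>x y. (x, y) \<in> ?T) xs"
    unfolding successively_conv_nth
  proof (intro allI impI)
    fix i assume i: "Suc i < length xs"
    have lt: "(xs ! j, xs ! k) \<in> A" if "j < k" "k < length xs" for j k
      using sorted_wrt_nth_less[OF xs(3) that] .
    have "\<not> ((xs ! i, z) \<in> A \<and> (z, xs ! Suc i) \<in> A)" for z
    proof
      assume z: "(xs ! i, z) \<in> A \<and> (z, xs ! Suc i) \<in> A"
      have "xs ! i \<in> ?S" "xs ! Suc i \<in> ?S" using i xs(1) nth_mem[of i xs] nth_mem[of "Suc i" xs]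
        by simp_all
      then have "z \<in> set xs" using support_convex[OF uv] z xs(1) by blast
      then obtain k where k: "k < length xs" "z = xs ! k" by (auto simp: in_set_conv_nth)
      have "k \<noteq> i" "k \<noteq> Suc i" using z k arc_neq by auto
      moreover have "\<not> k < i" using z k i lt[of k i] asym by auto
      moreover have "\<not> Suc i < k" using z k i lt[of "Suc i" k] asym by auto
      ultimately show False by simp
    qed
    then show "(xs ! i, xs ! Suc i) \<in> ?T" using lt[of i "Suc i"] i
      by (auto simp: mem_transitive_reduction)
  qed
  ultimately have path: "path_from_to ?T u xs v" using xs ne
    by (simp add: path_from_to_def directed_path_def)
  have "vs = xs"
    unfolding vs_def
  proof (rule the_equality)
    show "path_from_to ?T u xs v" by (rule path)
    fix p assume "path_from_to ?T u p v"
    from props[OF this] show "p = xs"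
      using xs asym by (intro sorted_wrt_set_unique[of "\<lambda>x y. (x, y) \<in> A"]) auto
  qed
  then show "set vs = ?S" "distinct vs" "sorted_wrt (\<lambda>x y. (x, y) \<in> A) vs" "hd vs = u" "last vs = v" "vs \<noteq> []"
    using xs ne \<open>hd xs = u\<close> \<open>last xs = v\<close> by auto
qed

end

lemma positions_image:
  assumes "distinct vs" "U \<subseteq> {1..length vs}"
  shows "positions vs ((\<lambda>i. vs ! (i - 1)) ` U) = U"
proof (intro equalityI subsetI)
  fix i assume "i \<in> positions vs ((\<lambda>i. vs ! (i - 1)) ` U)"
  then obtain j where *: "1 \<le> i" "i \<le> length vs" "j \<in> U" "vs ! (i - 1) = vs ! (j - 1)"
    by (auto simp: positions_def)
  moreover have "1 \<le> j" "j \<le> length vs" using * assms(2) by auto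
  ultimately have "i - 1 = j - 1" using assms(1) by (subst (asm) nth_eq_iff_index_eq) auto
  then have "i = j" using * \<open>1 \<le> j\<close> by simp
  then show "i \<in> U" using * by simp
next
  fix i assume "i \<in> U"
  then show "i \<in> positions vs ((\<lambda>i. vs ! (i - 1)) ` U)" using assms by (auto simp: positions_def)
qed

section \<open>The associahedron of a single rope\<close>

locale skeletal_rope = skeletal_dag A for A :: "('v::finite \<times> 'v) set" +
  fixes u v :: 'v and dn up :: "'v set"
  assumes rope: "(u, v, dn, up) \<in> ropes A"
begin

definition vs :: "'v list" where
  "vs = (THE vs. path_from_to (transitive_reduction A) u vs v)"

definition g :: "'v set \<Rightarrow> real" where
  "g = rope_support A (u, v, dn, up)"

lemma rope_props: "(u, v) \<in> A" "dn \<inter> up = {}" "dn \<union> up = between u v"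
  using rope by (auto simp: mem_ropes)

lemmas backbone_vs = backbone[OF rope_props(1), folded vs_def]

lemma set_vs: "set vs = rope_vertices (u, v, dn, up)"
  using rope_props backbone_vs(1) by (auto simp: transitive_support_arc)

lemma signature: "dn \<union> up = set vs - {hd vs, last vs}"
  using rope_props arc_neq unfolding set_vs backbone_vs(4,5) by auto

lemma g_eq: "g W = path_support (length vs) (positions vs up) (positions vs W)"
  by (simp add: g_def vs_def Let_def)

lemma g_Int: "g (W \<inter> set vs) = g W"
  by (simp add: g_eq positions_Int)

lemma g_empty: "g {} = 0"
  unfolding g_eq positions_empty by (rule path_support_empty[OF positions_subset])

lemma g_full: "g (set vs) = triangular (length vs)"
  unfolding g_eq positions_set by (rule path_support_full[OF positions_subset])

lemma vs_less_iff:
  assumes "k < length vs" "l < length vs"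
  shows "(vs ! k, vs ! l) \<in> A \<longleftrightarrow> k < l"
proof (cases k l rule: linorder_cases)
  case less
  then show ?thesis using sorted_wrt_nth_less[OF backbone_vs(3)] assms by blast
next
  case equal
  then show ?thesis using arc_neq by blast
next
  case greater
  then show ?thesis using sorted_wrt_nth_less[OF backbone_vs(3) greater assms(1)] asym by auto
qed

lemma vs_clique: "x \<in> set vs \<Longrightarrow> y \<in> set vs \<Longrightarrow> x \<noteq> y \<Longrightarrow> (x, y) \<in> A \<or> (y, x) \<in> A"
  using support_clique[OF rope_props(1)] backbone_vs(1) by blast

lemma between_vs:
  assumes "a \<in> set vs" "b \<in> set vs"
  shows "between a b \<subseteq> dn \<union> up"
proof
  fix w assume w: "w \<in> between a b"
  then have wS: "w \<in> set vs" using support_convex[OF rope_props(1)] assms backbone_vs(1) by blast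
  have S: "insert u (insert v (between u v)) = set vs"
    using backbone_vs(1) transitive_support_arc[OF rope_props(1)] by simp
  have "(x, u) \<notin> A" "(v, x) \<notin> A" if "x \<in> set vs" for x
    using that asym rope_props(1) arc_neq unfolding S[symmetric] by auto
  then have "w \<noteq> u" "w \<noteq> v" using w assms by auto
  then show "w \<in> dn \<union> up" using wS rope_props(3) S by auto
qed

text \<open>The vertices between \<open>a\<close> and \<open>b\<close> occupy the positions strictly
  between theirs, so this is \<open>path_support_exchange\<close>. The condition that
  \<open>W\<close> splits them in the same way as the rope becomes the subrope condition in
  \<open>vertex_flip\<close>.\<close>

lemma g_exchange:
  assumes ab: "a \<in> set vs" "b \<in> set vs" "(a, b) \<in> A" "a \<notin> W" "b \<notin> W"
  defines "L \<equiv> g (insert a (insert b W)) + g W - g (insert a W) - g (insert b W)"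
  shows "\<forall>w \<in> between a b. w \<in> W \<longleftrightarrow> w \<in> dn \<Longrightarrow> L > 0" "\<not> (\<forall>w \<in> between a b. w \<in> W \<longleftrightarrow> w \<in> dn) \<Longrightarrow> L = 0"
proof -
  obtain k l where k: "k < length vs" "a = vs ! k" and l: "l < length vs" "b = vs ! l"
    using ab by (auto simp: in_set_conv_nth)
  have kl: "k < l" using vs_less_iff k l ab by simp
  have pos: "positions vs (insert a W') = insert (Suc k) (positions vs W')"
    "positions vs (insert b W') = insert (Suc l) (positions vs W')" for W'
    using positions_insert[OF backbone_vs(2)] k l by auto
  have mem: "Suc m \<in> positions vs W' \<longleftrightarrow> vs ! m \<in> W'" if "m < length vs" for m W'
    using that by (simp add: positions_def)
  have btw: "w \<in> between a b \<longleftrightarrow> (\<exists>m. k < m \<and> m < l \<and> w = vs ! m)" for w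
  proof
    assume w: "w \<in> between a b"
    then have "w \<in> set vs" using between_vs[OF ab(1,2)] signature by blast
    then obtain m where "m < length vs" "w = vs ! m" by (auto simp: in_set_conv_nth)
    then show "\<exists>m. k < m \<and> m < l \<and> w = vs ! m" using w vs_less_iff k l by auto
  next
    assume "\<exists>m. k < m \<and> m < l \<and> w = vs ! m"
    then show "w \<in> between a b" using vs_less_iff k l by auto
  qed
  have up: "w \<in> dn \<longleftrightarrow> w \<notin> up" if "w \<in> between a b" for w
    using that between_vs[OF ab(1,2)] rope_props(2) by blast
  have "positions vs W \<inter> {Suc k<..<Suc l} = {Suc k<..<Suc l} - positions vs up \<longleftrightarrow>
      (\<forall>m. k < m \<and> m < l \<longrightarrow> (Suc m \<in> positions vs W \<longleftrightarrow> Suc m \<notin> positions vs up))" (is "?lhs \<longleftrightarrow> ?rhs")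
  proof
    assume ?rhs
    show ?lhs
    proof (rule Set.set_eqI)
      fix i
      show "i \<in> positions vs W \<inter> {Suc k<..<Suc l} \<longleftrightarrow> i \<in> {Suc k<..<Suc l} - positions vs up"
        using \<open>?rhs\<close>[rule_format, of "i - 1"] by (cases i) auto
    qed
  next
    assume l: ?lhs
    show ?rhs
    proof (intro allI impI)
      fix m assume "k < m \<and> m < l"
      then have "Suc m \<in> {Suc k<..<Suc l}" by simp
      then show "Suc m \<in> positions vs W \<longleftrightarrow> Suc m \<notin> positions vs up" using l by blast
    qed
  qed
  also have "\<dots> \<longleftrightarrow> (\<forall>w \<in> between a b. w \<in> W \<longleftrightarrow> w \<notin> up)"
    unfolding Ball_def btw using l(1) by (auto simp: mem)
  also have "\<dots> \<longleftrightarrow> (\<forall>w \<in> between a b. w \<in> W \<longleftrightarrow> w \<in> dn)" using up by auto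
  finally have gap: "positions vs W \<inter> {Suc k<..<Suc l} = {Suc k<..<Suc l} - positions vs up \<longleftrightarrow>
      (\<forall>w \<in> between a b. w \<in> W \<longleftrightarrow> w \<in> dn)" .
  have "Suc k \<notin> positions vs W" "Suc l \<notin> positions vs W" using ab k l by (auto simp: mem)
  then have ex: "positions vs W \<inter> {Suc k<..<Suc l} \<noteq> {Suc k<..<Suc l} - positions vs up \<Longrightarrow> L = 0"
    "positions vs W \<inter> {Suc k<..<Suc l} = {Suc k<..<Suc l} - positions vs up \<Longrightarrow> L > 0"
    unfolding L_def g_eq pos
    using path_support_exchange[OF positions_subset positions_subset, of "Suc k" "Suc l" vs W up] k l kl
    by (simp_all add: Suc_le_eq)
  show "L > 0" if "\<forall>w \<in> between a b. w \<in> W \<longleftrightarrow> w \<in> dn" using ex(2) gap that by blast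
  show "L = 0" if "\<not> (\<forall>w \<in> between a b. w \<in> W \<longleftrightarrow> w \<in> dn)" using ex(1) gap that by blast
qed

lemma g_supermodular:
  assumes "a \<in> set vs - W" "b \<in> set vs - W" "a \<noteq> b"
  shows "g (insert a W) + g (insert b W) \<le> g (insert a (insert b W)) + g W"
proof -
  have *: "g (insert x W) + g (insert y W) \<le> g (insert x (insert y W)) + g W"
    if "x \<in> set vs - W" "y \<in> set vs - W" "(x, y) \<in> A" for x y
    using g_exchange[of x y W] that by (cases "\<forall>w \<in> between x y. w \<in> W \<longleftrightarrow> w \<in> dn") auto
  consider "(a, b) \<in> A" | "(b, a) \<in> A" using vs_clique assms by blast
  then show ?thesis
  proof cases
    case 1
    then show ?thesis using * assms by blast
  next
    case 2
    then show ?thesis using *[of b a] assms by (simp add: insert_commute)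
  qed
qed

lemma cambrian_associahedron_eq:
  "cambrian_associahedron A (u, v, dn, up) = associahedron vs dn up"
  by (simp add: vs_def)

text \<open>Together with \<open>associahedronI\<close> this identifies the associahedron with the
  base polytope of \<open>g\<close>: the facet inequalities imply those for all subsets by adding
  along paths, and are special cases of them by \<open>path_support_facet\<close>.\<close>

lemma associahedron_bound:
  assumes z: "z \<in> associahedron vs dn up" and W: "W \<subseteq> set vs"
  shows "g W \<le> (\<Sum>w \<in> W. z $ w)" "(\<Sum>w \<in> set vs. z $ w) = g (set vs)"
proof -
  let ?z = "\<lambda>i. z $ (vs ! (i - 1))"
  show tot: "(\<Sum>w \<in> set vs. z $ w) = g (set vs)"
    using z by (simp add: associahedron_def inner_ones g_full triangular_of_nat)
  have sums: "sum ?z (positions vs W') = (\<Sum>w \<in> W' \<inter> set vs. z $ w)" for W'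
    by (rule sum_positions[OF backbone_vs(2)])
  have "path_support (length vs) (positions vs up) (positions vs W) \<le> sum ?z (positions vs W)"
  proof (rule path_support_le[OF positions_subset positions_subset])
    show "sum ?z {1..length vs} = triangular (length vs)"
      using sums[of "set vs"] tot unfolding positions_set g_full by simp
  next
    fix U assume U: "facet_set (length vs) (positions vs up) U"
    define U' where "U' = (\<lambda>i. vs ! (i - 1)) ` U"
    have "U \<subseteq> {1..length vs}" using U by (auto simp: facet_set_def)
    then have U': "positions vs U' = U" unfolding U'_def
      by (rule positions_image[OF backbone_vs(2)])
    have "vs ! (i - 1) \<in> set vs" if "i \<in> U" for i
    proof -
      have "i \<in> {1..length vs}" using that \<open>U \<subseteq> {1..length vs}\<close> by blast
      then show ?thesis by (intro nth_mem) auto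
    qed
    then have U's: "U' \<subseteq> set vs" by (auto simp: U'_def)
    then have "associahedron_facet_set vs dn up U'"
      using associahedron_facet_set_positions[OF backbone_vs(2) rope_props(2) signature U's] U U'
      by simp
    then have "triangular (card U') \<le> (\<Sum>w \<in> U'. z $ w)"
      using z by (simp add: associahedron_def inner_ones triangular_of_nat)
    moreover have "card U = card U'" using card_positions[OF backbone_vs(2), of U'] U' U's
      by (simp add: Int_absorb2)
    ultimately show "triangular (card U) \<le> sum ?z U" using sums[of U'] U' U's
      by (simp add: Int_absorb2)
  qed
  then show "g W \<le> (\<Sum>w \<in> W. z $ w)" using sums[of W] W by (simp add: g_eq Int_absorb2)
qed

lemma associahedronI:
  assumes "\<And>w. w \<notin> set vs \<Longrightarrow> z $ w = 0" "(\<Sum>w \<in> set vs. z $ w) = g (set vs)"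
    and "\<And>U. U \<subseteq> set vs \<Longrightarrow> g U \<le> (\<Sum>w \<in> U. z $ w)"
  shows "z \<in> associahedron vs dn up"
proof -
  have "real ((card U + 1) choose 2) \<le> (\<Sum>w \<in> U. z $ w)" if U: "associahedron_facet_set vs dn up U" for U
  proof -
    have US: "U \<subseteq> set vs" using U by (auto simp: associahedron_facet_set_def)
    have "g U = triangular (card U)"
      using path_support_facet[OF positions_subset, of vs up "positions vs U"] card_positions[OF backbone_vs(2), of U] US U
        associahedron_facet_set_positions[OF backbone_vs(2) rope_props(2) signature US]
      by (simp add: g_eq Int_absorb2)
    then show ?thesis using assms(3)[OF US] by (simp add: triangular_of_nat)
  qed
  then show ?thesis
    using assms(1,2) by (simp add: associahedron_def inner_ones g_full triangular_of_nat)
qed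

definition vertex :: "('v \<times> 'v) set \<Rightarrow> real ^ 'v" where
  "vertex E = rope_vertex A (u, v, dn, up) E"

lemma vertex_coordinate:
  "vertex E $ w = (if w \<in> set vs then g (insert w ({z. (z, w) \<in> reorient A E} \<inter> set vs))
     - g ({z. (z, w) \<in> reorient A E} \<inter> set vs) else 0)"
proof -
  have "g (insert w (W \<inter> set vs)) = g (insert w W)" if "w \<in> set vs" for W
    using g_Int[of "insert w W"] that by (simp add: Int_insert_left)
  then show ?thesis unfolding vertex_def rope_vertex_def set_vs[symmetric] g_def[symmetric] g_Int
    by simp
qed

text \<open>An acyclic reorientation orders the clique \<open>set vs\<close> linearly, so the
  predecessors of an entry form a prefix and the selected vertex is the greedy vector of this
  order.\<close>

lemma reorientation_list:
  assumes E: "E \<in> \<R>"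
  obtains ws where "set ws = set vs" "distinct ws" "sorted_wrt (\<lambda>a b. (a, b) \<in> reorient A E) ws"
    "\<And>k. k < length ws \<Longrightarrow> vertex E $ (ws ! k) = g (insert (ws ! k) (set (take k ws))) - g (set (take k ws))"
proof -
  let ?B = "reorient A E"
  have acyc: "acyclic ?B" using E by (auto simp: acyclic_reorientations_def)
  have tot: "(a, b) \<in> ?B \<or> (b, a) \<in> ?B" if "a \<in> set vs" "b \<in> set vs" "a \<noteq> b" for a b
    using vs_clique[OF that] reorient_cases[OF AR_subset[OF E]] by blast
  obtain ws where ws: "set ws = set vs" "distinct ws" "sorted_wrt (\<lambda>a b. (a, b) \<in> ?B) ws"
    by (rule sorted_list_of_acyclic[of "set vs" ?B]) (use acyc tot in auto)
  have "{z. (z, ws ! k) \<in> ?B} \<inter> set vs = set (take k ws)" if k: "k < length ws" for k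
  proof (intro equalityI subsetI)
    fix z assume "z \<in> {z. (z, ws ! k) \<in> ?B} \<inter> set vs"
    then obtain m where m: "m < length ws" "z = ws ! m" "(ws ! m, ws ! k) \<in> ?B"
      unfolding ws(1)[symmetric] by (auto simp: in_set_conv_nth)
    have "\<not> k < m" using sorted_wrt_nth_less[OF ws(3) _ m(1), of k] m(3) acyclic_imp_asym[OF acyc]
      by blast
    moreover have "k \<noteq> m" using m(3) acyclic_imp_neq[OF acyc] by blast
    ultimately have "m < length (take k ws)" "take k ws ! m = z" using m k by auto
    then show "z \<in> set (take k ws)" by (metis nth_mem)
  next
    fix z assume "z \<in> set (take k ws)"
    then obtain m where m: "m < k" "z = ws ! m" using k by (auto simp: in_set_conv_nth)
    then show "z \<in> {z. (z, ws ! k) \<in> ?B} \<inter> set vs"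
      using sorted_wrt_nth_less[OF ws(3) m(1) k] k nth_mem[of m ws] ws(1) by auto
  qed
  then have "vertex E $ (ws ! k) = g (insert (ws ! k) (set (take k ws))) - g (set (take k ws))" if "k < length ws" for k
    using that nth_mem[OF that] unfolding vertex_coordinate ws(1) by simp
  then show thesis using that ws by blast
qed

lemma vertex_in_associahedron:
  assumes E: "E \<in> \<R>"
  shows "vertex E \<in> associahedron vs dn up"
proof -
  obtain ws where ws: "set ws = set vs" "distinct ws" "sorted_wrt (\<lambda>a b. (a, b) \<in> reorient A E) ws"
    "\<And>k. k < length ws \<Longrightarrow> vertex E $ (ws ! k) = g (insert (ws ! k) (set (take k ws))) - g (set (take k ws))"
    using reorientation_list[OF E] by blast
  show ?thesis
  proof (rule associahedronI)
    show "vertex E $ w = 0" if "w \<notin> set vs" for w using that by (simp add: vertex_coordinate)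
    show "(\<Sum>w \<in> set vs. vertex E $ w) = g (set vs)"
      using greedy_prefix[of ws "\<lambda>w. vertex E $ w" g "length ws"] ws by (simp add: g_empty)
    show "g U \<le> (\<Sum>w \<in> U. vertex E $ w)" if "U \<subseteq> set vs" for U
      using greedy_feasible[of ws g "\<lambda>w. vertex E $ w" U] g_supermodular ws that
      by (simp add: g_empty)
  qed
qed

lemma inner_vs:
  assumes "\<And>w. w \<notin> set vs \<Longrightarrow> z $ w = 0"
  shows "y \<bullet> z = (\<Sum>w \<in> set vs. y $ w * z $ w)"
  unfolding inner_vec_def inner_real_def
  by (rule sum.mono_neutral_right) (use assms in auto)

lemma vertex_maximal:
  assumes E: "E \<in> \<R>" and y: "y \<in> reorientation_cone A E" and z: "z \<in> associahedron vs dn up"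
  shows "y \<bullet> z \<le> y \<bullet> vertex E"
proof -
  obtain ws where ws: "set ws = set vs" "distinct ws" "sorted_wrt (\<lambda>a b. (a, b) \<in> reorient A E) ws"
    "\<And>k. k < length ws \<Longrightarrow> vertex E $ (ws ! k) = g (insert (ws ! k) (set (take k ws))) - g (set (take k ws))"
    using reorientation_list[OF E] by blast
  have pre: "sum (\<lambda>w. vertex E $ w) (set (take k ws)) = g (set (take k ws))" if "k \<le> length ws" for k
    using greedy_prefix[of ws "\<lambda>w. vertex E $ w" g k] ws that by (simp add: g_empty)
  \<comment> \<open>Prefixes of \<open>ws\<close> are tight at the selected vertex while
    \<open>z\<close> only satisfies the bound, so the prefix sums of the difference are
    nonpositive.\<close>
  have "0 \<le> (\<Sum>w \<in> set ws. y $ w * (vertex E $ w - z $ w))"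
  proof (rule sum_by_parts_nonneg[OF ws(2)])
    show "sorted_wrt (\<lambda>a b. y $ a \<le> y $ b) ws"
      using ws(3)
      by (rule sorted_wrt_mono_rel[rotated]) (use y in \<open>auto simp: reorientation_cone_def\<close>)
    show "(\<Sum>w \<in> set (take k ws). vertex E $ w - z $ w) \<le> 0" if "k \<le> length ws" for k
      using pre[OF that] associahedron_bound(1)[OF z, of "set (take k ws)"] set_take_subset[of k ws] ws(1)
      by (simp add: sum_subtractf)
    show "(\<Sum>w \<in> set ws. vertex E $ w - z $ w) = 0"
      using pre[of "length ws"] associahedron_bound(2)[OF z order.refl] ws(1)
      by (simp add: sum_subtractf)
  qed
  moreover have "y \<bullet> z = (\<Sum>w \<in> set vs. y $ w * z $ w)"
    by (rule inner_vs) (use z in \<open>simp add: associahedron_def\<close>)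
  moreover have "y \<bullet> vertex E = (\<Sum>w \<in> set vs. y $ w * vertex E $ w)"
    by (rule inner_vs) (simp add: vertex_coordinate)
  ultimately show ?thesis using ws(1) by (simp add: right_diff_distrib sum_subtractf)
qed

text \<open>If \<open>a\<close> and \<open>b\<close> are both on the rope, they are adjacent in the
  linear order and the flip exchanges them. Only their two increments change, by opposite amounts
  given by the second difference of \<open>g\<close> at their common predecessors \<open>W\<close>.
  If one of them is off the rope, no predecessor set within the rope changes.\<close>

lemma vertex_flip:
  assumes fl: "flip E a b"
  shows "\<exists>c \<ge> 0. vertex (insert (a, b) E) = vertex E + c *\<^sub>R (axis a 1 - axis b 1) \<and>
    (c = 0 \<longleftrightarrow> \<not> subrope (flip_rope E a b) (u, v, dn, up))"
proof -
  let ?E = "insert (a, b) E"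
  have E: "E \<in> \<R>" "?E \<in> \<R>" "(a, b) \<in> A" "(a, b) \<notin> E" using fl by (auto simp: flip_def)
  note sub = E(1,2)[THEN AR_subset]
  define B where "B = reorient A E"
  define B' where "B' = reorient A ?E"
  have acyc: "acyclic B" "acyclic B'" using E
    by (auto simp: acyclic_reorientations_def B_def B'_def)
  have flipped: "(a, b) \<in> B" "(b, a) \<in> B'" using E(3,4) by (auto simp: B_def B'_def reorient_def)
  note ab = flipped acyclic_imp_asym[OF acyc(1) flipped(1)] acyclic_imp_asym[OF acyc(2) flipped(2)]
  have same: "(s, t) \<in> B' \<longleftrightarrow> (s, t) \<in> B" if "(s, t) \<noteq> (a, b)" "(s, t) \<noteq> (b, a)" for s t
    using that by (auto simp: B_def B'_def reorient_def)
  have neq: "a \<noteq> b" using E arc_neq by blast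
  have other: "vertex ?E $ w = vertex E $ w" if "w \<noteq> a" "w \<noteq> b" for w
    unfolding vertex_coordinate B_def[symmetric] B'_def[symmetric] using same that by simp
  show ?thesis
  proof (cases "a \<in> set vs \<and> b \<in> set vs")
    case True
    define W where "W = {z. (z, a) \<in> B} \<inter> set vs"
    \<comment> \<open>A vertex placed between \<open>a\<close> and \<open>b\<close> would close a
      cyclic triangle before or after the flip.\<close>
    have adj: "(z, a) \<in> B \<longleftrightarrow> (z, b) \<in> B" if z: "z \<in> set vs" "z \<noteq> a" "z \<noteq> b" for z
    proof
      assume "(z, a) \<in> B"
      then have "(b, z) \<notin> B" using ab acyclic_no_triangle[OF acyc(1)] by blast
      then show "(z, b) \<in> B"
        using vs_clique[of z b] True z reorient_cases[OF sub(1), of z b] by (auto simp: B_def)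
    next
      assume "(z, b) \<in> B"
      then have "(z, b) \<in> B'" using same z by auto
      then have "(a, z) \<notin> B'" using ab acyclic_no_triangle[OF acyc(2)] by blast
      then have "(a, z) \<notin> B" using same z by auto
      then show "(z, a) \<in> B"
        using vs_clique[of z a] True z reorient_cases[OF sub(1), of z a] by (auto simp: B_def)
    qed
    have irr: "(s, s) \<notin> B" "(s, s) \<notin> B'" for s
      using acyclic_imp_neq[OF acyc(1), of s s] acyclic_imp_neq[OF acyc(2), of s s] by blast+
    have aW: "a \<notin> W" "b \<notin> W" using irr ab by (auto simp: W_def)
    have below: "{z. (z, b) \<in> B} \<inter> set vs = insert a W" "{z. (z, b) \<in> B'} \<inter> set vs = W"
      "{z. (z, a) \<in> B'} \<inter> set vs = insert b W"
    proof -
      have "z \<in> {z. (z, b) \<in> B} \<inter> set vs \<longleftrightarrow> z \<in> insert a W" for z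
        using ab adj[of z] True irr by (cases "z = a"; cases "z = b") (auto simp: W_def)
      then show "{z. (z, b) \<in> B} \<inter> set vs = insert a W" by blast
      have "z \<in> {z. (z, b) \<in> B'} \<inter> set vs \<longleftrightarrow> z \<in> W" for z
        using ab adj[of z] same[of z b] True irr
        by (cases "z = a"; cases "z = b") (auto simp: W_def)
      then show "{z. (z, b) \<in> B'} \<inter> set vs = W" by blast
      have "z \<in> {z. (z, a) \<in> B'} \<inter> set vs \<longleftrightarrow> z \<in> insert b W" for z
        using ab same[of z a] True irr by (cases "z = a"; cases "z = b") (auto simp: W_def)
      then show "{z. (z, a) \<in> B'} \<inter> set vs = insert b W" by blast
    qed
    define c where "c = g (insert a (insert b W)) + g W - g (insert a W) - g (insert b W)"
    have xa: "vertex E $ a = g (insert a W) - g W" "vertex ?E $ a = g (insert a (insert b W)) - g (insert b W)"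
      and xb: "vertex E $ b = g (insert b (insert a W)) - g (insert a W)" "vertex ?E $ b = g (insert b W) - g W"
      unfolding vertex_coordinate B_def[symmetric] B'_def[symmetric] below using True
      by (simp_all add: W_def)
    have "vertex ?E $ w = (vertex E + c *\<^sub>R (axis a 1 - axis b 1)) $ w" for w
    proof -
      consider "w = a" | "w = b" | "w \<noteq> a" "w \<noteq> b" by blast
      then show ?thesis
        by cases (use neq other xa xb in \<open>auto simp: axis_def c_def insert_commute\<close>)
    qed
    then have "vertex ?E = vertex E + c *\<^sub>R (axis a 1 - axis b 1)" by (simp add: vec_eq_iff)
    moreover have "c > 0 \<longleftrightarrow> subrope (flip_rope E a b) (u, v, dn, up)" "c \<ge> 0"
    proof -
      note ex = g_exchange[of a b W, folded c_def, OF _ _ E(3) aW]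
      have mem: "w \<in> W \<longleftrightarrow> (a, w) \<in> E" if "w \<in> between a b" for w
      proof -
        have "w \<in> set vs" using between_vs[of a b] True that signature by blast
        then show ?thesis using that asym mem_reorient[OF sub(1), of w a]
          by (auto simp: W_def B_def)
      qed
      have "subrope (flip_rope E a b) (u, v, dn, up) \<longleftrightarrow> (\<forall>w \<in> between a b. w \<in> W \<longleftrightarrow> w \<in> dn)"
      proof
        assume s: "subrope (flip_rope E a b) (u, v, dn, up)"
        then show "\<forall>w \<in> between a b. w \<in> W \<longleftrightarrow> w \<in> dn"
          using mem rope_props(2) unfolding flip_rope_def by auto
      next
        assume s: "\<forall>w \<in> between a b. w \<in> W \<longleftrightarrow> w \<in> dn"
        have "{w \<in> between a b. (a, w) \<in> E} \<subseteq> dn" using s mem by blast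
        moreover have "{w \<in> between a b. (a, w) \<notin> E} \<subseteq> up" using s mem between_vs[of a b] True
          by blast
        ultimately show "subrope (flip_rope E a b) (u, v, dn, up)"
          using True set_vs unfolding flip_rope_def by simp
      qed
      then show "c > 0 \<longleftrightarrow> subrope (flip_rope E a b) (u, v, dn, up)" "c \<ge> 0"
        using ex True by fastforce+
    qed
    ultimately show ?thesis by (metis less_eq_real_def order_less_irrefl)
  next
    case False
    have "vertex ?E $ w = vertex E $ w" for w
    proof (cases "w \<in> set vs \<and> (w = a \<or> w = b)")
      case True
      then have "(z, w) \<in> B' \<longleftrightarrow> (z, w) \<in> B" if "z \<in> set vs" for z
        using False same[of z w] that by blast
      then have "{z. (z, w) \<in> B'} \<inter> set vs = {z. (z, w) \<in> B} \<inter> set vs" by blast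
      then show ?thesis unfolding vertex_coordinate B_def[symmetric] B'_def[symmetric] by simp
    next
      case False
      then show ?thesis using other[of w] by (auto simp: vertex_coordinate)
    qed
    then have "vertex ?E = vertex E" by (simp add: vec_eq_iff)
    moreover have "\<not> subrope (flip_rope E a b) (u, v, dn, up)"
      using False set_vs by (auto simp: flip_rope_def)
    ultimately show ?thesis by (intro exI[of _ 0]) simp
  qed
qed

lemma convex_associahedron: "convex (associahedron vs dn up)"
proof -
  have "associahedron vs dn up = (\<Inter>w \<in> - set vs. {z. axis w 1 \<bullet> z = 0}) \<inter>
     {z. ones (set vs) \<bullet> z = real ((length vs + 1) choose 2)} \<inter>
     (\<Inter>U \<in> {U. associahedron_facet_set vs dn up U}. {z. ones U \<bullet> z \<ge> real ((card U + 1) choose 2)})"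
    by (auto simp: associahedron_def inner_axis')
  then show ?thesis
    by (auto intro!: convex_Int convex_INT convex_hyperplane convex_halfspace_ge)
qed

end

section \<open>All generating ropes together\<close>

context skeletal_dag
begin

lemma skeletal_ropeI: "(u, v, dn, up) \<in> ropes A \<Longrightarrow> skeletal_rope A u v dn up"
  by (intro skeletal_rope.intro skeletal_rope_axioms.intro skeletal_dag_axioms)

lemma rope_vertex_props:
  assumes "\<rho> \<in> ropes A"
  shows "convex (cambrian_associahedron A \<rho> :: (real ^ 'v) set)"
    and "E \<in> \<R> \<Longrightarrow> rope_vertex A \<rho> E \<in> cambrian_associahedron A \<rho>"
    and "E \<in> \<R> \<Longrightarrow> y \<in> reorientation_cone A E \<Longrightarrow> z \<in> cambrian_associahedron A \<rho>
      \<Longrightarrow> y \<bullet> z \<le> y \<bullet> rope_vertex A \<rho> E"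
    and "flip E a b \<Longrightarrow> \<exists>c \<ge> 0. rope_vertex A \<rho> (insert (a, b) E) = rope_vertex A \<rho> E + c *\<^sub>R (axis a 1 - axis b 1)
      \<and> (c = 0 \<longleftrightarrow> \<not> subrope (flip_rope E a b) \<rho>)"
proof -
  obtain u v dn up where e: "\<rho> = (u, v, dn, up)" by (cases \<rho>) auto
  interpret skeletal_rope A u v dn up using assms by (intro skeletal_ropeI) (simp add: e)
  show "convex (cambrian_associahedron A \<rho> :: (real ^ 'v) set)"
    unfolding e cambrian_associahedron_eq by (rule convex_associahedron)
  show "rope_vertex A \<rho> E \<in> cambrian_associahedron A \<rho>" if "E \<in> \<R>"
    using vertex_in_associahedron[OF that] unfolding e cambrian_associahedron_eq vertex_def .
  show "y \<bullet> z \<le> y \<bullet> rope_vertex A \<rho> E"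
    if "E \<in> \<R>" "y \<in> reorientation_cone A E" "z \<in> cambrian_associahedron A \<rho>"
    using vertex_maximal[OF that(1,2)] that(3) unfolding e cambrian_associahedron_eq vertex_def .
  show "\<exists>c \<ge> 0. rope_vertex A \<rho> (insert (a, b) E) = rope_vertex A \<rho> E + c *\<^sub>R (axis a 1 - axis b 1)
      \<and> (c = 0 \<longleftrightarrow> \<not> subrope (flip_rope E a b) \<rho>)" if "flip E a b"
    using vertex_flip[OF that] unfolding e vertex_def .
qed

lemma strict_point:
  assumes "E \<in> \<R>"
  obtains y :: "real ^ 'v" where "\<And>a b. (a, b) \<in> reorient A E \<Longrightarrow> y $ a < y $ b"
proof
  let ?B = "reorient A E" and ?y = "\<chi> w. real (card {z. (z, w) \<in> (reorient A E)\<^sup>+})"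
  have acyc: "acyclic ?B" using assms by (auto simp: acyclic_reorientations_def)
  fix a b assume ab: "(a, b) \<in> ?B"
  have "{z. (z, a) \<in> ?B\<^sup>+} \<subset> {z. (z, b) \<in> ?B\<^sup>+}"
  proof
    show "{z. (z, a) \<in> ?B\<^sup>+} \<subseteq> {z. (z, b) \<in> ?B\<^sup>+}" using ab by (auto intro: trancl.intros)
    show "{z. (z, a) \<in> ?B\<^sup>+} \<noteq> {z. (z, b) \<in> ?B\<^sup>+}" using ab acyc by (auto simp: acyclic_def)
  qed
  then have "card {z. (z, a) \<in> ?B\<^sup>+} < card {z. (z, b) \<in> ?B\<^sup>+}" by (intro psubset_card_mono) auto
  then show "?y $ a < ?y $ b" by simp
qed

lemma reorientation_cone_halfspaces:
  "reorientation_cone A E = (\<Inter>(a, b) \<in> reorient A E. {y. y $ a \<le> y $ b})"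
  by (auto simp: reorientation_cone_def)

lemma closed_reorientation_cone: "closed (reorientation_cone A E :: (real ^ 'v) set)"
  unfolding reorientation_cone_halfspaces
  by (auto intro!: closed_INT closed_Collect_le continuous_intros)

lemma interior_reorientation_cone:
  assumes "E \<in> \<R>"
  shows "interior (reorientation_cone A E :: (real ^ 'v) set) \<noteq> {}"
proof -
  let ?U = "(\<Inter>(a, b) \<in> reorient A E. {y :: real ^ 'v. y $ a < y $ b})"
  have "open ?U" by (auto intro!: open_INT open_Collect_less continuous_intros)
  moreover have "?U \<subseteq> reorientation_cone A E" by (force simp: reorientation_cone_halfspaces)
  moreover obtain y :: "real ^ 'v" where "\<And>a b. (a, b) \<in> reorient A E \<Longrightarrow> y $ a < y $ b"
    using strict_point[OF assms] by blast
  then have "y \<in> ?U" by auto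
  ultimately show ?thesis using interior_maximal by blast
qed

lemma reorientation_cones_cover: "\<exists>E \<in> \<R>. y \<in> reorientation_cone A E"
proof -
  \<comment> \<open>Arcs along which \<open>y\<close> is constant keep their direction; strict
    decrease is closed and coclosed.\<close>
  define E where "E = {(a, b) \<in> A. y $ b < y $ a}"
  have sub: "E \<subseteq> A" by (auto simp: E_def)
  have "E \<in> \<R>"
    unfolding mem_AR_iff by (auto simp: E_def)
  moreover have "y \<in> reorientation_cone A E"
    by (auto simp: reorientation_cone_def reorient_def E_def)
  ultimately show ?thesis by blast
qed

definition congruence_vertex :: "(('v \<times> 'v) set \<times> ('v \<times> 'v) set) set \<Rightarrow> ('v \<times> 'v) set \<Rightarrow> real ^ 'v" where
  "congruence_vertex r E = (\<Sum>\<rho> \<in> generating_ropes A r. rope_vertex A \<rho> E)"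

lemma generating_ropes_subset: "generating_ropes A r \<subseteq> ropes A"
  by (auto simp: generating_ropes_def rope_ideal_def)

text \<open>All summands move in the same direction by nonnegative amounts, so nothing cancels: the
  sum stays put iff the flip rope is a subrope of no generating rope, that is, iff it is outside the
  rope ideal.\<close>

lemma congruence_vertex_flip:
  assumes r: "lattice_congruence (AR A) r" and fl: "flip E a b"
  shows "\<exists>c \<ge> 0. congruence_vertex r (insert (a, b) E) = congruence_vertex r E + c *\<^sub>R (axis a 1 - axis b 1)
    \<and> (c = 0 \<longleftrightarrow> (E, insert (a, b) E) \<in> r)"
proof -
  let ?G = "generating_ropes A r"
  have "\<forall>\<rho> \<in> ?G. \<exists>c. c \<ge> 0 \<and> rope_vertex A \<rho> (insert (a, b) E) = rope_vertex A \<rho> E + c *\<^sub>R (axis a 1 - axis b 1)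
    \<and> (c = 0 \<longleftrightarrow> \<not> subrope (flip_rope E a b) \<rho>)"
    using rope_vertex_props(4)[OF _ fl] generating_ropes_subset by blast
  then obtain c where c: "\<And>\<rho>. \<rho> \<in> ?G \<Longrightarrow> c \<rho> \<ge> 0"
    "\<And>\<rho>. \<rho> \<in> ?G \<Longrightarrow> rope_vertex A \<rho> (insert (a, b) E) = rope_vertex A \<rho> E + c \<rho> *\<^sub>R (axis a 1 - axis b 1)"
    "\<And>\<rho>. \<rho> \<in> ?G \<Longrightarrow> c \<rho> = 0 \<longleftrightarrow> \<not> subrope (flip_rope E a b) \<rho>" by metis
  have fin: "finite ?G" by simp
  have "sum c ?G = 0 \<longleftrightarrow> (\<forall>\<rho> \<in> ?G. \<not> subrope (flip_rope E a b) \<rho>)"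
    using c fin by (subst sum_nonneg_eq_0_iff) auto
  also have "\<dots> \<longleftrightarrow> (E, insert (a, b) E) \<in> r"
    using rope_ideal_generated[OF r, of "flip_rope E a b"] flip_congruence_iff[OF r fl] flip_rope_in_ropes fl
    by (auto simp: flip_def)
  finally have "sum c ?G = 0 \<longleftrightarrow> (E, insert (a, b) E) \<in> r" .
  moreover have "sum c ?G \<ge> 0" using c by (intro sum_nonneg)
  moreover have "congruence_vertex r (insert (a, b) E) = congruence_vertex r E + sum c ?G *\<^sub>R (axis a 1 - axis b 1)"
    unfolding congruence_vertex_def using c(2) by (simp add: sum.distrib scaleR_sum_left)
  ultimately show ?thesis by blast
qed

lemma congruence_vertex_in:
  assumes "E \<in> \<R>"
  shows "congruence_vertex r E \<in> (\<Sum>\<rho> \<in> generating_ropes A r. cambrian_associahedron A \<rho>)"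
  unfolding congruence_vertex_def
  using rope_vertex_props(2)[OF _ assms] generating_ropes_subset
  by (subst set_sum_alt) (simp, blast)

lemma congruence_vertex_maximal:
  assumes "E \<in> \<R>" "y \<in> reorientation_cone A E" "z \<in> (\<Sum>\<rho> \<in> generating_ropes A r. cambrian_associahedron A \<rho>)"
  shows "y \<bullet> z \<le> y \<bullet> congruence_vertex r E"
proof -
  obtain s where s: "z = (\<Sum>\<rho> \<in> generating_ropes A r. s \<rho>)"
    "\<And>\<rho>. \<rho> \<in> generating_ropes A r \<Longrightarrow> s \<rho> \<in> cambrian_associahedron A \<rho>"
    using assms(3) by (auto simp: set_sum_alt)
  show ?thesis
    unfolding s(1) congruence_vertex_def inner_sum_right
    using rope_vertex_props(3)[OF _ assms(1,2)] s(2) generating_ropes_subset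
    by (intro sum_mono) blast
qed

lemma congruence_iff_vertex:
  assumes r: "lattice_congruence (AR A) r" and E: "E \<in> \<R>" "E' \<in> \<R>"
  shows "(E, E') \<in> r \<longleftrightarrow> congruence_vertex r E = congruence_vertex r E'"
proof
  let ?p = "congruence_vertex r"
  let ?Q = "{(E, E') \<in> \<R> \<times> \<R>. ?p E = ?p E'}"
  have "r \<subseteq> ?Q"
  proof (rule congruence_subset[OF r])
    show "equiv \<R> ?Q" by (auto simp: equiv_def refl_on_def sym_def trans_def)
    fix K u v assume K: "flip K u v" "flip_rope K u v \<notin> rope_ideal A r"
    then have "(K, insert (u, v) K) \<in> r" using flip_congruence_iff[OF r] by blast
    then have "?p (insert (u, v) K) = ?p K" using congruence_vertex_flip[OF r K(1)] by auto
    then show "(K, insert (u, v) K) \<in> ?Q" using K by (auto simp: flip_def)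
  qed
  then show "?p E = ?p E'" if "(E, E') \<in> r" using that by blast
  obtain y :: "real ^ 'v" where y: "\<And>a b. (a, b) \<in> reorient A E' \<Longrightarrow> y $ a < y $ b"
    using strict_point[OF E(2)] by blast
  have yC: "y \<in> reorientation_cone A E'" using y by (auto simp: reorientation_cone_def less_imp_le)
  note sym = congruence_props(3)[OF r] and trans = congruence_props(4)[OF r]
  note E'A = AR_subset[OF E(2)]
  show "(E, E') \<in> r" if "?p E = ?p E'"
    using E(1) that
  proof (induction "card ((E - E') \<union> (E' - E))" arbitrary: E rule: less_induct)
    case less
    \<comment> \<open>As \<open>E\<close> and \<open>E'\<close> select the same vertex, the
      functional \<open>y\<close> taken from the cone of \<open>E'\<close> is also maximal at the
      vertex of \<open>E\<close>. A flip towards \<open>E'\<close> that moved the vertex would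
      increase it further.\<close>
    have max: "y \<bullet> ?p F \<le> y \<bullet> ?p E" if "F \<in> \<R>" for F
      unfolding less(3)
      by (rule congruence_vertex_maximal[OF E(2) yC congruence_vertex_in[OF that]])
    show ?case
    proof (cases "E = E'")
      case True
      then show ?thesis using congruence_props(2)[OF r E(2)] by simp
    next
      case False
      show ?thesis
      proof (rule exists_flip_towards[OF less(2) E(2) False])
        fix u v assume uv: "flip E u v" "(u, v) \<in> E'"
        let ?F = "insert (u, v) E"
        have F: "?F \<in> \<R>" "(u, v) \<notin> E" using uv by (auto simp: flip_def)
        obtain c where c: "c \<ge> 0" "?p ?F = ?p E + c *\<^sub>R (axis u 1 - axis v 1)" "c = 0 \<longleftrightarrow> (E, ?F) \<in> r"
          using congruence_vertex_flip[OF r uv(1)] by blast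
        \<comment> \<open>The arc is reversed in \<open>E'\<close>, so \<open>y\<close> strictly
          decreases along it and any positive \<open>c\<close> would raise the value of
          \<open>y\<close>.\<close>
        have "y $ v < y $ u" using uv(2) by (intro y) (auto simp: reorient_def)
        moreover have "c * (y $ u - y $ v) \<le> 0"
          using max[OF F(1)] unfolding c(2)
          by (simp add: inner_add_right inner_diff_right inner_axis)
        ultimately have "c = 0" using c(1) by (auto simp: mult_le_0_iff)
        then have 1: "(E, ?F) \<in> r" "?p ?F = ?p E'" using c less(3) by auto
        have "card ((?F - E') \<union> (E' - ?F)) < card ((E - E') \<union> (E' - E))"
          using uv F(2) by (intro psubset_card_mono) auto
        then have "(?F, E') \<in> r" using less(1) F(1) 1(2) by blast
        then show "(E, E') \<in> r" using 1(1) trans by blast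
      next
        fix u v assume uv: "(u, v) \<in> E" "(u, v) \<notin> E'" "flip (E - {(u, v)}) u v"
        let ?F = "E - {(u, v)}"
        have F: "?F \<in> \<R>" "insert (u, v) ?F = E" "(u, v) \<in> A" using uv by (auto simp: flip_def)
        obtain c where c: "c \<ge> 0" "?p E = ?p ?F + c *\<^sub>R (axis u 1 - axis v 1)" "c = 0 \<longleftrightarrow> (?F, E) \<in> r"
          using congruence_vertex_flip[OF r uv(3)] unfolding F(2) by blast
        have "y $ u < y $ v" using uv(2) F by (intro y) (auto simp: reorient_def)
        moreover have "c * (y $ v - y $ u) \<le> 0"
          using max[OF F(1)] unfolding c(2)
          by (simp add: inner_add_right inner_diff_right inner_axis algebra_simps)
        ultimately have "c = 0" using c(1) by (auto simp: mult_le_0_iff)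
        then have 1: "(E, ?F) \<in> r" "?p ?F = ?p E'" using c less(3) sym by auto
        have "card ((?F - E') \<union> (E' - ?F)) < card ((E - E') \<union> (E' - E))"
          using uv F by (intro psubset_card_mono) auto
        then have "(?F, E') \<in> r" using less(1) F(1) 1(2) by blast
        then show "(E, E') \<in> r" using 1(1) trans by blast
      qed
    qed
  qed
qed

lemma quotient_fan_eq_normal_fan:
  assumes r: "lattice_congruence (AR A) r"
  shows "quotient_fan A r = normal_fan (\<Sum>\<rho> \<in> generating_ropes A r. cambrian_associahedron A \<rho> :: (real ^ 'v) set)"
proof -
  let ?P = "\<Sum>\<rho> \<in> generating_ropes A r. cambrian_associahedron A \<rho> :: (real ^ 'v) set"
  interpret vertex_cones \<R> "reorientation_cone A" "congruence_vertex r" ?P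
  proof
    show "convex ?P"
      by (rule convex_sum_sets[OF finite_class.finite]) (use rope_vertex_props(1) generating_ropes_subset in blast)
  qed (use congruence_vertex_in congruence_vertex_maximal reorientation_cones_cover
        closed_reorientation_cone interior_reorientation_cone in auto)
  have "equiv \<R> r" using lattice_congruenceD(1)[OF r] by simp
  from fan_eq_normal_fan[OF this congruence_iff_vertex[OF r]]
  show ?thesis unfolding quotient_fan_def quotient_chambers_def by simp
qed

lemma cambrian_fan_eq_normal_fan:
  assumes "\<rho> \<in> ropes A"
  shows "cambrian_fan A \<rho> = normal_fan (cambrian_associahedron A \<rho> :: (real ^ 'v) set)"
  unfolding cambrian_fan_def quotient_fan_eq_normal_fan[OF rope_congruence(1)[OF assms]]
    rope_congruence(3)[OF assms] by simp

end

theorem theorem56: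
  fixes A :: "('v::finite \<times> 'v) set"
    and r :: "(('v \<times> 'v) set \<times> ('v \<times> 'v) set) set"
  assumes "acyclic A"
    and "skeletal A"
    and "lattice_congruence (AR A) r"
  shows "quotient_fan A r = common_refinement (generating_ropes A r) (cambrian_fan A) \<and>
         quotient_fan A r = normal_fan (\<Sum>\<rho> \<in> generating_ropes A r. cambrian_associahedron A \<rho>)"
proof
  interpret skeletal_dag A using assms by unfold_locales
  show fan: "quotient_fan A r = normal_fan (\<Sum>\<rho> \<in> generating_ropes A r. cambrian_associahedron A \<rho>)"
    by (rule quotient_fan_eq_normal_fan[OF assms(3)])
  have "normal_fan (\<Sum>\<rho> \<in> generating_ropes A r. cambrian_associahedron A \<rho>) =
      common_refinement (generating_ropes A r) (\<lambda>\<rho>. normal_fan (cambrian_associahedron A \<rho>))"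
    by (rule normal_fan_sum[OF finite_class.finite]) (use rope_vertex_props(1) generating_ropes_subset in blast)
  also have "\<dots> = common_refinement (generating_ropes A r) (cambrian_fan A)"
    using cambrian_fan_eq_normal_fan generating_ropes_subset unfolding common_refinement_def
    by (metis subsetD)
  finally show "quotient_fan A r = common_refinement (generating_ropes A r) (cambrian_fan A)"
    using fan by simp
qed

end
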